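(* Let $n\ge 1$, $0<p<q<\infty$ and $\alpha=1+n/q-n/p$. Then $H^p\subsetneq[\mathcal{B}^\alpha:H^q]$ (proper inclusion of sets of holomorphic functions on $\mathbb{B}_n$).
   Context: $\mathbb{B}_n=\{z\in\mathbb{C}^n:|z|<1\}$ is the open unit ball, $\mathbb{S}_n=\partial\mathbb{B}_n$ the unit sphere, $d\sigma$ the normalized surface measure on $\mathbb{S}_n$, and $H(\mathbb{B}_n)$ the space of holomorphic functions on $\mathbb{B}_n$. The radial derivative is $Rf(z)=\sum_{k=1}^n z_k\partial_{z_k}f(z)$. For $0<p<\infty$, the Hardy space $H^p$ consists of $f\in H(\mathbb{B}_n)$ with $\|f\|_{H^p}=\sup_{0\le s<1}\left(\int_{\mathbb{S}_n}|f(s\zeta)|^p\,d\sigma(\zeta)\right)^{1/p}<\infty$. The Bloch type space $\mathcal{B}^\alpha$ consists of $g\in H(\mathbb{B}_n)$ with $\sup_{z\in\mathbb{B}_n}(1-|z|^2)^\alpha|Rg(z)|<\infty$; if $\alpha<0$ it is understood to consist of the constants only. For $g\in H(\mathbb{B}_n)$ the Volterra integration operator on $H(\mathbb{B}_n)$ is $T_gf(z)=\int_0^1 f(tz)\,Rg(tz)\,\frac{dt}{t}$. The optimal domain is $[g:H^q]=\{f\in H(\mathbb{B}_n): T_gf\in H^q\}$, and for a set $V\subseteq H(\mathbb{B}_n)$ one writes $[V:H^q]=\bigcap_{g\in V}[g:H^q]$. *)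

theory Defs
  imports "HOL-Analysis.Analysis"
begin

text \<open>
  The space of \<open>n\<close> complex variables is \<^typ>\<open>complex ^ 'n\<close> with \<open>n = CARD('n)\<close>; its norm is the
  Euclidean one. A function on the unit ball is represented by a total function whose values
  outside \<^term>\<open>ball (0 :: complex ^ 'n) 1\<close> are arbitrary: membership in each of the sets of
  functions below depends only on the values inside the ball.
\<close>

definition holo_ball :: "(complex ^ 'n \<Rightarrow> complex) set" where
  "holo_ball = {f. \<forall>z\<in>ball 0 1. \<exists>D. (f has_derivative D) (at z) \<and> (\<forall>c v. D (c *s v) = c * D v)}"

definition partial_deriv :: "'n \<Rightarrow> (complex ^ 'n \<Rightarrow> complex) \<Rightarrow> complex ^ 'n \<Rightarrow> complex" where
  "partial_deriv k f z = deriv (\<lambda>w. f (\<chi> i. if i = k then w else z $ i)) (z $ k)"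

definition radial_deriv :: "(complex ^ 'n \<Rightarrow> complex) \<Rightarrow> complex ^ 'n \<Rightarrow> complex" where
  "radial_deriv f z = (\<Sum>k\<in>UNIV. z $ k * partial_deriv k f z)"

text \<open>
  Normalized surface measure, as a Borel measure on the sphere: the measure of \<open>A\<close> is the
  proportion of the volume of the ball taken up by the cone over \<open>A\<close>
  (see \<open>emeasure_sphere_measure\<close>). Restricting the space to the sphere, rather than using a measure
  on the whole space, makes integrals independent of values of the integrand off the sphere.
\<close>

definition sphere_measure :: "'a::euclidean_space measure" where
  "sphere_measure =
     distr (uniform_measure (restrict_space lborel (ball 0 1 - {0})) (ball 0 1 - {0}))
       (restrict_space borel (sphere 0 1)) (\<lambda>z. z /\<^sub>R norm z)"

lemma space_sphere_measure [simp]: "space sphere_measure = sphere 0 1"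
  by (simp add: sphere_measure_def space_restrict_space)

lemma sets_sphere_measure [measurable_cong]:
  "sets sphere_measure = sets (restrict_space borel (sphere 0 1))"
  by (simp add: sphere_measure_def)

lemma emeasure_sphere_measure:
  fixes A :: "'a::euclidean_space set"
  assumes A: "A \<in> sets borel" "A \<subseteq> sphere 0 1"
  shows "emeasure sphere_measure A =
    emeasure lborel {r *\<^sub>R x | r x. 0 < r \<and> r < 1 \<and> x \<in> A} / emeasure lborel (ball (0::'a) 1)"
proof -
  let ?B = "ball (0::'a) 1 - {0}"
  let ?h = "\<lambda>z::'a. z /\<^sub>R norm z"
  let ?M = "restrict_space lborel ?B"
  let ?C = "{r *\<^sub>R x | r x. 0 < r \<and> r < 1 \<and> x \<in> A}"
  have h: "?h \<in> restrict_space lborel ?B \<rightarrow>\<^sub>M restrict_space borel (sphere 0 1)"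
    by (rule measurable_restrict_space2) (auto intro!: measurable_restrict_space1)
  have A': "A \<in> sets (restrict_space borel (sphere 0 1))"
    using A by (auto simp: sets_restrict_space_iff)
  have C: "?h -` A \<inter> ?B = ?C"
  proof (intro equalityI subsetI)
    fix z assume z: "z \<in> ?h -` A \<inter> ?B"
    then have "z = norm z *\<^sub>R ?h z" "0 < norm z" "norm z < 1" "?h z \<in> A" by auto
    then show "z \<in> ?C" by blast
  next
    fix z assume "z \<in> ?C"
    then obtain r x where rx: "z = r *\<^sub>R x" "0 < r" "r < 1" "x \<in> A" by blast
    then have "norm x = 1" using A(2) by auto
    then show "z \<in> ?h -` A \<inter> ?B" using rx by auto
  qed
  have Cs: "?C \<in> sets ?M"
    using measurable_sets[OF h A'] by (simp add: C space_restrict_space)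
  have "emeasure lborel ?B = emeasure lborel (ball (0::'a) 1)"
    by (rule emeasure_Diff_null_set) auto
  moreover have "emeasure ?M ?B = emeasure lborel ?B"
    by (rule emeasure_restrict_space) auto
  moreover have "emeasure ?M (?B \<inter> ?C) = emeasure lborel ?C"
    using C by (subst emeasure_restrict_space) (auto intro!: arg_cong[where f="emeasure lborel"])
  moreover have "emeasure sphere_measure A = emeasure (uniform_measure ?M ?B) ?C"
    using h A' C unfolding sphere_measure_def
    by (subst emeasure_distr) (auto simp: space_restrict_space)
  moreover have "\<dots> = emeasure ?M (?B \<inter> ?C) / emeasure ?M ?B"
    using Cs by (intro emeasure_uniform_measure) (auto simp: sets_restrict_space_iff)
  ultimately show ?thesis by simp
qed

lemma emeasure_sphere_measure_sphere:
  "emeasure sphere_measure (sphere (0::'a::euclidean_space) 1) = 1"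
proof -
  let ?B = "ball (0::'a) 1"
  have "{r *\<^sub>R x | r x. 0 < r \<and> r < 1 \<and> x \<in> sphere (0::'a) 1} = ?B - {0}"
  proof (intro equalityI subsetI)
    fix z assume z: "z \<in> ?B - {0}"
    then have "z = norm z *\<^sub>R (z /\<^sub>R norm z)" "0 < norm z" "norm z < 1" "z /\<^sub>R norm z \<in> sphere 0 1"
      by auto
    then show "z \<in> {r *\<^sub>R x | r x. 0 < r \<and> r < 1 \<and> x \<in> sphere (0::'a) 1}" by blast
  qed auto
  moreover have "emeasure lborel (?B - {0}) = emeasure lborel ?B"
    by (rule emeasure_Diff_null_set) auto
  moreover have "emeasure lborel ?B \<noteq> 0"
    using emeasure_ball[of 1 "0::'a"] unit_ball_vol_pos[of "real DIM('a)"]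
    by (simp add: less_imp_neq[symmetric])
  moreover have "emeasure lborel ?B < top"
    using emeasure_lborel_ball_finite[of "0::'a" 1] by simp
  ultimately show ?thesis
    by (subst emeasure_sphere_measure) (auto intro!: ennreal_divide_self)
qed

definition hardy_norm :: "real \<Rightarrow> (complex ^ 'n \<Rightarrow> complex) \<Rightarrow> ennreal" where
  "hardy_norm p f =
     (SUP s\<in>{0..<1}. ennreal
        ((\<integral>\<zeta>. norm (f (s *\<^sub>R \<zeta>)) powr p \<partial>sphere_measure) powr (1 / p)))"

definition hardy :: "real \<Rightarrow> (complex ^ 'n \<Rightarrow> complex) set" where
  "hardy p = {f \<in> holo_ball. hardy_norm p f < \<infinity>}"

definition bloch :: "real \<Rightarrow> (complex ^ 'n \<Rightarrow> complex) set" where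
  "bloch \<alpha> =
     (if \<alpha> < 0 then {g \<in> holo_ball. \<exists>c. \<forall>z\<in>ball 0 1. g z = c}
      else {g \<in> holo_ball.
        (SUP z\<in>ball 0 1. ennreal ((1 - (norm z)\<^sup>2) powr \<alpha> * norm (radial_deriv g z))) < \<infinity>})"

text \<open>
  Since \<open>Rg\<close> vanishes at the origin, the integrand below is bounded near \<open>t = 0\<close>; at the single
  point \<open>t = 0\<close> its value is irrelevant.
\<close>

definition volterra ::
  "(complex ^ 'n \<Rightarrow> complex) \<Rightarrow> (complex ^ 'n \<Rightarrow> complex) \<Rightarrow> complex ^ 'n \<Rightarrow> complex" where
  "volterra g f z = integral {0..1} (\<lambda>t. f (t *\<^sub>R z) * radial_deriv g (t *\<^sub>R z) / of_real t)"

definition optimal_domain ::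
  "(complex ^ 'n \<Rightarrow> complex) \<Rightarrow> (complex ^ 'n \<Rightarrow> complex) set \<Rightarrow> (complex ^ 'n \<Rightarrow> complex) set" where
  "optimal_domain g X = {f \<in> holo_ball. volterra g f \<in> X}"

definition optimal_domain_set ::
  "(complex ^ 'n \<Rightarrow> complex) set \<Rightarrow> (complex ^ 'n \<Rightarrow> complex) set \<Rightarrow> (complex ^ 'n \<Rightarrow> complex) set" where
  "optimal_domain_set V X = (\<Inter>g\<in>V. optimal_domain g X)"

end

theory Submission
  imports
    Defs
    "HOL-Complex_Analysis.Complex_Analysis"
    "HOL-Computational_Algebra.Fundamental_Theorem_Algebra"
begin

text \<open>
  Put \<open>a = n/p\<close>, \<open>b = n/q\<close>, \<open>\<beta> = 1 - \<alpha> = a - b\<close>. For \<open>g\<close> in the Bloch type space the function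
  \<open>T_g f\<close> is dominated on the ray through \<open>\<zeta>\<close> by the fractional integral of \<open>\<bar>f(t\<zeta>)\<bar>\<close> against
  \<open>(1 - t)\<close> to the power \<open>\<beta> - 1\<close>. For \<open>f\<close> in \<open>H^p\<close>, Hedberg's trick plays the pointwise
  growth of order \<open>(1 - \<bar>z\<bar>)\<close> to the power \<open>-a\<close> against the radial maximal function, which lies in
  \<open>L^p\<close> of the sphere. The maximal theorem is proved on the discs through the origin: as
  \<open>\<bar>f\<bar>\<close> to the power \<open>p/2\<close> has the Poisson integral of its boundary values as a majorant, it suffices to
  bound the linearized maximal Poisson operator \<open>T\<close> on \<open>L^2\<close>, and this follows from
  \<open>\<parallel>T\<parallel>\<close> squared \<open>= \<parallel>T T*\<parallel> \<le> 16 \<parallel>T\<parallel>\<close>, a consequence of the semigroup law of the Poisson kernel. The growth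
  estimate is the mean value property over an ellipsoid of size \<open>1 - \<bar>z\<bar>\<close> in the complex radial
  direction and of size the square root of \<open>1 - \<bar>z\<bar>\<close> in the complex tangential directions.

  The inclusion is proper because the function which is \<open>1 - z_k\<close> to the power \<open>-n/p\<close> divided by
  \<open>L - log (1 - z_k)\<close> to the power \<open>1/p\<close> just fails to lie in \<open>H^p\<close>, whereas its fractional integral
  behaves like \<open>1 - z_k\<close> to the power \<open>-n/q\<close> divided by the same power of the logarithm, and \<open>q/p > 1\<close>.
  If \<open>\<alpha> < 0\<close> only constants \<open>g\<close> occur and \<open>T_g = 0\<close>.
\<close>

section \<open>Invariance of the surface measure and polar coordinates\<close>

text \<open>Two exponents must come out sharp. For the growth estimate put d = 1 - |z|. A Euclidean
  ball of radius d has volume of order d^(2n) and lies in a shell of thickness of order d, which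
  yields only d^(1-2n). Since |z| reacts quadratically to complex tangential displacements, an
  ellipsoid of volume of order d^(n+1) fits into the same shell, and the quotient is d^n. In
  Hedberg's bound the maximal function carries the exponent b/a = p/q, so its q-th power is
  controlled by exactly the L^p norm of the maximal function. The maximal theorem is needed for all
  p > 0, also below 1; passing to |f|^(p/2) reduces every p to an L^2 estimate. The inequality for
  the operator norm is useful only if that norm is already known to be finite, which forces radii
  bounded away from 1. Hence finite sets of radii are treated, with a bound that does not see them,
  and dyadic refinement exhausts [0,1). In the counterexample a cap of radius 2^-j has measure of
  order 2^(-jn). The p-th power of the function has size 2^(jn)/j there, so the caps contribute the
  harmonic series; after integration against g the terms become j to the power -q/p.\<close>

lemma lborel_distr_basis_bij:
  fixes e :: "'m::finite \<Rightarrow> 'b::euclidean_space"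
  assumes e: "bij_betw e UNIV Basis"
  defines "\<phi> \<equiv> \<lambda>x::real^'m. \<Sum>i\<in>UNIV. (x $ i) *\<^sub>R e i"
  shows "distr lborel borel \<phi> = lborel"
proof (rule lborel_eqI[symmetric])
  have eB: "e i \<in> Basis" for i using e by (auto simp: bij_betw_def)
  have inj: "e i = e j \<longleftrightarrow> i = j" for i j using e by (auto simp: bij_betw_def inj_on_def)
  have ip: "\<phi> x \<bullet> e i = x $ i" for x i
  proof -
    have "\<phi> x \<bullet> e i = (\<Sum>j\<in>UNIV. x $ j * (if j = i then 1 else 0))"
      by (simp add: \<phi>_def inner_sum_left inner_Basis eB inj)
    also have "\<dots> = (\<Sum>j\<in>UNIV. if j = i then x $ j else 0)" by (rule sum.cong) auto
    finally show ?thesis by simp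
  qed
  have Bim: "Basis = range e" using e by (auto simp: bij_betw_def)
  have meas[measurable]: "\<phi> \<in> borel \<rightarrow>\<^sub>M borel"
    unfolding \<phi>_def by (intro borel_measurable_continuous_onI continuous_intros)
  fix l u :: 'b assume le: "\<And>b. b \<in> Basis \<Longrightarrow> l \<bullet> b \<le> u \<bullet> b"
  have pre: "\<phi> -` box l u = box (\<chi> i. l \<bullet> e i) (\<chi> i. u \<bullet> e i)"
    by (auto simp: box_def Bim Basis_vec_def ip inner_axis)
  have Bv: "(Basis :: (real^'m) set) = range (\<lambda>i. axis i 1)" by (auto simp: Basis_vec_def)
  have "emeasure (distr lborel borel \<phi>) (box l u) = emeasure lborel (\<phi> -` box l u)"
    by (subst emeasure_distr) auto
  also have "\<dots> = (\<Prod>b\<in>Basis. ((\<chi> i. u \<bullet> e i) - (\<chi> i. l \<bullet> e i) :: real^'m) \<bullet> b)"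
    unfolding pre by (rule emeasure_lborel_box) (auto simp: Bv inner_axis le eB)
  also have "\<dots> = ennreal (\<Prod>i\<in>UNIV. (u - l) \<bullet> e i)"
    unfolding Bv by (subst prod.reindex) (auto simp: inj_on_def axis_eq_axis inner_axis inner_diff_left)
  also have "(\<Prod>i\<in>UNIV. (u - l) \<bullet> e i) = (\<Prod>b\<in>Basis. (u - l) \<bullet> b)"
    unfolding Bim by (subst prod.reindex) (auto simp: inj_on_def inj)
  finally show "emeasure (distr lborel borel \<phi>) (box l u) = (\<Prod>b\<in>Basis. (u - l) \<bullet> b)" .
qed simp

lemma lborel_distr_orthogonal_real:
  fixes T :: "real^'m::{finite,wellorder} \<Rightarrow> real^'m::_"
  assumes T: "orthogonal_transformation T"
  shows "distr lborel borel T = lborel"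
proof (rule lborel_eqI[symmetric])
  have [measurable]: "T \<in> borel \<rightarrow>\<^sub>M borel"
    using T by (intro borel_measurable_continuous_onI linear_continuous_on)
      (simp add: linear_conv_bounded_linear[symmetric] orthogonal_transformation_linear)
  fix l u :: "real^'m::{finite,wellorder}" assume le: "\<And>b. b \<in> Basis \<Longrightarrow> l \<bullet> b \<le> u \<bullet> b"
  have iT: "orthogonal_transformation (inv T)"
    using T by (rule orthogonal_transformation_inv)
  have bT: "bij T" using T by (rule orthogonal_transformation_bij)
  have pre: "T -` box l u = inv T ` box l u"
    using bT by (rule bij_vimage_eq_inv_image)
  have m: "inv T ` box l u \<in> lmeasurable"
    by (rule measurable_orthogonal_image[OF iT]) simp
  have bo: "inv T ` box l u \<in> sets borel" 
    unfolding pre[symmetric] using measurable_sets[of T borel borel "box l u"] by simp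
  have "emeasure (distr lborel borel T) (box l u) = emeasure lborel (inv T ` box l u)"
    by (subst emeasure_distr) (auto simp: pre)
  also have "\<dots> = emeasure lebesgue (inv T ` box l u)"
    using bo by (simp add: emeasure_completion)
  also have "\<dots> = ennreal (measure lebesgue (inv T ` box l u))"
    using m by (simp add: emeasure_eq_measure2)
  also have "\<dots> = ennreal (measure lebesgue (box l u))"
    by (subst measure_orthogonal_image[OF iT]) simp_all
  also have "\<dots> = (\<Prod>b\<in>Basis. (u - l) \<bullet> b)"
    using le by (subst measure_completion) (auto simp: measure_lborel_box_eq)
  finally show "emeasure (distr lborel borel T) (box l u) = (\<Prod>b\<in>Basis. (u - l) \<bullet> b)" .
qed simp

text \<open>The map is conjugated by an isometry to a map of a real coordinate space. The index type
  \<open>'n bit0\<close> has \<open>2 * CARD('n)\<close> elements and carries the well-order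
  demanded by \<open>lborel_distr_orthogonal_real\<close>.\<close>

lemma lborel_distr_orthogonal:
  fixes T :: "complex^'n \<Rightarrow> complex^'n"
  assumes T: "orthogonal_transformation T"
  shows "distr lborel borel T = lborel"
proof -
  have "card (UNIV :: 'n bit0 set) = card (Basis :: (complex^'n) set)"
    by (simp add: DIM_complex)
  then obtain e :: "'n bit0 \<Rightarrow> complex^'n" where e: "bij_betw e UNIV Basis"
    using finite_same_card_bij[of "UNIV :: 'n bit0 set" "Basis :: (complex^'n) set"] by auto
  define \<phi> where "\<phi> \<equiv> \<lambda>x::real^'n bit0. \<Sum>i\<in>UNIV. (x $ i) *\<^sub>R e i"
  define \<psi> where "\<psi> \<equiv> \<lambda>y::complex^'n. (\<chi> i. y \<bullet> e i)::real^'n bit0"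
  have d: "distr lborel borel \<phi> = lborel"
    unfolding \<phi>_def by (rule lborel_distr_basis_bij[OF e])
  have eB: "e i \<in> Basis" for i using e by (auto simp: bij_betw_def)
  have inj: "e i = e j \<longleftrightarrow> i = j" for i j using e by (auto simp: bij_betw_def inj_on_def)
  have Bim: "Basis = range e" using e by (auto simp: bij_betw_def)
  have ip: "\<phi> x \<bullet> e i = x $ i" for x i
  proof -
    have "\<phi> x \<bullet> e i = (\<Sum>j\<in>UNIV. x $ j * (if j = i then 1 else 0))"
      by (simp add: \<phi>_def inner_sum_left inner_Basis eB inj)
    also have "\<dots> = (\<Sum>j\<in>UNIV. if j = i then x $ j else 0)" by (rule sum.cong) auto
    finally show ?thesis by simp
  qed
  have 1: "\<psi> (\<phi> x) = x" for x by (simp add: \<psi>_def ip vec_eq_iff)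
  have 2: "\<phi> (\<psi> y) = y" for y
    by (rule euclidean_eqI) (auto simp: Bim ip \<psi>_def)
  have lin1: "linear \<phi>" unfolding \<phi>_def
    by (rule linearI) (simp_all add: scaleR_add_left sum.distrib scaleR_sum_right)
  have lin2: "linear \<psi>" unfolding \<psi>_def
    by (rule linearI) (auto simp: vec_eq_iff inner_add_left)
  have inn: "\<psi> x \<bullet> \<psi> y = x \<bullet> y" for x y
    unfolding \<psi>_def inner_vec_def[where 'b="'n bit0"] euclidean_inner[of x y] Bim
    by (subst sum.reindex) (auto simp: inj_on_def inj)
  define S where "S = \<psi> \<circ> T \<circ> \<phi>"
  have S: "orthogonal_transformation S"
    unfolding orthogonal_transformation_def S_def
  proof (intro conjI allI)
    show "linear (\<psi> \<circ> T \<circ> \<phi>)" using lin1 lin2 T 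
      by (intro linear_compose) (auto simp: orthogonal_transformation_linear)
    show "(\<psi> \<circ> T \<circ> \<phi>) v \<bullet> (\<psi> \<circ> T \<circ> \<phi>) w = v \<bullet> w" for v w
    proof -
      have "(\<psi> \<circ> T \<circ> \<phi>) v \<bullet> (\<psi> \<circ> T \<circ> \<phi>) w = \<phi> v \<bullet> \<phi> w"
        using T by (simp add: inn orthogonal_transformation_def)
      also have "\<dots> = v \<bullet> w" by (metis inn 1)
      finally show ?thesis .
    qed
  qed
  have bl: "linear f \<Longrightarrow> f \<in> borel \<rightarrow>\<^sub>M borel" for f :: "'x::euclidean_space \<Rightarrow> 'y::euclidean_space"
    by (intro borel_measurable_continuous_onI linear_continuous_on)
      (simp add: linear_conv_bounded_linear[symmetric])
  have [measurable]: "\<phi> \<in> borel \<rightarrow>\<^sub>M borel" "S \<in> borel \<rightarrow>\<^sub>M borel" "T \<in> borel \<rightarrow>\<^sub>M borel"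
    using lin1 S T by (auto intro!: bl simp: orthogonal_transformation_linear)
  have "distr lborel borel T = distr (distr lborel borel \<phi>) borel T" by (simp add: d)
  also have "\<dots> = distr lborel borel (T \<circ> \<phi>)" by (subst distr_distr) auto
  also have "T \<circ> \<phi> = \<phi> \<circ> S" by (auto simp: S_def 2)
  also have "distr lborel borel (\<phi> \<circ> S) = distr (distr lborel borel S) borel \<phi>"
    by (subst distr_distr) auto
  also have "\<dots> = lborel" by (simp add: lborel_distr_orthogonal_real[OF S] d)
  finally show ?thesis .
qed

section \<open>Cones over sets of directions, rotation invariance, polar coordinates\<close>

lemma emeasure_sphere_measure_cone:
  fixes A :: "'a::euclidean_space set"
  assumes A: "A \<in> sets borel" "A \<subseteq> sphere 0 1"
  shows "emeasure sphere_measure A =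
    emeasure lborel {z. 0 < norm z \<and> norm z < 1 \<and> z /\<^sub>R norm z \<in> A} / emeasure lborel (ball (0::'a) 1)"
proof -
  have "{r *\<^sub>R x | r x. 0 < r \<and> r < 1 \<and> x \<in> A} = {z. 0 < norm z \<and> norm z < 1 \<and> z /\<^sub>R norm z \<in> A}"
  proof (intro equalityI subsetI)
    fix z assume "z \<in> {z. 0 < norm z \<and> norm z < 1 \<and> z /\<^sub>R norm z \<in> A}"
    then have "z = norm z *\<^sub>R (z /\<^sub>R norm z)" "0 < norm z" "norm z < 1" "z /\<^sub>R norm z \<in> A"
      by auto
    then show "z \<in> {r *\<^sub>R x | r x. 0 < r \<and> r < 1 \<and> x \<in> A}" by blast
  qed (use A(2) in auto)
  then show ?thesis by (simp add: emeasure_sphere_measure[OF A])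
qed

lemma finite_measure_sphere_measure: "finite_measure (sphere_measure :: 'a::euclidean_space measure)"
  by (rule finite_measureI) (simp add: emeasure_sphere_measure_sphere)

lemma measurable_normalize [measurable]:
  "(\<lambda>z::'a::euclidean_space. z /\<^sub>R norm z) \<in> borel \<rightarrow>\<^sub>M borel"
  by measurable

lemma sets_sphere_measureD:
  "A \<in> sets sphere_measure \<Longrightarrow> A \<in> sets borel \<and> A \<subseteq> sphere (0::'a::euclidean_space) 1"
  by (auto simp: sets_sphere_measure sets_restrict_space)

lemma emeasure_lborel_ball_ne:
  "emeasure lborel (ball (0::'a::euclidean_space) 1) \<noteq> 0"
  "emeasure lborel (ball (0::'a::euclidean_space) 1) \<noteq> \<infinity>"
  using emeasure_ball[of 1 "0::'a"] unit_ball_vol_pos[of "real DIM('a)"]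
    emeasure_lborel_ball_finite[of "0::'a" 1]
  by (simp_all add: less_imp_neq[symmetric])

lemma emeasure_unit_ball_ennreal:
  obtains V where "emeasure lborel (ball (0::'a::euclidean_space) 1) = ennreal V" "0 < V"
  using emeasure_lborel_ball_ne[where 'a='a]
  by (cases "emeasure lborel (ball (0::'a) 1)") (auto simp: less_le)

lemma borel_measurable_orthogonal:
  fixes T :: "'a::euclidean_space \<Rightarrow> 'a"
  assumes "orthogonal_transformation T"
  shows "T \<in> borel \<rightarrow>\<^sub>M borel"
  using orthogonal_transformation_linear[OF assms]
  by (intro borel_measurable_continuous_onI linear_continuous_on) (simp add: linear_conv_bounded_linear[symmetric])

lemma measurable_orthogonal_sphere:
  fixes T :: "'a::euclidean_space \<Rightarrow> 'a"
  assumes T: "orthogonal_transformation T"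
  shows "T \<in> sphere_measure \<rightarrow>\<^sub>M sphere_measure"
proof -
  have "T \<in> restrict_space borel (sphere 0 1) \<rightarrow>\<^sub>M restrict_space borel (sphere 0 1)"
    by (rule measurable_restrict_space2) (use T borel_measurable_orthogonal[OF T] in
      \<open>auto simp: orthogonal_transformation intro!: measurable_restrict_space1\<close>)
  then show ?thesis by (simp cong: measurable_cong_sets add: sets_sphere_measure)
qed

text \<open>An orthogonal map commutes with normalization, so the preimage of a cone is the cone
  over the preimage, and invariance of volume passes to the sphere.\<close>

lemma distr_sphere_measure_orthogonal:
  fixes T :: "complex^'n \<Rightarrow> complex^'n"
  assumes T: "orthogonal_transformation T"
  shows "distr sphere_measure sphere_measure T = sphere_measure"
proof (rule measure_eqI)
  have lin: "linear T" using T by (rule orthogonal_transformation_linear)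
  have T_meas[measurable]: "T \<in> borel \<rightarrow>\<^sub>M borel"
    using T by (rule borel_measurable_orthogonal)
  have nT: "norm (T z) = norm z" for z using T by (simp add: orthogonal_transformation)
  have T0: "T z = 0 \<longleftrightarrow> z = 0" for z by (metis nT norm_eq_zero)
  have Tm: "T \<in> sphere_measure \<rightarrow>\<^sub>M sphere_measure"
    using T by (rule measurable_orthogonal_sphere)
  fix A assume "A \<in> sets (distr sphere_measure sphere_measure T)"
  then have A: "A \<in> sets borel" "A \<subseteq> sphere 0 1" and A': "A \<in> sets sphere_measure"
    using sets_sphere_measureD by auto
  note [measurable] = A(1)
  define C where "C A = {z::complex^'n. 0 < norm z \<and> norm z < 1 \<and> z /\<^sub>R norm z \<in> A}" for A
  have CA: "C A \<in> sets borel" unfolding C_def by measurable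
  have TA: "T -` A \<inter> sphere 0 1 = T -` A" using A(2) by (auto simp: nT)
  have TA': "T -` A \<in> sets borel" using measurable_sets[OF T_meas A(1)] by simp
  have eq: "C (T -` A) = T -` C A" using lin by (auto simp: C_def nT T0 linear_cmul)
  have "emeasure (distr sphere_measure sphere_measure T) A = emeasure sphere_measure (T -` A)"
    using A' Tm by (simp add: emeasure_distr TA)
  also have "\<dots> = emeasure lborel (C (T -` A)) / emeasure lborel (ball (0::complex^'n) 1)"
    unfolding C_def by (rule emeasure_sphere_measure_cone) (use TA TA' in auto)
  also have "emeasure lborel (C (T -` A)) = emeasure (distr lborel borel T) (C A)"
    by (subst emeasure_distr) (auto simp: eq CA)
  also have "\<dots> = emeasure lborel (C A)" by (simp add: lborel_distr_orthogonal[OF T])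
  also have "\<dots> / emeasure lborel (ball (0::complex^'n) 1) = emeasure sphere_measure A"
    unfolding C_def by (rule emeasure_sphere_measure_cone[symmetric]) (use A in auto)
  finally show "emeasure (distr sphere_measure sphere_measure T) A = emeasure sphere_measure A" .
qed simp

lemma emeasure_cone_scale:
  fixes A :: "'a::euclidean_space set"
  assumes A: "A \<in> sets borel" "A \<subseteq> sphere 0 1" and s: "0 < s"
  shows "emeasure lborel {z. 0 < norm z \<and> norm z < s \<and> z /\<^sub>R norm z \<in> A} =
    ennreal (s ^ DIM('a)) * emeasure sphere_measure A * emeasure lborel (ball (0::'a) 1)"
proof -
  let ?C = "\<lambda>s. {z::'a. 0 < norm z \<and> norm z < s \<and> z /\<^sub>R norm z \<in> A}"
  note [measurable] = A(1)
  have b: "?C t \<in> sets borel" for t by measurable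
  have eq: "?C s = (\<lambda>x. s *\<^sub>R x + 0) ` ?C 1"
  proof (intro equalityI subsetI)
    fix z assume "z \<in> ?C s"
    then have "z = s *\<^sub>R (z /\<^sub>R s) + 0" "z /\<^sub>R s \<in> ?C 1" using s by (auto simp: field_simps)
    then show "z \<in> (\<lambda>x. s *\<^sub>R x + 0) ` ?C 1" by blast
  qed (use s in \<open>auto simp: field_simps\<close>)
  have "emeasure lborel (?C s) = emeasure lebesgue (?C s)" using b by (simp add: emeasure_completion)
  also have "\<dots> = \<bar>s\<bar> ^ DIM('a) * emeasure lebesgue (?C 1)"
    unfolding eq by (rule emeasure_lebesgue_affine)
  also have "\<dots> = s ^ DIM('a) * emeasure lborel (?C 1)"
    using b s by (simp add: emeasure_completion)
  also have "emeasure lborel (?C 1) = emeasure sphere_measure A * emeasure lborel (ball (0::'a) 1)"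
    unfolding emeasure_sphere_measure_cone[OF A]
    using emeasure_lborel_ball_ne[where 'a='a] 
    by (simp add: ennreal_divide_times ennreal_divide_self less_top)
  finally show ?thesis by (simp add: mult.assoc)
qed

text \<open>Difference of the cones of heights 1 and \<open>s\<close>; the piece of the sphere of
  radius \<open>s\<close> between them is a null set. The exact value serves both for integrating
  over shells and for measuring caps.\<close>

lemma emeasure_shell_cone:
  fixes A :: "'a::euclidean_space set"
  assumes A: "A \<in> sets borel" "A \<subseteq> sphere 0 1" and s: "0 \<le> s" "s < 1"
  shows "emeasure lborel {z. s < norm z \<and> norm z < 1 \<and> z /\<^sub>R norm z \<in> A} =
    ennreal (1 - s ^ DIM('a)) * emeasure sphere_measure A * emeasure lborel (ball (0::'a) 1)"
proof (cases "s = 0")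
  case True
  then show ?thesis using emeasure_cone_scale[OF A, of 1] by (simp add: power_0_left)
next
  case False
  with s have s0: "0 < s" by simp
  note [measurable] = A(1)
  let ?C = "\<lambda>s. {z::'a. 0 < norm z \<and> norm z < s \<and> z /\<^sub>R norm z \<in> A}"
  let ?D = "{z::'a. norm z = s \<and> z /\<^sub>R norm z \<in> A}"
  have "sphere (0::'a) s \<in> null_sets lborel"
    using negligible_sphere[of "0::'a" s] 
    by (simp add: null_sets_completion_iff negligible_iff_null_sets)
  then have D: "?D \<in> null_sets lborel"
    by (rule null_sets_subset) (auto, measurable)
  have "emeasure lborel {z. s < norm z \<and> norm z < 1 \<and> z /\<^sub>R norm z \<in> A}
     = emeasure lborel (?C 1 - (?C s \<union> ?D))"
    by (rule arg_cong[where f="emeasure lborel"]) (use s s0 in auto)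
  also have "\<dots> = emeasure lborel (?C 1) - emeasure lborel (?C s \<union> ?D)"
  proof (rule emeasure_Diff)
    have "emeasure lborel (?C s \<union> ?D) \<le> emeasure lborel (ball (0::'a) 2)"
      using s by (intro emeasure_mono) auto
    then show "emeasure lborel (?C s \<union> ?D) \<noteq> \<infinity>"
      using emeasure_lborel_ball_finite[of "0::'a" 2] by (auto simp: top_unique)
  qed (use s s0 in \<open>auto, measurable\<close>)
  also have "emeasure lborel (?C s \<union> ?D) = emeasure lborel (?C s)"
    using D by (intro emeasure_Un_null_set) auto
  also have "emeasure lborel (?C 1) - emeasure lborel (?C s) = 
     ennreal (1 - s ^ DIM('a)) * (emeasure sphere_measure A * emeasure lborel (ball (0::'a) 1))"
  proof -
    define X where "X = emeasure sphere_measure A * emeasure lborel (ball (0::'a) 1)"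
    interpret finite_measure "sphere_measure :: 'a measure" by (rule finite_measure_sphere_measure)
    have "X \<noteq> \<infinity>"
      using emeasure_lborel_ball_ne(2)[where 'a='a] by (simp add: X_def ennreal_mult_eq_top_iff)
    then obtain x where x: "X = ennreal x" "0 \<le> x" by (cases X) auto
    have "s ^ DIM('a) \<le> 1" using s by (simp add: power_le_one)
    then have "X - ennreal (s ^ DIM('a)) * X = ennreal (1 - s ^ DIM('a)) * X"
      using x s by (simp add: ennreal_mult'[symmetric] ennreal_minus algebra_simps flip: ennreal_mult)
    then show ?thesis
      using emeasure_cone_scale[OF A, of 1] emeasure_cone_scale[OF A s0] by (simp add: X_def mult.assoc)
  qed
  finally show ?thesis by (simp add: mult.assoc)
qed

lemma emeasure_distr_norm_cone:
  fixes B :: "'a::euclidean_space set"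
  assumes [measurable]: "B \<in> sets borel" "A \<in> sets borel"
  shows "emeasure (distr (restrict_space lborel {z::'a. 0 < norm z \<and> norm z < 1 \<and> z /\<^sub>R norm z \<in> B}) borel norm) A
    = emeasure lborel {z::'a. 0 < norm z \<and> norm z < 1 \<and> z /\<^sub>R norm z \<in> B \<and> norm z \<in> A}"
proof -
  let ?S = "{z::'a. 0 < norm z \<and> norm z < 1 \<and> z /\<^sub>R norm z \<in> B}"
  have S: "?S \<in> sets lborel" by measurable
  have "norm \<in> restrict_space lborel ?S \<rightarrow>\<^sub>M borel" by (rule measurable_restrict_space1) measurable
  then have "emeasure (distr (restrict_space lborel ?S) borel norm) A
      = emeasure (restrict_space lborel ?S) (norm -` A \<inter> ?S)"
    by (subst emeasure_distr) (auto simp: space_restrict_space)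
  also have "\<dots> = emeasure lborel (norm -` A \<inter> ?S)"
    using S by (subst emeasure_restrict_space) auto
  also have "norm -` A \<inter> ?S = {z. 0 < norm z \<and> norm z < 1 \<and> z /\<^sub>R norm z \<in> B \<and> norm z \<in> A}" by auto
  finally show ?thesis .
qed

text \<open>Independence of modulus and direction under Lebesgue measure on the ball: the law of the
  norm on a cone depends on \<open>B\<close> only through a factor. Both sides are finite measures
  and agree on half-lines by \<open>emeasure_shell_cone\<close>.\<close>

lemma distr_norm_cone_eq:
  fixes B :: "'a::euclidean_space set"
  assumes B: "B \<in> sets borel" "B \<subseteq> sphere 0 1"
  defines "\<nu> \<equiv> \<lambda>B. distr (restrict_space lborel {z::'a. 0 < norm z \<and> norm z < 1 \<and> z /\<^sub>R norm z \<in> B}) borel norm"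
  shows "\<nu> B = scale_measure (emeasure sphere_measure B) (\<nu> (sphere 0 1))"
proof (rule measure_eqI_lessThan)
  have e: "emeasure (\<nu> B) {x<..} = (if x < 1 then ennreal (1 - (max x 0) ^ DIM('a)) else 0)
      * emeasure sphere_measure B * emeasure lborel (ball (0::'a) 1)" 
    if B: "B \<in> sets borel" "B \<subseteq> sphere 0 1" for x B
  proof -
    have eq: "{z::'a. 0 < norm z \<and> norm z < 1 \<and> z /\<^sub>R norm z \<in> B \<and> norm z \<in> {x<..}}
      = (if x < 1 then {z. max x 0 < norm z \<and> norm z < 1 \<and> z /\<^sub>R norm z \<in> B} else {})"
      by auto
    have "emeasure (\<nu> B) {x<..} = emeasure lborel {z::'a. 0 < norm z \<and> norm z < 1 \<and> z /\<^sub>R norm z \<in> B \<and> norm z \<in> {x<..}}"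
      unfolding \<nu>_def by (rule emeasure_distr_norm_cone) (use B in auto)
    also have "\<dots> = (if x < 1 then ennreal (1 - (max x 0) ^ DIM('a)) else 0)
      * emeasure sphere_measure B * emeasure lborel (ball (0::'a) 1)"
      unfolding eq using emeasure_shell_cone[OF B, of "max x 0"] by (cases "x < 1") (simp_all del: max_less_iff_conj)
    finally show ?thesis .
  qed
  show "emeasure (\<nu> B) {x<..} = emeasure (scale_measure (emeasure sphere_measure B) (\<nu> (sphere 0 1))) {x<..}" for x
    using e[OF B, of x] e[of "sphere 0 1" x]
    by (simp add: emeasure_sphere_measure_sphere mult_ac)
  interpret finite_measure "sphere_measure :: 'a measure" by (rule finite_measure_sphere_measure)
  show "emeasure (\<nu> B) {x<..} < \<infinity>" for x
    using emeasure_lborel_ball_ne(2)[where 'a='a]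
    by (simp add: e[OF B] less_top[symmetric] ennreal_mult_eq_top_iff)
qed (simp_all add: \<nu>_def)

text \<open>Polar coordinates in the form of an upper bound. The map to (norm, direction) pushes
  Lebesgue measure on the punctured ball to a product of a radial measure and the surface measure.
  Since the inner integrals are bounded by \<open>K\<close>, only the radial mass of
  \<open>{s<..}\<close> has to be known.\<close>

lemma nn_integral_shell_le:
  fixes u :: "'a::euclidean_space \<Rightarrow> ennreal"
  assumes u[measurable]: "u \<in> borel_measurable borel" and s: "0 \<le> s" "s < 1"
    and K: "\<And>\<rho>. s < \<rho> \<Longrightarrow> \<rho> < 1 \<Longrightarrow> (\<integral>\<^sup>+\<zeta>. u (\<rho> *\<^sub>R \<zeta>) \<partial>sphere_measure) \<le> K"
  shows "(\<integral>\<^sup>+z. u z * indicator {z. s < norm z \<and> norm z < 1} z \<partial>lborel)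
    \<le> K * ennreal (1 - s ^ DIM('a)) * emeasure lborel (ball (0::'a) 1)"
proof -
  define S where "S = {z::'a. 0 < norm z \<and> norm z < 1 \<and> z /\<^sub>R norm z \<in> sphere 0 1}"
  have S_eq: "S = ball 0 1 - {0}" by (auto simp: S_def)
  have S[measurable]: "S \<in> sets borel" by (simp add: S_eq)
  define \<nu> where "\<nu> = (\<lambda>B. distr (restrict_space lborel {z::'a. 0 < norm z \<and> norm z < 1 \<and> z /\<^sub>R norm z \<in> B}) borel norm)"
  let ?\<nu> = "\<nu> (sphere 0 1)"
  let ?M = "restrict_space lborel S"
  let ?\<sigma> = "sphere_measure :: 'a measure"
  define P where "P = distr ?M (borel \<Otimes>\<^sub>M ?\<sigma>) (\<lambda>z. (norm z, z /\<^sub>R norm z))"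
  interpret sig: finite_measure ?\<sigma> by (rule finite_measure_sphere_measure)
  have n1: "norm \<in> ?M \<rightarrow>\<^sub>M borel" by (rule measurable_restrict_space1) measurable
  have n2: "(\<lambda>z. z /\<^sub>R norm z) \<in> ?M \<rightarrow>\<^sub>M ?\<sigma>"
  proof -
    have "(\<lambda>z. z /\<^sub>R norm z) \<in> ?M \<rightarrow>\<^sub>M restrict_space borel (sphere 0 1)"
      by (rule measurable_restrict_space2) (auto simp: S_eq space_restrict_space intro!: measurable_restrict_space1)
    then show ?thesis by (simp cong: measurable_cong_sets add: sets_sphere_measure)
  qed
  have n3: "(\<lambda>z. (norm z, z /\<^sub>R norm z)) \<in> ?M \<rightarrow>\<^sub>M borel \<Otimes>\<^sub>M ?\<sigma>"
    using n1 n2 by (rule measurable_Pair)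
  have sets_nu[measurable_cong]: "sets ?\<nu> = sets borel" by (simp add: \<nu>_def)
  have nu_fin: "emeasure ?\<nu> UNIV \<noteq> \<infinity>"
  proof -
    have "emeasure ?\<nu> UNIV \<le> emeasure lborel (ball (0::'a) 1)"
      unfolding \<nu>_def by (subst emeasure_distr_norm_cone) (auto intro!: emeasure_mono)
    then show ?thesis using emeasure_lborel_ball_ne(2)[where 'a='a] by (auto simp: top_unique)
  qed
  interpret nu: finite_measure ?\<nu>
    using nu_fin by (intro finite_measureI) (simp add: \<nu>_def)
  have PM: "?\<nu> \<Otimes>\<^sub>M ?\<sigma> = P"
  proof (rule pair_measure_eqI)
    show "sigma_finite_measure ?\<nu>" "sigma_finite_measure ?\<sigma>" by unfold_locales
    show "sets (?\<nu> \<Otimes>\<^sub>M ?\<sigma>) = sets P"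
      by (simp add: P_def sets_nu cong: sets_pair_measure_cong)
    fix A B assume "A \<in> sets ?\<nu>" and B': "B \<in> sets ?\<sigma>"
    then have A[measurable]: "A \<in> sets borel" and B[measurable]: "B \<in> sets borel" and Bs: "B \<subseteq> sphere 0 1"
      using sets_sphere_measureD[OF B'] sets_nu by auto
    have AB: "A \<times> B \<in> sets (borel \<Otimes>\<^sub>M ?\<sigma>)" using A B' by auto
    have "emeasure ?\<nu> A * emeasure ?\<sigma> B = emeasure (\<nu> B) A"
      unfolding \<nu>_def distr_norm_cone_eq[OF B Bs] by (simp add: mult.commute)
    also have "\<dots> = emeasure lborel {z::'a. 0 < norm z \<and> norm z < 1 \<and> z /\<^sub>R norm z \<in> B \<and> norm z \<in> A}"
      unfolding \<nu>_def by (rule emeasure_distr_norm_cone) measurable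
    also have "{z::'a. 0 < norm z \<and> norm z < 1 \<and> z /\<^sub>R norm z \<in> B \<and> norm z \<in> A}
       = (\<lambda>z. (norm z, z /\<^sub>R norm z)) -` (A \<times> B) \<inter> S" by (auto simp: S_eq)
    also have "emeasure lborel \<dots> = emeasure ?M \<dots>"
      by (rule emeasure_restrict_space[symmetric]) auto
    also have "\<dots> = emeasure P (A \<times> B)"
      unfolding P_def using n3 AB by (subst emeasure_distr) (auto simp: space_restrict_space)
    finally show "emeasure ?\<nu> A * emeasure ?\<sigma> B = emeasure P (A \<times> B)" .
  qed
  have id_meas: "(\<lambda>x. x) \<in> ?\<sigma> \<rightarrow>\<^sub>M borel"
    by (simp add: measurable_restrict_space1 cong: measurable_cong_sets[OF sets_sphere_measure refl])
  have fm: "(\<lambda>(\<rho>, \<zeta>). u (\<rho> *\<^sub>R \<zeta>) * indicator {s<..<1} \<rho>) \<in> borel_measurable (borel \<Otimes>\<^sub>M ?\<sigma>)"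
  proof -
    have [measurable]: "snd \<in> (borel :: real measure) \<Otimes>\<^sub>M ?\<sigma> \<rightarrow>\<^sub>M borel"
      by (rule measurable_compose[OF measurable_snd id_meas])
    show ?thesis unfolding case_prod_beta by measurable
  qed
  then have fm': "(\<lambda>(\<rho>, \<zeta>). u (\<rho> *\<^sub>R \<zeta>) * indicator {s<..<1} \<rho>) \<in> borel_measurable (?\<nu> \<Otimes>\<^sub>M ?\<sigma>)"
    by (simp cong: measurable_cong_sets[OF sets_pair_measure_cong[OF sets_nu refl] refl])
  have "(\<integral>\<^sup>+z. u z * indicator {z. s < norm z \<and> norm z < 1} z \<partial>lborel)
     = (\<integral>\<^sup>+z. (u z * indicator {s<..<1} (norm z)) * indicator S z \<partial>lborel)"
    by (rule nn_integral_cong) (use s in \<open>auto simp: S_eq indicator_def\<close>)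
  also have "\<dots> = (\<integral>\<^sup>+z. u z * indicator {s<..<1} (norm z) \<partial>?M)"
    by (rule nn_integral_restrict_space[symmetric]) auto
  also have "\<dots> = (\<integral>\<^sup>+z. (case (norm z, z /\<^sub>R norm z) of (\<rho>, \<zeta>) \<Rightarrow> u (\<rho> *\<^sub>R \<zeta>) * indicator {s<..<1} \<rho>) \<partial>?M)"
    by (rule nn_integral_cong) (auto simp: space_restrict_space S_eq)
  also have "\<dots> = (\<integral>\<^sup>+x. (case x of (\<rho>, \<zeta>) \<Rightarrow> u (\<rho> *\<^sub>R \<zeta>) * indicator {s<..<1} \<rho>) \<partial>P)"
    unfolding P_def by (subst nn_integral_distr[OF n3]) (use fm in simp_all)
  also have "\<dots> = (\<integral>\<^sup>+\<rho>. (\<integral>\<^sup>+\<zeta>. u (\<rho> *\<^sub>R \<zeta>) * indicator {s<..<1} \<rho> \<partial>?\<sigma>) \<partial>?\<nu>)"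
    unfolding PM[symmetric] using sig.nn_integral_fst[OF fm', symmetric] by simp
  also have "\<dots> \<le> (\<integral>\<^sup>+\<rho>. K * indicator {s<..} \<rho> \<partial>?\<nu>)"
    by (rule nn_integral_mono) (auto simp: indicator_def intro: K)
  also have "\<dots> = K * emeasure ?\<nu> {s<..}"
    by (rule nn_integral_cmult_indicator) (simp add: \<nu>_def)
  also have "emeasure ?\<nu> {s<..} = emeasure lborel {z::'a. s < norm z \<and> norm z < 1 \<and> z /\<^sub>R norm z \<in> sphere 0 1}"
  proof -
    have "{z::'a. s < norm z \<and> norm z < 1 \<and> z /\<^sub>R norm z \<in> sphere 0 1} =
        {z. 0 < norm z \<and> norm z < 1 \<and> z /\<^sub>R norm z \<in> sphere 0 1 \<and> norm z \<in> {s<..}}"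
      using s by auto
    then show ?thesis unfolding \<nu>_def by (subst emeasure_distr_norm_cone) simp_all
  qed
  also have "\<dots> = ennreal (1 - s ^ DIM('a)) * emeasure ?\<sigma> (sphere 0 1) * emeasure lborel (ball (0::'a) 1)"
    by (rule emeasure_shell_cone) (use s in auto)
  finally show ?thesis by (simp add: emeasure_sphere_measure_sphere mult.assoc)
qed

section \<open>Poisson integrals and powers of holomorphic functions on the disc\<close>

text \<open>The parameter runs over one unit, so Lebesgue measure on \<open>{0..1}\<close> is
  normalized arc length.\<close>

definition circ :: "real \<Rightarrow> complex" where
  "circ x = exp (2 * of_real pi * \<i> * of_real x)"

lemma circ_diff: "circ (x - y) = circ x * cnj (circ y)"
  by (simp add: circ_def exp_cnj exp_add[symmetric] algebra_simps)

lemma norm_circ [simp]: "norm (circ x) = 1"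
  by (simp add: circ_def norm_exp_eq_Re)

lemma circ_mult_cnj [simp]: "circ x * cnj (circ x) = 1" "cnj (circ x) * circ x = 1"
  by (simp_all add: complex_norm_square[symmetric] mult.commute[of "cnj _"])

lemma circ_nonzero [simp]: "circ x \<noteq> 0"
  by (simp add: circ_def)

lemma continuous_on_circ [continuous_intros]:
  "continuous_on A f \<Longrightarrow> continuous_on A (\<lambda>x. circ (f x))"
  unfolding circ_def by (intro continuous_intros)

text \<open>Cauchy's formula at \<open>z\<close> for
  \<open>k u * (1 - |z|^2) / (1 - cnj z * u)\<close>, which takes the value \<open>k z\<close> at
  \<open>z\<close>. On the circle \<open>1 - cnj z * u = u * cnj (u - z)\<close>, and this turns the
  Cauchy kernel into the Poisson kernel.\<close>

lemma poisson_representation: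
  assumes k: "continuous_on (cball 0 1) k" "k holomorphic_on ball 0 1" and z: "norm z < 1"
  shows "((\<lambda>x. k (circ x) * of_real ((1 - (norm z)\<^sup>2) / (norm (circ x - z))\<^sup>2)) has_integral k z) {0..1}"
proof -
  have nz: "1 - cnj z * u \<noteq> 0" if "norm u \<le> 1" for u
  proof
    assume "1 - cnj z * u = 0"
    then have "norm (cnj z * u) = 1" by (metis norm_one right_minus_eq)
    moreover have "norm (cnj z * u) \<le> norm z * 1"
      unfolding norm_mult complex_mod_cnj using that by (intro mult_left_mono) auto
    ultimately show False using z by simp
  qed
  define f where "f = (\<lambda>u. k u * of_real (1 - (norm z)\<^sup>2) / (1 - cnj z * u))"
  have CI: "((\<lambda>u. f u / (u - z)) has_contour_integral (2 * of_real pi * \<i> * f z)) (circlepath 0 1)"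
  proof (rule Cauchy_integral_circlepath)
    show "continuous_on (cball 0 1) f" unfolding f_def
      by (intro continuous_intros k) (use nz in auto)
    show "f holomorphic_on ball 0 1" unfolding f_def
      by (intro holomorphic_intros k) (use nz in auto)
  qed (use z in auto)
  have fz: "f z = k z"
  proof -
    have "of_real (1 - (norm z)\<^sup>2) = 1 - cnj z * z"
      using complex_norm_square[of z] by (simp add: mult.commute)
    then show ?thesis using nz[of z] z by (simp add: f_def)
  qed
  have vd: "vector_derivative (circlepath 0 1) (at x within {0..1}) = 2 * of_real pi * \<i> * circ x"
    if "x \<in> {0..1}" for x using that by (simp add: vector_derivative_circlepath01 circ_def)
  have cp: "circlepath 0 1 x = circ x" for x by (simp add: circlepath circ_def)
  have A: "((\<lambda>x. f (circlepath 0 1 x) / (circlepath 0 1 x - z) * vector_derivative (circlepath 0 1) (at x within {0..1}))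
      has_integral (2 * of_real pi * \<i> * k z)) {0..1}"
    using CI unfolding has_contour_integral_def fz by simp
  have A2: "((\<lambda>x. f (circ x) / (circ x - z) * (2 * of_real pi * \<i> * circ x)) has_integral (2 * of_real pi * \<i> * k z)) {0..1}"
    by (rule has_integral_eq[OF _ A]) (simp add: vd cp)
  have "((\<lambda>x. inverse (2 * of_real pi * \<i>) * (f (circ x) / (circ x - z) * (2 * of_real pi * \<i> * circ x))) has_integral k z) {0..1}"
  proof -
    have e: "inverse (2 * of_real pi * \<i>) * (2 * of_real pi * \<i> * k z) = k z" by (simp add: field_simps)
    then show ?thesis
      using has_integral_mult_right[OF A2, of "inverse (2 * of_real pi * \<i>)"] by (simp only: e)
  qed
  then show ?thesis
  proof (rule has_integral_eq[rotated])
    fix x :: real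
    let ?u = "circ x"
    have gen: "inverse c * (K * N / (u * b) / d * (c * u)) = K * (N / (d * b))"
      if "c \<noteq> 0" "u \<noteq> 0" "d \<noteq> 0" "b \<noteq> 0" for c K N u b d :: complex
      using that by (simp add: field_simps)
    have 1: "1 - cnj z * ?u = ?u * cnj (?u - z)" by (simp add: algebra_simps)
    have 2: "?u - z \<noteq> 0" using z by (metis norm_circ less_irrefl right_minus_eq)
    have 3: "complex_of_real ((norm (?u - z))\<^sup>2) = (?u - z) * cnj (?u - z)"
      by (rule complex_norm_square)
    show "inverse (2 * of_real pi * \<i>) * (f ?u / (?u - z) * (2 * of_real pi * \<i> * ?u)) =
      k ?u * of_real ((1 - (norm z)\<^sup>2) / (norm (?u - z))\<^sup>2)"
      unfolding f_def of_real_divide 3 1 by (rule gen) (use 2 in auto)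
  qed
qed

definition poisson :: "real \<Rightarrow> real \<Rightarrow> real" where
  "poisson r x = (1 - r\<^sup>2) / (norm (1 - of_real r * circ x))\<^sup>2"

lemma poisson_nonneg: "\<bar>r\<bar> \<le> 1 \<Longrightarrow> 0 \<le> poisson r x"
  by (auto simp: poisson_def abs_square_le_1 intro!: divide_nonneg_nonneg)

lemma norm_circ_minus: "norm (circ x - of_real r * circ y) = norm (1 - of_real r * circ (y - x))"
proof -
  have "circ x * (1 - of_real r * circ (y - x)) = circ x - of_real r * (circ x * cnj (circ x)) * circ y"
    by (simp only: circ_diff) (simp add: algebra_simps)
  then have "norm (circ x - of_real r * circ y) = norm (circ x * (1 - of_real r * circ (y - x)))" by simp
  then show ?thesis by (simp add: norm_mult)
qed

lemma poisson_minus: "poisson r (- x) = poisson r x"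
proof -
  have "circ (-x) = cnj (circ x)" using circ_diff[of 0 x] by (simp add: circ_def)
  then have "1 - of_real r * circ (-x) = cnj (1 - of_real r * circ x)" by simp
  then show ?thesis unfolding poisson_def by (metis complex_mod_cnj)
qed

lemma poisson_representation':
  assumes k: "continuous_on (cball 0 1) k" "k holomorphic_on ball 0 1" and r: "0 \<le> r" "r < 1"
  shows "((\<lambda>x. k (circ x) * of_real (poisson r (\<theta> - x))) has_integral k (of_real r * circ \<theta>)) {0..1}"
  using poisson_representation[OF k, of "of_real r * circ \<theta>"] r
  by (simp add: poisson_def norm_circ_minus norm_mult)

lemma continuous_on_poisson [continuous_intros]:
  assumes "continuous_on A f" "continuous_on A g" "\<And>x. x \<in> A \<Longrightarrow> 0 \<le> f x \<and> f x < 1"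
  shows "continuous_on A (\<lambda>x. poisson (f x) (g x))"
  unfolding poisson_def
proof (intro continuous_intros assms)
  show "\<forall>x\<in>A. (cmod (1 - complex_of_real (f x) * circ (g x)))\<^sup>2 \<noteq> 0"
  proof
    fix x assume x: "x \<in> A"
    have "norm (complex_of_real (f x) * circ (g x)) < 1" using assms(3)[OF x] by (simp add: norm_mult)
    then have "complex_of_real (f x) * circ (g x) \<noteq> 1" by (metis less_irrefl norm_one)
    then show "(cmod (1 - complex_of_real (f x) * circ (g x)))\<^sup>2 \<noteq> 0" by simp
  qed
qed

lemma poisson_integral_1: "0 \<le> r \<Longrightarrow> r < 1 \<Longrightarrow> ((\<lambda>x. poisson r (\<theta> - x)) has_integral 1) {0..1}"
  using has_integral_linear[OF poisson_representation'[of "\<lambda>_. 1" r \<theta>] bounded_linear_Re]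
  by (simp add: o_def)

text \<open>The kernel is the real part of \<open>(1 + v) / (1 - v)\<close> with
  \<open>v = s * w * cnj (circ z)\<close>, a function of \<open>w\<close> holomorphic beyond the
  closed disc. Its Poisson integral at \<open>r * circ x\<close> is its value there, which replaces
  \<open>s\<close> by \<open>r * s\<close>.\<close>

lemma poisson_semigroup:
  assumes r: "0 \<le> r" "r < 1" and s: "0 \<le> s" "s < 1"
  shows "((\<lambda>y. poisson r (x - y) * poisson s (y - z)) has_integral poisson (r * s) (x - z)) {0..1}"
proof -
  define k where "k = (\<lambda>w. (1 + of_real s * w * cnj (circ z)) / (1 - of_real s * w * cnj (circ z)))"
  have nz: "1 - of_real s * w * cnj (circ z) \<noteq> 0" if "norm w \<le> 1" for w
  proof
    assume "1 - of_real s * w * cnj (circ z) = 0"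
    then have "norm (of_real s * w * cnj (circ z)) = 1" by (metis norm_one right_minus_eq)
    then show False using that s mult_left_le[of "norm w" s] by (simp add: norm_mult)
  qed
  have Re_k: "Re (k w) = (1 - (s * norm w)\<^sup>2) / (norm (1 - of_real s * w * cnj (circ z)))\<^sup>2"
    if "norm w \<le> 1" for w
  proof -
    let ?v = "of_real s * w * cnj (circ z)"
    have nv: "norm ?v = s * norm w" using s by (simp add: norm_mult)
    have "k w = (1 + ?v) * cnj (1 - ?v) / of_real ((norm (1 - ?v))\<^sup>2)"
      unfolding k_def complex_norm_square
      by (rule nonzero_mult_divide_mult_cancel_right[symmetric]) (use nz[OF that] complex_cnj_zero_iff in blast)
    then have "Re (k w) = Re ((1 + ?v) * cnj (1 - ?v)) / (norm (1 - ?v))\<^sup>2"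
      by (simp only: Re_divide_of_real)
    also have "Re ((1 + ?v) * cnj (1 - ?v)) = 1 - (norm ?v)\<^sup>2"
    proof -
      have "Re ((1 + v) * cnj (1 - v)) = 1 - (norm v)\<^sup>2" for v
        unfolding cmod_power2 by (simp add: power2_eq_square algebra_simps)
      then show ?thesis .
    qed
    finally show ?thesis by (simp only: nv)
  qed
  have "((\<lambda>y. k (circ y) * of_real (poisson r (x - y))) has_integral k (of_real r * circ x)) {0..1}"
  proof (rule poisson_representation')
    show "continuous_on (cball 0 1) k" unfolding k_def
      by (intro continuous_intros) (use nz in auto)
    show "k holomorphic_on ball 0 1" unfolding k_def
      by (intro holomorphic_intros) (use nz in auto)
  qed (use r in auto)
  from has_integral_linear[OF this bounded_linear_Re]
  have "((\<lambda>y. Re (k (circ y)) * poisson r (x - y)) has_integral Re (k (of_real r * circ x))) {0..1}"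
    by (simp add: o_def)
  moreover have "Re (k (circ y)) = poisson s (y - z)" for y
    by (subst Re_k) (simp_all add: poisson_def circ_diff mult.assoc)
  moreover have "Re (k (of_real r * circ x)) = poisson (r * s) (x - z)"
    using r by (subst Re_k) (simp_all add: poisson_def circ_diff norm_mult mult_ac)
  ultimately show ?thesis by (simp add: mult.commute)
qed

text \<open>Let \<open>r\<close> be the smaller radius. Then
  \<open>|1 - r e| \<le> 2 |1 - r s e|\<close>, costing a factor 4 in the denominator, and
  \<open>1 - (r s)^2 \<le> 2 (1 - r^2)\<close> costs 2 in the numerator. The sum of both kernels
  covers both orders of the radii.\<close>

lemma poisson_mult_le:
  assumes r: "0 \<le> r" "r < 1" and s: "0 \<le> s" "s < 1"
  shows "poisson (r * s) x \<le> 8 * (poisson r x + poisson s x)"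
proof -
  have main: "poisson (r * s) x \<le> 8 * poisson r x" if r: "0 \<le> r" "r < 1" and s: "0 \<le> s" "s < 1" and "r \<le> s" for r s
  proof -
    let ?e = "circ x"
    let ?a = "norm (1 - of_real r * ?e)" and ?b = "norm (1 - of_real (r * s) * ?e)"
    have rs: "r * s < 1" using r s by (meson le_less_trans mult_left_le less_imp_le)
    have b: "1 - r * s \<le> ?b" 
      using norm_triangle_ineq2[of 1 "of_real (r * s) * ?e"] r s by (simp add: norm_mult)
    have b0: "0 < ?b" using b rs by linarith
    have "?a \<le> ?b + norm (of_real (r * s) * ?e - of_real r * ?e)"
      by (metis norm_triangle_sub add.commute diff_add_eq_diff_diff_swap norm_minus_commute norm_triangle_ineq diff_diff_eq2 diff_add_cancel)
    also have "of_real (r * s) * ?e - of_real r * ?e = of_real (r * s - r) * ?e" by (simp add: algebra_simps)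
    also have "norm \<dots> = \<bar>r * s - r\<bar>" by (simp only: norm_mult norm_of_real norm_circ mult_1_right)
    also have "\<dots> = r * (1 - s)" using mult_left_le[of s r] r s by (simp add: right_diff_distrib)
    also have "r * (1 - s) \<le> 1 - r * s" using r s by (simp add: algebra_simps)
    finally have ab: "?a \<le> 2 * ?b" using b by simp
    have a0: "0 < ?a"
    proof -
      have "1 - r \<le> ?a" using norm_triangle_ineq2[of 1 "of_real r * ?e"] r by (simp add: norm_mult)
      then show ?thesis using r by linarith
    qed
    have "1 - (r * s)\<^sup>2 = (1 - r\<^sup>2) + r\<^sup>2 * (1 - s\<^sup>2)" by (simp add: power2_eq_square algebra_simps)
    also have "\<dots> \<le> (1 - r\<^sup>2) + 1 * (1 - r\<^sup>2)"
      using r s that(5) by (intro add_mono mult_mono) (auto simp: abs_square_le_1 power_le_one power_mono)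
    finally have n: "1 - (r * s)\<^sup>2 \<le> 2 * (1 - r\<^sup>2)" by simp
    have "?a\<^sup>2 \<le> (2 * ?b)\<^sup>2" using ab by (intro power_mono) auto
    then have "?a\<^sup>2 \<le> 4 * ?b\<^sup>2" by (simp add: power_mult_distrib)
    have "(1 - (r * s)\<^sup>2) * ?a\<^sup>2 \<le> (2 * (1 - r\<^sup>2)) * (4 * ?b\<^sup>2)"
      using n \<open>?a\<^sup>2 \<le> 4 * ?b\<^sup>2\<close> r by (intro mult_mono) (auto simp: power_le_one)
    then show ?thesis unfolding poisson_def using a0 b0 by (simp add: field_simps)
  qed
  show ?thesis
  proof (cases "r \<le> s")
    case True
    then show ?thesis using main[OF r s] poisson_nonneg[of s x] s by (simp add: abs_le_iff)
  next
    case False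
    then show ?thesis using main[OF s r] poisson_nonneg[of r x] r by (simp add: mult.commute abs_le_iff)
  qed
qed

section \<open>Poisson majorants of powers of the modulus\<close>

text \<open>
  A zero \<open>a\<close> inside the disc is reflected as in a Blaschke product: \<open>1 - cnj a * w\<close> dominates \<open>w - a\<close> on
  the disc, with equality on the circle. The remaining linear factors have powers continuous up to
  the circle.
\<close>

lemma poly_power_majorant:
  fixes P :: "complex poly" and s :: real
  assumes s: "0 < s"
  shows "\<exists>k. continuous_on (cball 0 1) k \<and> k holomorphic_on ball 0 1 \<and>
    (\<forall>w\<in>cball 0 1. norm (poly P w) powr s \<le> norm (k w)) \<and>
    (\<forall>w\<in>sphere 0 1. norm (k w) = norm (poly P w) powr s)"
proof (induction "degree P" arbitrary: P)
  case 0
  then obtain c where "P = [:c:]" by (metis degree_eq_zeroE)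
  then show ?case by (intro exI[of _ "\<lambda>_. of_real (norm c powr s)"]) auto
next
  case (Suc n)
  then have "\<not> constant (poly P)" using constant_degree[of P] by auto
  then obtain a where "poly P a = 0" using Fundamental_Theorem_Algebra.fundamental_theorem_of_algebra by blast
  then obtain Q where Q: "P = [:- a, 1:] * Q" by (auto simp: poly_eq_0_iff_dvd dvd_def)
  with Suc(2) have "Q \<noteq> 0" by auto
  then have "degree P = Suc (degree Q)" using Q by (simp add: degree_mult_eq del: mult_pCons_left)
  then have "n = degree Q" using Suc(2) by simp
  from Suc(1)[OF this] obtain k where k: "continuous_on (cball 0 1) k" "k holomorphic_on ball 0 1"
    "\<And>w. norm w \<le> 1 \<Longrightarrow> norm (poly Q w) powr s \<le> norm (k w)"
    "\<And>w. norm w = 1 \<Longrightarrow> norm (k w) = norm (poly Q w) powr s" by auto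
  have "\<exists>l. continuous_on (cball 0 1) l \<and> l holomorphic_on ball 0 1 \<and>
    (\<forall>w. norm w \<le> 1 \<longrightarrow> norm (w - a) powr s \<le> norm (l w)) \<and>
    (\<forall>w. norm w = 1 \<longrightarrow> norm (l w) = norm (w - a) powr s)"
  proof (cases "norm a < 1")
    case True
    have nn: "1 - cnj a * w \<notin> \<real>\<^sub>\<le>\<^sub>0" if "norm w \<le> 1" for w
    proof -
      have "norm (cnj a * w) < 1" using that True mult_left_le[of "norm w" "norm a"] by (simp add: norm_mult)
      then have "Re (1 - cnj a * w) > 0" using complex_Re_le_cmod[of "cnj a * w"] by simp
      then show ?thesis by (auto simp: complex_nonpos_Reals_iff)
    qed
    have id: "(norm (1 - cnj a * w))\<^sup>2 - (norm (w - a))\<^sup>2 = (1 - (norm a)\<^sup>2) * (1 - (norm w)\<^sup>2)" for w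
      unfolding cmod_power2 by (simp add: algebra_simps power2_eq_square)
    show ?thesis
    proof (intro exI[of _ "\<lambda>w. (1 - cnj a * w) powr of_real s"] conjI allI impI)
      show "continuous_on (cball 0 1) (\<lambda>w. (1 - cnj a * w) powr of_real s)"
        unfolding continuous_on_def by (intro ballI tendsto_intros) (use nn in auto)
      show "(\<lambda>w. (1 - cnj a * w) powr of_real s) holomorphic_on ball 0 1"
        by (intro holomorphic_intros) (use nn in auto)
      fix w :: complex
      { assume w: "norm w \<le> 1"
        have "0 \<le> (1 - (norm a)\<^sup>2) * (1 - (norm w)\<^sup>2)"
          using True w by (intro mult_nonneg_nonneg) (auto simp: power_le_one)
        then have "(norm (w - a))\<^sup>2 \<le> (norm (1 - cnj a * w))\<^sup>2" using id[of w] by linarith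
        then have "norm (w - a) \<le> norm (1 - cnj a * w)" by (rule power2_le_imp_le) simp
        then show "norm (w - a) powr s \<le> norm ((1 - cnj a * w) powr of_real s)"
          using s by (simp add: norm_powr_real_powr' powr_mono2) }
      { assume w: "norm w = 1"
        then have "(norm (w - a))\<^sup>2 = (norm (1 - cnj a * w))\<^sup>2" using id[of w] by simp
        then have "norm (w - a) = norm (1 - cnj a * w)" by (rule power2_eq_imp_eq) auto
        then show "norm ((1 - cnj a * w) powr of_real s) = norm (w - a) powr s"
          by (simp add: norm_powr_real_powr') }
    qed
  next
    case False
    then have a: "1 \<le> norm a" "a \<noteq> 0" by auto
    \<comment> \<open>For |a| = 1 the zero lies on the circle itself. There \<open>1 - w / a\<close>
      meets the branch cut only at its end point 0, where the power with exponent
      \<open>s > 0\<close> is still continuous.\<close>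
    have nn: "1 - w / a \<notin> \<real>\<^sub>\<le>\<^sub>0 \<or> 1 - w / a = 0" if "norm w \<le> 1" for w
    proof (rule ccontr)
      assume nx: "\<not> ?thesis"
      then obtain x where x: "1 - w / a = of_real x" "x \<le> 0" by (auto elim!: nonpos_Reals_cases)
      then have "w / a = of_real (1 - x)" by (simp add: algebra_simps)
      then have "norm (w / a) = 1 - x" using x by (metis abs_of_nonneg norm_of_real diff_ge_0_iff_ge order_trans zero_le_one)
      moreover have "norm (w / a) \<le> 1" using that a by (simp add: norm_divide divide_le_eq)
      ultimately have "x = 0" using x by simp
      then show False using x nx by simp
    qed
    have eq: "norm (of_real (norm a powr s) * (1 - w / a) powr of_real s) = norm (w - a) powr s" for w
    proof -
      have "norm (of_real (norm a powr s) * (1 - w / a) powr of_real s) = (norm a * norm (1 - w / a)) powr s"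
        by (simp add: norm_mult norm_powr_real_powr' powr_mult)
      also have "norm a * norm (1 - w / a) = norm (w - a)"
      proof -
        have "a * (1 - w / a) = a - w" using a by (simp add: right_diff_distrib)
        then show ?thesis by (metis norm_mult norm_minus_commute)
      qed
      finally show ?thesis .
    qed
    show ?thesis
    proof (intro exI[of _ "\<lambda>w. of_real (norm a powr s) * (1 - w / a) powr of_real s"] conjI allI impI)
      show "continuous_on (cball 0 1) (\<lambda>w. of_real (norm a powr s) * (1 - w / a) powr of_real s)"
        unfolding continuous_on_def by (intro ballI tendsto_intros) (use nn s a in auto)
      have "1 - w / a \<noteq> 0" if "norm w < 1" for w
        using that a by auto
      then show "(\<lambda>w. of_real (norm a powr s) * (1 - w / a) powr of_real s) holomorphic_on ball 0 1"
        by (intro holomorphic_intros) (use nn a in \<open>force+\<close>)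
    qed (use eq in auto)
  qed
  then obtain l where l: "continuous_on (cball 0 1) l" "l holomorphic_on ball 0 1"
    "\<And>w. norm w \<le> 1 \<Longrightarrow> norm (w - a) powr s \<le> norm (l w)"
    "\<And>w. norm w = 1 \<Longrightarrow> norm (l w) = norm (w - a) powr s" by auto
  have P: "norm (poly P w) powr s = norm (w - a) powr s * norm (poly Q w) powr s" for w
    by (simp add: Q norm_mult[symmetric] powr_mult[symmetric] algebra_simps)
  show ?case
  proof (intro exI[of _ "\<lambda>w. l w * k w"] conjI ballI)
    fix w :: complex assume "w \<in> cball 0 1"
    then show "norm (poly P w) powr s \<le> norm (l w * k w)"
      unfolding P norm_mult by (intro mult_mono l k) auto
  next
    fix w :: complex assume "w \<in> sphere 0 1"
    then show "norm (l w * k w) = norm (poly P w) powr s"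
      unfolding P norm_mult by (simp add: l k)
  qed (intro continuous_intros holomorphic_intros l k)+
qed

lemma holomorphic_approx_poly:
  assumes f: "f holomorphic_on ball 0 R" and R: "1 < R" and e: "0 < e"
  shows "\<exists>P. \<forall>w\<in>cball 0 1. norm (f w - poly P w) < e"
proof -
  define c where "c = (\<lambda>n. (deriv ^^ n) f 0 / fact n)"
  have sums: "(\<lambda>n. c n * w ^ n) sums f w" if "norm w < R" for w
    using holomorphic_power_series[OF f, of w] that by (simp add: c_def)
  define \<rho> where "\<rho> = (1 + R) / 2"
  have \<rho>: "1 < \<rho>" "\<rho> < R" using R by (auto simp: \<rho>_def)
  have "summable (\<lambda>n. c n * of_real \<rho> ^ n)"
    using sums[of "of_real \<rho>"] \<rho> by (auto simp: sums_iff)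
  then have sn: "summable (\<lambda>n. norm (c n * 1 ^ n))"
    by (rule powser_insidea) (use \<rho> in auto)
  have "uniform_limit (cball 0 1) (\<lambda>n w. \<Sum>i<n. c i * w ^ i) (\<lambda>w. \<Sum>i. c i * w ^ i) sequentially"
  proof (rule Weierstrass_m_test[OF _ sn])
    fix n and w :: complex assume "w \<in> cball 0 1"
    then have "norm (w ^ n) \<le> 1" by (simp add: norm_power power_le_one)
    then show "norm (c n * w ^ n) \<le> norm (c n * 1 ^ n)"
      using mult_left_mono[of "norm (w ^ n)" 1 "norm (c n)"] by (simp add: norm_mult)
  qed
  from uniform_limitD[OF this e] obtain n where
    n: "\<And>w. norm w \<le> 1 \<Longrightarrow> dist (\<Sum>i<n. c i * w ^ i) (\<Sum>i. c i * w ^ i) < e"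
    unfolding eventually_sequentially by (metis order_refl mem_cball_0)
  show ?thesis
  proof (intro exI[of _ "\<Sum>i<n. monom (c i) i"] ballI)
    fix w :: complex assume w: "w \<in> cball 0 1"
    then have "(\<Sum>i. c i * w ^ i) = f w" using sums[of w] R by (simp add: sums_iff)
    then show "norm (f w - poly (\<Sum>i<n. monom (c i) i) w) < e"
      using n[of w] w by (simp add: poly_sum poly_monom dist_norm norm_minus_commute)
  qed
qed

lemma continuous_on_norm_powr:
  assumes "continuous_on A f" "0 < s"
  shows "continuous_on A (\<lambda>x. norm (f x) powr s)"
  using assms by (intro continuous_on_powr' continuous_intros) auto

text \<open>This is where the majorant pays: inside the disc it exceeds the power of |P|, on the
  circle it has the same modulus. So the Poisson representation of the holomorphic function
  \<open>k\<close> gives the inequality for \<open>|P|^s\<close>.\<close>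

lemma norm_powr_le_poisson_poly:
  assumes s: "0 < s" and r: "0 \<le> r" "r < 1"
  shows "norm (poly P (of_real r * circ \<theta>)) powr s \<le>
    integral {0..1} (\<lambda>x. poisson r (\<theta> - x) * norm (poly P (circ x)) powr s)"
proof -
  obtain k where k: "continuous_on (cball 0 1) k" "k holomorphic_on ball 0 1"
    "\<And>w. norm w \<le> 1 \<Longrightarrow> norm (poly P w) powr s \<le> norm (k w)"
    "\<And>w. norm w = 1 \<Longrightarrow> norm (k w) = norm (poly P w) powr s"
    using poly_power_majorant[OF s, of P] by auto
  have "norm (poly P (of_real r * circ \<theta>)) powr s \<le> norm (k (of_real r * circ \<theta>))"
    using r by (intro k) (simp add: norm_mult)
  also have "k (of_real r * circ \<theta>) = integral {0..1} (\<lambda>x. k (circ x) * of_real (poisson r (\<theta> - x)))"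
    by (rule integral_unique[OF poisson_representation'[OF k(1,2) r], symmetric])
  also have "norm \<dots> \<le> integral {0..1} (\<lambda>x. poisson r (\<theta> - x) * norm (poly P (circ x)) powr s)"
  proof (rule integral_norm_bound_integral)
    show "(\<lambda>x. k (circ x) * of_real (poisson r (\<theta> - x))) integrable_on {0..1}"
      using poisson_representation'[OF k(1,2) r] by (rule has_integral_integrable)
    show "(\<lambda>x. poisson r (\<theta> - x) * norm (poly P (circ x)) powr s) integrable_on {0..1}"
      using r s by (intro integrable_continuous_real continuous_on_mult continuous_on_norm_powr continuous_on_poisson continuous_intros) auto
    show "norm (k (circ x) * of_real (poisson r (\<theta> - x))) \<le> poisson r (\<theta> - x) * norm (poly P (circ x)) powr s"
      for x using r by (simp add: norm_mult k poisson_nonneg abs_of_nonneg mult.commute)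
  qed
  finally show ?thesis .
qed

text \<open>Polynomials come first because their zeros can be split off one at a time. The passage
  to \<open>f\<close> is uniform approximation on the closed disc; the Poisson kernel has total mass
  1, so each of the two errors is at most \<open>e / 2\<close>.\<close>

lemma norm_powr_le_poisson:
  assumes f: "f holomorphic_on ball 0 R" and R: "1 < R"
    and s: "0 < s" and r: "0 \<le> r" "r < 1"
  shows "norm (f (of_real r * circ \<theta>)) powr s \<le>
    integral {0..1} (\<lambda>x. poisson r (\<theta> - x) * norm (f (circ x)) powr s)"
proof (rule field_le_epsilon)
  fix e :: real assume e: "0 < e"
  have cf: "continuous_on (cball 0 1) f"
    using f R by (intro holomorphic_on_imp_continuous_on holomorphic_on_subset[OF f]) auto
  have "compact (f ` cball 0 1)" by (intro compact_continuous_image cf) auto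
  then obtain M where M: "\<And>w. norm w \<le> 1 \<Longrightarrow> norm (f w) \<le> M"
    by (metis mem_cball_0 bounded_iff compact_imp_bounded imageI)
  \<comment> \<open>The interval reaches to \<open>M + 1\<close> because the approximating
    polynomial is taken within distance 1 of \<open>f\<close>. Uniform continuity on a compact
    interval also covers exponents below 1.\<close>
  have "uniformly_continuous_on {0..M + 1} (\<lambda>x::real. x powr s)"
    by (intro compact_uniformly_continuous continuous_on_powr' continuous_intros) (use s in auto)
  then obtain d where d: "d > 0" "\<And>x y. x \<in> {0..M+1} \<Longrightarrow> y \<in> {0..M+1} \<Longrightarrow> dist y x < d \<Longrightarrow> dist (y powr s) (x powr s) < e / 2"
    unfolding uniformly_continuous_on_def using e by (metis half_gt_zero)
  obtain P where P: "\<And>w. norm w \<le> 1 \<Longrightarrow> norm (f w - poly P w) < min d 1"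
    using holomorphic_approx_poly[OF f R, of "min d 1"] d(1) by (metis mem_cball_0 min_less_iff_conj zero_less_one)
  have close: "\<bar>norm (f w) powr s - norm (poly P w) powr s\<bar> < e / 2" if w: "norm w \<le> 1" for w
  proof -
    have a: "\<bar>norm (f w) - norm (poly P w)\<bar> < min d 1"
      using P[OF w] norm_triangle_ineq3[of "f w" "poly P w"] by linarith
    then have "dist (norm (f w) powr s) (norm (poly P w) powr s) < e / 2"
      using M[OF w] by (intro d(2)) (auto simp: dist_real_def)
    then show ?thesis by (simp add: dist_real_def)
  qed
  have cP: "continuous_on {0..1} (\<lambda>x. poisson r (\<theta> - x))" using r by (intro continuous_intros) auto
  have cfc: "continuous_on {0..1} (\<lambda>x. f (circ x))"
    by (rule continuous_on_compose2[OF cf]) (auto intro!: continuous_intros)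
  have i1: "(\<lambda>x. poisson r (\<theta> - x) * norm (f (circ x)) powr s) integrable_on {0..1}"
    by (intro integrable_continuous_real continuous_on_mult cP continuous_on_norm_powr cfc s)
  have i2: "((\<lambda>x. poisson r (\<theta> - x)) has_integral 1) {0..1}" using r by (rule poisson_integral_1)
  have "norm (f (of_real r * circ \<theta>)) powr s \<le> norm (poly P (of_real r * circ \<theta>)) powr s + e / 2"
  proof -
    have "norm (of_real r * circ \<theta>) \<le> 1" using r by (simp add: norm_mult)
    from close[OF this] show ?thesis by linarith
  qed
  also have "norm (poly P (of_real r * circ \<theta>)) powr s \<le>
      integral {0..1} (\<lambda>x. poisson r (\<theta> - x) * norm (poly P (circ x)) powr s)"
    by (rule norm_powr_le_poisson_poly[OF s r])
  also have "\<dots> \<le> integral {0..1} (\<lambda>x. poisson r (\<theta> - x) * norm (f (circ x)) powr s + poisson r (\<theta> - x) * (e / 2))"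
  proof (rule integral_le)
    show "(\<lambda>x. poisson r (\<theta> - x) * norm (poly P (circ x)) powr s) integrable_on {0..1}"
      using s by (intro integrable_continuous_real continuous_on_mult cP continuous_on_norm_powr continuous_intros) auto
    show "(\<lambda>x. poisson r (\<theta> - x) * norm (f (circ x)) powr s + poisson r (\<theta> - x) * (e / 2)) integrable_on {0..1}"
      using i1 i2 by (intro integrable_add integrable_on_mult_left) auto
    fix x :: real
    have "norm (poly P (circ x)) powr s \<le> norm (f (circ x)) powr s + e / 2"
    proof -
      have "norm (circ x) \<le> 1" by simp
      from close[OF this] show ?thesis by linarith
    qed
    moreover have "0 \<le> poisson r (\<theta> - x)" using r by (intro poisson_nonneg) auto
    ultimately show "poisson r (\<theta> - x) * norm (poly P (circ x)) powr s \<le>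
        poisson r (\<theta> - x) * norm (f (circ x)) powr s + poisson r (\<theta> - x) * (e / 2)"
      unfolding distrib_left[symmetric] by (rule mult_left_mono)
  qed
  also have "\<dots> = integral {0..1} (\<lambda>x. poisson r (\<theta> - x) * norm (f (circ x)) powr s) + e / 2"
    by (subst integral_add) (use i1 i2 in \<open>auto simp: integral_unique intro!: integrable_on_mult_left\<close>)
  finally show "norm (f (of_real r * circ \<theta>)) powr s \<le>
      integral {0..1} (\<lambda>x. poisson r (\<theta> - x) * norm (f (circ x)) powr s) + e" by simp
qed

section \<open>The Poisson operator with variable radius on L^2 of the circle\<close>

abbreviation circ_measure :: "real measure" where
  "circ_measure \<equiv> density lborel (indicator {0..1})"

lemma finite_measure_circ_measure: "finite_measure circ_measure"
  by (rule finite_measureI) (simp add: emeasure_density)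

lemma nn_integral_circ_measure:
  assumes f: "continuous_on {0..1} f" "\<And>x. x \<in> {0..1} \<Longrightarrow> 0 \<le> f x"
    and m: "f \<in> borel_measurable borel"
  shows "(\<integral>\<^sup>+x. ennreal (f x) \<partial>circ_measure) = ennreal (integral {0..1} f)"
proof -
  have "(\<integral>\<^sup>+x. ennreal (f x) \<partial>circ_measure) = (\<integral>\<^sup>+x. indicator {0..1} x * ennreal (f x) \<partial>lborel)"
    by (rule nn_integral_density) (use m in measurable)
  also have "\<dots> = (\<integral>\<^sup>+x. ennreal (indicator {0..1} x *\<^sub>R f x) \<partial>lborel)"
    by (rule nn_integral_cong) (auto simp: indicator_def)
  also have "\<dots> = ennreal (integral\<^sup>L lborel (\<lambda>x. indicator {0..1} x *\<^sub>R f x))"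
    by (rule nn_integral_eq_integral) (use f borel_integrable_compact[of "{0..1}" f] in \<open>auto simp: indicator_def set_integrable_def\<close>)
  also have "integral\<^sup>L lborel (\<lambda>x. indicator {0..1} x *\<^sub>R f x) = integral {0..1} f"
    using set_borel_integral_eq_integral(2)[of "{0..1}" f] borel_integrable_compact[of "{0..1}" f] f(1)
    by (simp add: set_integrable_def set_lebesgue_integral_def)
  finally show ?thesis .
qed

lemma borel_measurable_poisson [measurable (raw)]:
  assumes [measurable]: "f \<in> borel_measurable M" "g \<in> borel_measurable M"
  shows "(\<lambda>x. poisson (f x) (g x)) \<in> borel_measurable M"
proof -
  have [measurable]: "circ \<in> borel_measurable borel"
    by (intro borel_measurable_continuous_onI continuous_intros)
  show ?thesis unfolding poisson_def by measurable
qed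

lemma nn_integral_poisson_semigroup:
  assumes r: "0 \<le> r" "r < 1" and s: "0 \<le> s" "s < 1"
  shows "(\<integral>\<^sup>+y. ennreal (poisson r (x - y)) * ennreal (poisson s (z - y)) \<partial>circ_measure) = ennreal (poisson (r * s) (x - z))"
proof -
  have m: "poisson s (z - y) = poisson s (y - z)" for y using poisson_minus[of s "z - y"] by simp
  have "(\<integral>\<^sup>+y. ennreal (poisson r (x - y)) * ennreal (poisson s (z - y)) \<partial>circ_measure)
     = (\<integral>\<^sup>+y. ennreal (poisson r (x - y) * poisson s (y - z)) \<partial>circ_measure)"
    using r s by (intro nn_integral_cong) (simp add: m ennreal_mult poisson_nonneg)
  also have "\<dots> = ennreal (integral {0..1} (\<lambda>y. poisson r (x - y) * poisson s (y - z)))"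
    by (rule nn_integral_circ_measure) (use r s in \<open>auto intro!: continuous_intros mult_nonneg_nonneg poisson_nonneg\<close>)
  also have "\<dots> = ennreal (poisson (r * s) (x - z))"
    by (subst integral_unique[OF poisson_semigroup[OF r s]]) simp
  finally show ?thesis .
qed

text \<open>The radius is a function of the point. A measurable choice of a maximizing radius makes
  this linear operator agree with a maximal operator at a given function.\<close>

definition poisson_op :: "(real \<Rightarrow> real) \<Rightarrow> (real \<Rightarrow> ennreal) \<Rightarrow> real \<Rightarrow> ennreal" where
  "poisson_op r u \<theta> = (\<integral>\<^sup>+x. ennreal (poisson (r \<theta>) (\<theta> - x)) * u x \<partial>circ_measure)"

interpretation circ_measure: finite_measure circ_measure
  by (rule finite_measure_circ_measure)

interpretation circ_pair: pair_sigma_finite circ_measure circ_measure ..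

lemma borel_measurable_poisson_op [measurable]:
  assumes [measurable]: "r \<in> borel_measurable borel" "u \<in> borel_measurable borel"
  shows "poisson_op r u \<in> borel_measurable borel"
  unfolding poisson_op_def by measurable

text \<open>
  The left-hand side is the square of the norm of the adjoint operator applied to \<open>g\<close>; by the semigroup
  law the composition with its adjoint has the kernel \<open>poisson (r \<theta> * r \<eta>) (\<theta> - \<eta>)\<close>.
\<close>

lemma poisson_op_TTstar:
  assumes [measurable]: "r \<in> borel_measurable borel" "g \<in> borel_measurable borel"
    and r: "\<And>\<theta>. 0 \<le> r \<theta> \<and> r \<theta> < 1"
  shows "(\<integral>\<^sup>+x. (\<integral>\<^sup>+\<theta>. ennreal (poisson (r \<theta>) (\<theta> - x)) * g \<theta> \<partial>circ_measure)\<^sup>2 \<partial>circ_measure)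
    \<le> 16 * (\<integral>\<^sup>+\<theta>. g \<theta> * poisson_op r g \<theta> \<partial>circ_measure)"
proof -
  let ?C = circ_measure
  define p where "p = (\<lambda>\<theta> x. ennreal (poisson (r \<theta>) (\<theta> - x)))"
  have [measurable]: "(\<lambda>x. p (f x) (h x)) \<in> borel_measurable M"
    if [measurable]: "f \<in> borel_measurable M" "h \<in> borel_measurable M" for f h and M :: "'z measure"
    unfolding p_def by measurable
  have pg: "poisson_op r g \<theta> = (\<integral>\<^sup>+x. p \<theta> x * g x \<partial>?C)" for \<theta> by (simp add: poisson_op_def p_def)
  have "(\<integral>\<^sup>+x. (\<integral>\<^sup>+\<theta>. p \<theta> x * g \<theta> \<partial>?C)\<^sup>2 \<partial>?C)
      = (\<integral>\<^sup>+x. (\<integral>\<^sup>+\<theta>. (\<integral>\<^sup>+\<eta>. (p \<theta> x * p \<eta> x) * (g \<theta> * g \<eta>) \<partial>?C) \<partial>?C) \<partial>?C)"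
  proof (intro nn_integral_cong)
    fix x
    have "(\<integral>\<^sup>+\<theta>. p \<theta> x * g \<theta> \<partial>?C)\<^sup>2 = (\<integral>\<^sup>+\<theta>. (\<integral>\<^sup>+\<eta>. (p \<theta> x * g \<theta>) * (p \<eta> x * g \<eta>) \<partial>?C) \<partial>?C)"
      by (simp add: nn_integral_cmult nn_integral_multc power2_eq_square)
    then show "(\<integral>\<^sup>+\<theta>. p \<theta> x * g \<theta> \<partial>?C)\<^sup>2 = (\<integral>\<^sup>+\<theta>. (\<integral>\<^sup>+\<eta>. (p \<theta> x * p \<eta> x) * (g \<theta> * g \<eta>) \<partial>?C) \<partial>?C)"
      by (simp add: mult_ac)
  qed
  also have "\<dots> = (\<integral>\<^sup>+\<theta>. (\<integral>\<^sup>+x. (\<integral>\<^sup>+\<eta>. (p \<theta> x * p \<eta> x) * (g \<theta> * g \<eta>) \<partial>?C) \<partial>?C) \<partial>?C)"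
    by (rule circ_pair.Fubini') measurable
  also have "\<dots> = (\<integral>\<^sup>+\<theta>. (\<integral>\<^sup>+\<eta>. (\<integral>\<^sup>+x. (p \<theta> x * p \<eta> x) * (g \<theta> * g \<eta>) \<partial>?C) \<partial>?C) \<partial>?C)"
    by (intro nn_integral_cong circ_pair.Fubini') measurable
  also have "\<dots> = (\<integral>\<^sup>+\<theta>. (\<integral>\<^sup>+\<eta>. ennreal (poisson (r \<theta> * r \<eta>) (\<theta> - \<eta>)) * (g \<theta> * g \<eta>) \<partial>?C) \<partial>?C)"
    using r by (simp add: nn_integral_multc nn_integral_poisson_semigroup[folded p_def] p_def)
  also have "\<dots> \<le> (\<integral>\<^sup>+\<theta>. (\<integral>\<^sup>+\<eta>. 8 * (p \<theta> \<eta> * (g \<theta> * g \<eta>)) + 8 * (p \<eta> \<theta> * (g \<theta> * g \<eta>)) \<partial>?C) \<partial>?C)"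
  proof (intro nn_integral_mono)
    fix \<theta> \<eta>
    have "poisson (r \<theta> * r \<eta>) (\<theta> - \<eta>) \<le> 8 * (poisson (r \<theta>) (\<theta> - \<eta>) + poisson (r \<eta>) (\<eta> - \<theta>))"
      using poisson_mult_le[of "r \<theta>" "r \<eta>" "\<theta> - \<eta>"] r poisson_minus[of "r \<eta>" "\<theta> - \<eta>"] by simp
    then have "ennreal (poisson (r \<theta> * r \<eta>) (\<theta> - \<eta>)) \<le> ennreal (8 * (poisson (r \<theta>) (\<theta> - \<eta>) + poisson (r \<eta>) (\<eta> - \<theta>)))"
      by (rule ennreal_leI)
    also have "\<dots> = 8 * (p \<theta> \<eta> + p \<eta> \<theta>)"
      using r[of \<theta>] r[of \<eta>] unfolding p_def by (simp add: ennreal_mult ennreal_plus poisson_nonneg)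
    finally have "ennreal (poisson (r \<theta> * r \<eta>) (\<theta> - \<eta>)) \<le> 8 * (p \<theta> \<eta> + p \<eta> \<theta>)" .
    from mult_right_mono[OF this, of "g \<theta> * g \<eta>"]
    show "ennreal (poisson (r \<theta> * r \<eta>) (\<theta> - \<eta>)) * (g \<theta> * g \<eta>) \<le>
        8 * (p \<theta> \<eta> * (g \<theta> * g \<eta>)) + 8 * (p \<eta> \<theta> * (g \<theta> * g \<eta>))"
      by (simp add: algebra_simps)
  qed
  also have "\<dots> = 8 * (\<integral>\<^sup>+\<theta>. (\<integral>\<^sup>+\<eta>. p \<theta> \<eta> * (g \<theta> * g \<eta>) \<partial>?C) \<partial>?C) + 8 * (\<integral>\<^sup>+\<theta>. (\<integral>\<^sup>+\<eta>. p \<eta> \<theta> * (g \<theta> * g \<eta>) \<partial>?C) \<partial>?C)"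
    by (simp add: nn_integral_add nn_integral_cmult)
  \<comment> \<open>By Fubini the term with exchanged variables equals the other one; both are the
    quadratic form of the operator at \<open>g\<close>, whence 8 + 8 = 16.\<close>
  also have "(\<integral>\<^sup>+\<theta>. (\<integral>\<^sup>+\<eta>. p \<eta> \<theta> * (g \<theta> * g \<eta>) \<partial>?C) \<partial>?C) = (\<integral>\<^sup>+\<eta>. (\<integral>\<^sup>+\<theta>. p \<eta> \<theta> * (g \<theta> * g \<eta>) \<partial>?C) \<partial>?C)"
    by (rule circ_pair.Fubini') measurable
  also have "\<dots> = (\<integral>\<^sup>+\<theta>. g \<theta> * poisson_op r g \<theta> \<partial>?C)"
    unfolding pg by (simp add: nn_integral_cmult[symmetric] mult_ac)
  also have "(\<integral>\<^sup>+\<theta>. (\<integral>\<^sup>+\<eta>. p \<theta> \<eta> * (g \<theta> * g \<eta>) \<partial>?C) \<partial>?C) = (\<integral>\<^sup>+\<theta>. g \<theta> * poisson_op r g \<theta> \<partial>?C)"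
    unfolding pg by (simp add: nn_integral_cmult[symmetric] mult_ac)
  finally show ?thesis unfolding p_def by (simp add: distrib_right[symmetric])
qed

lemma poisson_le:
  assumes r: "0 \<le> r" "r \<le> R" "R < 1"
  shows "poisson r x \<le> 1 / (1 - R)\<^sup>2"
proof -
  have "1 - R \<le> 1 - r" using r by simp
  also have "\<dots> \<le> norm (1 - of_real r * circ x)"
    using norm_triangle_ineq2[of 1 "of_real r * circ x"] r by (simp add: norm_mult)
  finally have "(1 - R)\<^sup>2 \<le> (norm (1 - of_real r * circ x))\<^sup>2" using r by (intro power_mono) auto
  then show ?thesis unfolding poisson_def using r by (intro frac_le) auto
qed

lemma emeasure_circ_measure [simp]: "emeasure circ_measure UNIV = 1"
  by (simp add: emeasure_density)

text \<open>A bound that blows up as \<open>R\<close> tends to 1. It only guarantees that some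
  finite constant exists, from which the self-improvement can start.\<close>

lemma poisson_op_crude:
  assumes [measurable]: "r \<in> borel_measurable borel" "u \<in> borel_measurable borel"
    and r: "\<And>\<theta>. 0 \<le> r \<theta> \<and> r \<theta> \<le> R" "R < 1"
  shows "(\<integral>\<^sup>+\<theta>. (poisson_op r u \<theta>)\<^sup>2 \<partial>circ_measure) \<le> ennreal ((1 / (1 - R)\<^sup>2)\<^sup>2) * (\<integral>\<^sup>+x. (u x)\<^sup>2 \<partial>circ_measure)"
proof -
  let ?C = circ_measure and ?D = "1 / (1 - R)\<^sup>2"
  have "(poisson_op r u \<theta>)\<^sup>2 \<le> ennreal (?D\<^sup>2) * (\<integral>\<^sup>+x. (u x)\<^sup>2 \<partial>?C)" for \<theta>
  proof -
    have "poisson_op r u \<theta> \<le> (\<integral>\<^sup>+x. ennreal ?D * u x \<partial>?C)"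
      unfolding poisson_op_def using r by (intro nn_integral_mono mult_right_mono ennreal_leI poisson_le) auto
    also have "\<dots> = ennreal ?D * (\<integral>\<^sup>+x. u x * 1 \<partial>?C)" by (simp add: nn_integral_cmult)
    finally have "(poisson_op r u \<theta>)\<^sup>2 \<le> (ennreal ?D * (\<integral>\<^sup>+x. u x * 1 \<partial>?C))\<^sup>2" by (intro power_mono) auto
    also have "\<dots> = ennreal (?D\<^sup>2) * (\<integral>\<^sup>+x. u x * 1 \<partial>?C)\<^sup>2"
      by (simp add: power_mult_distrib ennreal_power)
    also have "(\<integral>\<^sup>+x. u x * 1 \<partial>?C)\<^sup>2 \<le> (\<integral>\<^sup>+x. (u x)\<^sup>2 \<partial>?C) * (\<integral>\<^sup>+x. 1\<^sup>2 \<partial>?C)"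
      by (rule Cauchy_Schwarz_nn_integral) measurable
    also have "(\<integral>\<^sup>+x. 1\<^sup>2 \<partial>?C) = 1" by simp
    finally show ?thesis by (simp add: mult_left_mono)
  qed
  then have "(\<integral>\<^sup>+\<theta>. (poisson_op r u \<theta>)\<^sup>2 \<partial>?C) \<le> (\<integral>\<^sup>+\<theta>. ennreal (?D\<^sup>2) * (\<integral>\<^sup>+x. (u x)\<^sup>2 \<partial>?C) \<partial>?C)"
    by (intro nn_integral_mono)
  then show ?thesis by simp
qed

text \<open>Any bound self-improves as long as it exceeds the fixed point \<open>256\<close> of \<open>B \<mapsto> 16 * sqrt B\<close>.\<close>

lemma poisson_op_step:
  assumes rm[measurable]: "r \<in> borel_measurable borel" and um[measurable]: "u \<in> borel_measurable borel"
    and r: "\<And>\<theta>. 0 \<le> r \<theta> \<and> r \<theta> < 1" and B: "0 < B"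
    and le: "\<And>u. u \<in> borel_measurable borel \<Longrightarrow>
       (\<integral>\<^sup>+\<theta>. (poisson_op r u \<theta>)\<^sup>2 \<partial>circ_measure) \<le> ennreal B * (\<integral>\<^sup>+x. (u x)\<^sup>2 \<partial>circ_measure)"
  shows "(\<integral>\<^sup>+\<theta>. (poisson_op r u \<theta>)\<^sup>2 \<partial>circ_measure) \<le> ennreal (16 * sqrt B) * (\<integral>\<^sup>+x. (u x)\<^sup>2 \<partial>circ_measure)"
proof (cases "(\<integral>\<^sup>+x. (u x)\<^sup>2 \<partial>circ_measure) = \<infinity>")
  case True
  then show ?thesis using B by (simp add: ennreal_mult_top)
next
  case False
  let ?C = circ_measure
  define g where "g = poisson_op r u"
  have [measurable]: "g \<in> borel_measurable borel" unfolding g_def by measurable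
  define N where "N = (\<integral>\<^sup>+x. (u x)\<^sup>2 \<partial>?C)"
  define G where "G = (\<integral>\<^sup>+x. (g x)\<^sup>2 \<partial>?C)"
  \<comment> \<open>The adjoint operator applied to \<open>g\<close>; with \<open>g\<close> the
    image of \<open>u\<close>, the square norm \<open>G\<close> of \<open>g\<close> is the pairing
    of \<open>u\<close> with \<open>h\<close>. Cauchy-Schwarz and the kernel estimate then bound
    \<open>G^2\<close> by \<open>16 * N * X\<close>, and a second Cauchy-Schwarz bounds
    \<open>X\<close> by \<open>sqrt B * G\<close>.\<close>
  define h where "h = (\<lambda>x. \<integral>\<^sup>+\<theta>. ennreal (poisson (r \<theta>) (\<theta> - x)) * g \<theta> \<partial>?C)"
  have [measurable]: "h \<in> borel_measurable borel" unfolding h_def by measurable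
  define X where "X = (\<integral>\<^sup>+\<theta>. g \<theta> * poisson_op r g \<theta> \<partial>?C)"
  have "G = (\<integral>\<^sup>+\<theta>. (\<integral>\<^sup>+x. ennreal (poisson (r \<theta>) (\<theta> - x)) * u x * g \<theta> \<partial>?C) \<partial>?C)"
    unfolding G_def power2_eq_square by (subst (1) g_def) (simp add: poisson_op_def nn_integral_multc)
  also have "\<dots> = (\<integral>\<^sup>+x. (\<integral>\<^sup>+\<theta>. ennreal (poisson (r \<theta>) (\<theta> - x)) * u x * g \<theta> \<partial>?C) \<partial>?C)"
    by (rule circ_pair.Fubini') measurable
  also have "\<dots> = (\<integral>\<^sup>+x. u x * h x \<partial>?C)"
    unfolding h_def by (simp add: nn_integral_cmult[symmetric] mult_ac)
  finally have "G\<^sup>2 = (\<integral>\<^sup>+x. u x * h x \<partial>?C)\<^sup>2" by simp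
  also have "\<dots> \<le> N * (\<integral>\<^sup>+x. (h x)\<^sup>2 \<partial>?C)"
    unfolding N_def by (rule Cauchy_Schwarz_nn_integral) measurable
  also have "(\<integral>\<^sup>+x. (h x)\<^sup>2 \<partial>?C) \<le> 16 * X"
    unfolding h_def X_def by (rule poisson_op_TTstar) (use r in \<open>auto\<close>, measurable)
  finally have G1: "G\<^sup>2 \<le> N * (16 * X)" by (simp add: mult_left_mono)
  have "X\<^sup>2 \<le> G * (\<integral>\<^sup>+\<theta>. (poisson_op r g \<theta>)\<^sup>2 \<partial>?C)"
    unfolding X_def G_def by (rule Cauchy_Schwarz_nn_integral) measurable
  also have "\<dots> \<le> G * (ennreal B * G)"
    unfolding G_def by (intro mult_left_mono le) simp_all
  finally have X1: "X\<^sup>2 \<le> G * (ennreal B * G)" .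
  \<comment> \<open>This use of the assumed bound only shows that \<open>G\<close> is finite, so
    that the factor \<open>\<gamma>\<close> can be cancelled at the end.\<close>
  have G2: "G \<le> ennreal B * N" unfolding G_def N_def g_def by (rule le) (rule um)
  obtain n where n: "N = ennreal n" "0 \<le> n" using False unfolding N_def by (cases N) (auto simp: N_def)
  have "ennreal B * N < \<infinity>" using n by (simp add: ennreal_mult_less_top)
  with G2 have "G \<noteq> \<infinity>" by (auto simp: top_unique)
  then obtain \<gamma> where \<gamma>: "G = ennreal \<gamma>" "0 \<le> \<gamma>" by (cases G) auto
  have "X \<noteq> \<infinity>"
  proof
    assume "X = \<infinity>"
    with X1 \<gamma> show False by (simp add: power2_eq_square ennreal_mult_top top_unique ennreal_mult_eq_top_iff)
  qed
  then obtain x where x: "X = ennreal x" "0 \<le> x" by (cases X) auto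
  have "ennreal (x\<^sup>2) \<le> ennreal (\<gamma> * (B * \<gamma>))"
    using X1 x \<gamma> B by (simp add: ennreal_power ennreal_mult)
  then have "x\<^sup>2 \<le> (sqrt B * \<gamma>)\<^sup>2" using x \<gamma> B by (simp add: power_mult_distrib power2_eq_square mult_ac)
  then have x2: "x \<le> sqrt B * \<gamma>" by (rule power2_le_imp_le) (use \<gamma> B in simp)
  have "ennreal (\<gamma>\<^sup>2) \<le> ennreal (n * (16 * x))"
    using G1 x \<gamma> n by (simp add: ennreal_power ennreal_mult)
  then have "\<gamma>\<^sup>2 \<le> n * (16 * x)" using n x by simp
  also have "\<dots> \<le> n * (16 * (sqrt B * \<gamma>))" using x2 n by (intro mult_left_mono) auto
  finally have "\<gamma> * \<gamma> \<le> (16 * sqrt B * n) * \<gamma>" by (simp add: power2_eq_square mult_ac)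
  then have "\<gamma> \<le> 16 * sqrt B * n" using \<gamma> n B by (cases "\<gamma> = 0") auto
  then have "G \<le> ennreal (16 * sqrt B) * N"
    using \<gamma> n B by (simp add: ennreal_mult[symmetric] ennreal_leI)
  then show ?thesis by (simp add: G_def N_def g_def)
qed

text \<open>The infimum of the admissible constants cannot exceed 256, since the improvement step
  would produce a smaller one. The value 257 leaves room to pick an admissible constant near the
  infimum. What matters is independence of \<open>R\<close>.\<close>

lemma poisson_op_bound:
  assumes rm: "r \<in> borel_measurable borel" and um: "u \<in> borel_measurable borel"
    and r: "\<And>\<theta>. 0 \<le> r \<theta> \<and> r \<theta> \<le> R" "R < 1"
  shows "(\<integral>\<^sup>+\<theta>. (poisson_op r u \<theta>)\<^sup>2 \<partial>circ_measure) \<le> 257 * (\<integral>\<^sup>+x. (u x)\<^sup>2 \<partial>circ_measure)"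
proof -
  define S where "S = {B. 0 < B \<and> (\<forall>u\<in>borel_measurable borel.
       (\<integral>\<^sup>+\<theta>. (poisson_op r u \<theta>)\<^sup>2 \<partial>circ_measure) \<le> ennreal B * (\<integral>\<^sup>+x. (u x)\<^sup>2 \<partial>circ_measure))}"
  have r': "0 \<le> r \<theta> \<and> r \<theta> < 1" for \<theta> using r(1)[of \<theta>] r(2) by linarith
  have step: "16 * sqrt B \<in> S" if "B \<in> S" for B
    using that poisson_op_step[OF rm _ r', of _ B] by (auto simp: S_def)
  have "(1 / (1 - R)\<^sup>2)\<^sup>2 \<in> S"
    using poisson_op_crude[OF rm _ r] r by (auto simp: S_def)
  then have ne: "S \<noteq> {}" by auto
  have bdd: "bdd_below S" by (rule bdd_belowI[of _ 0]) (auto simp: S_def)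
  have "Inf S \<le> 256"
  proof (rule ccontr)
    assume "\<not> ?thesis"
    then have b: "256 < Inf S" by simp
    then have "Inf S * 256 < Inf S * Inf S" by simp
    then have "Inf S < (Inf S)\<^sup>2 / 256" by (simp add: power2_eq_square)
    then obtain B where B: "B \<in> S" "B < (Inf S)\<^sup>2 / 256"
      using cInf_less_iff[OF ne bdd] by blast
    have "sqrt B < sqrt ((Inf S / 16)\<^sup>2)" using B by (simp add: power_divide)
    then have "16 * sqrt B < Inf S" using b by simp
    moreover have "Inf S \<le> 16 * sqrt B" using step[OF B(1)] bdd by (rule cInf_lower)
    ultimately show False by simp
  qed
  then have "Inf S < 257" by simp
  then obtain B where B: "B \<in> S" "B < 257" using cInf_less_iff[OF ne bdd] by blast
  then have "(\<integral>\<^sup>+\<theta>. (poisson_op r u \<theta>)\<^sup>2 \<partial>circ_measure) \<le> ennreal B * (\<integral>\<^sup>+x. (u x)\<^sup>2 \<partial>circ_measure)"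
    using um by (auto simp: S_def)
  also have "\<dots> \<le> ennreal 257 * (\<integral>\<^sup>+x. (u x)\<^sup>2 \<partial>circ_measure)"
    using B by (intro mult_right_mono ennreal_leI) auto
  finally show ?thesis by simp
qed

section \<open>The maximal function over finitely many radii\<close>

text \<open>Finiteness allows a maximizing parameter to be chosen measurably by comparing one
  candidate at a time. Measurability of the attained value is carried through the induction, as it
  makes the next comparison measurable.\<close>

lemma measurable_argmax:
  fixes F :: "real \<Rightarrow> real \<Rightarrow> real"
  assumes "finite T" "T \<noteq> {}" "\<And>t. t \<in> T \<Longrightarrow> F t \<in> borel_measurable borel"
  shows "\<exists>r\<in>borel_measurable borel. (\<lambda>x. F (r x) x) \<in> borel_measurable borel \<and>
    (\<forall>x. r x \<in> T \<and> (\<forall>t\<in>T. F t x \<le> F (r x) x))"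
  using assms
proof (induction T rule: finite_ne_induct)
  case (singleton t)
  then show ?case by (intro bexI[of _ "\<lambda>_. t"]) auto
next
  case (insert t T)
  then obtain r where r[measurable]: "r \<in> borel_measurable borel" "(\<lambda>x. F (r x) x) \<in> borel_measurable borel"
    and r': "\<And>x. r x \<in> T \<and> (\<forall>t\<in>T. F t x \<le> F (r x) x)" by auto
  have [measurable]: "F t \<in> borel_measurable borel" using insert by auto
  let ?r = "\<lambda>x. if F t x \<le> F (r x) x then r x else t"
  have eq: "(\<lambda>x. F (?r x) x) = (\<lambda>x. if F t x \<le> F (r x) x then F (r x) x else F t x)" by auto
  show ?case
  proof (intro bexI[of _ ?r] conjI allI)
    show "(\<lambda>x. F (?r x) x) \<in> borel_measurable borel" unfolding eq by measurable
    show "?r x \<in> insert t T" for x using r' by auto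
    show "\<forall>s\<in>insert t T. F s x \<le> F (?r x) x" for x using r'[of x] by (auto intro: order_trans)
  qed measurable
qed

text \<open>The Poisson majorant of \<open>|f|^(p/2)\<close> at the maximizing radius is
  \<open>poisson_op r u\<close>, and its square dominates the maximal function of
  \<open>|f|^p\<close>. Thus the L^2 bound yields the result for every \<open>p > 0\<close>;
  \<open>Max T < 1\<close> provides the bound on the radii.\<close>

lemma radial_maximal_circle:
  assumes f: "f holomorphic_on ball 0 R" and R: "1 < R" and p: "0 < p"
    and T: "finite T" "T \<noteq> {}" "T \<subseteq> {0..<1}"
  shows "(\<integral>\<^sup>+x. (MAX t\<in>T. ennreal (norm (f (of_real t * circ x)) powr p)) \<partial>circ_measure)
    \<le> 257 * (\<integral>\<^sup>+x. ennreal (norm (f (circ x)) powr p) \<partial>circ_measure)"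
proof -
  let ?F = "\<lambda>t x. norm (f (of_real t * circ x))"
  have cf: "continuous_on (cball 0 1) f"
    using f R by (intro holomorphic_on_imp_continuous_on holomorphic_on_subset[OF f]) auto
  have cF: "continuous_on UNIV (?F t)" if "0 \<le> t" "t \<le> 1" for t
    by (intro continuous_on_norm continuous_on_compose2[OF cf] continuous_intros)
      (use that in \<open>auto simp: norm_mult\<close>)
  have mF: "?F t \<in> borel_measurable borel" if "t \<in> T" for t
    using T that by (intro borel_measurable_continuous_onI cF) auto
  obtain r where r[measurable]: "r \<in> borel_measurable borel"
    and r': "\<And>x. r x \<in> T \<and> (\<forall>t\<in>T. ?F t x \<le> ?F (r x) x)"
    using measurable_argmax[OF T(1,2), of ?F] mF by auto
  define u where "u = (\<lambda>x. ennreal (norm (f (circ x)) powr (p / 2)))"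
  have u1: "continuous_on UNIV (\<lambda>x. norm (f (circ x)) powr (p / 2))"
    using p by (intro continuous_on_norm_powr continuous_on_compose2[OF cf] continuous_intros) auto
  then have u1m: "(\<lambda>x. norm (f (circ x)) powr (p / 2)) \<in> borel_measurable borel"
    by (intro borel_measurable_continuous_onI)
  then have u[measurable]: "u \<in> borel_measurable borel" unfolding u_def by measurable
  have rT: "0 \<le> r x \<and> r x \<le> Max T" "Max T < 1" "0 \<le> r x \<and> r x < 1" for x
    using r'[of x] T Max_ge[OF T(1), of "r x"] by auto
  have rx: "r x \<le> 1" for x using rT(3)[of x] by simp
  have sq: "ennreal (y powr p) = (ennreal (y powr (p / 2)))\<^sup>2" if "0 \<le> y" for y
    using that by (simp add: power2_eq_square powr_add[symmetric] ennreal_mult[symmetric])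
  have "(MAX t\<in>T. ennreal (?F t x powr p)) \<le> (poisson_op r u x)\<^sup>2" for x
  proof (rule Max.boundedI)
    fix a assume "a \<in> (\<lambda>t. ennreal (?F t x powr p)) ` T"
    then obtain t where t: "t \<in> T" "a = ennreal (?F t x powr p)" by auto
    have "?F t x powr (p / 2) \<le> ?F (r x) x powr (p / 2)"
      using r'[of x] t p by (intro powr_mono2) auto
    also have "\<dots> \<le> integral {0..1} (\<lambda>y. poisson (r x) (x - y) * norm (f (circ y)) powr (p / 2))"
      using norm_powr_le_poisson[OF f R, of "p / 2" "r x" x] p rT by auto
    finally have "ennreal (?F t x powr (p / 2)) \<le> ennreal \<dots>" by (rule ennreal_leI)
    also have "\<dots> = (\<integral>\<^sup>+y. ennreal (poisson (r x) (x - y) * norm (f (circ y)) powr (p / 2)) \<partial>circ_measure)"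
      by (rule nn_integral_circ_measure[symmetric])
        (use rT rx u1 u1m in \<open>auto intro!: continuous_intros mult_nonneg_nonneg poisson_nonneg 
          borel_measurable_times borel_measurable_poisson continuous_on_subset[OF u1]\<close>)
    also have "\<dots> = poisson_op r u x"
      unfolding poisson_op_def u_def using rT
      by (intro nn_integral_cong) (simp add: ennreal_mult poisson_nonneg abs_of_nonneg less_imp_le)
    finally show "a \<le> (poisson_op r u x)\<^sup>2" 
      unfolding t(2) sq[OF norm_ge_zero] by (intro power_mono) auto
  qed (use T in auto)
  then have "(\<integral>\<^sup>+x. (MAX t\<in>T. ennreal (?F t x powr p)) \<partial>circ_measure) \<le> (\<integral>\<^sup>+x. (poisson_op r u x)\<^sup>2 \<partial>circ_measure)"
    by (intro nn_integral_mono)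
  also have "\<dots> \<le> 257 * (\<integral>\<^sup>+x. (u x)\<^sup>2 \<partial>circ_measure)"
    by (rule poisson_op_bound[OF r u rT(1,2)])
  also have "(\<integral>\<^sup>+x. (u x)\<^sup>2 \<partial>circ_measure) = (\<integral>\<^sup>+x. ennreal (norm (f (circ x)) powr p) \<partial>circ_measure)"
    unfolding u_def by (simp add: sq)
  finally show ?thesis .
qed

section \<open>The radial maximal function on the sphere\<close>

lemma norm_vector_smult [simp]: "norm (c *s z) = norm c * norm (z :: complex^'n)"
  by (simp add: norm_vec_def norm_mult L2_set_right_distrib)

lemma scaleR_conv_smult: "r *\<^sub>R z = of_real r *s (z :: complex^'n)"
  by (simp add: vec_eq_iff scaleR_conv_of_real[where 'a=complex])

lemma continuous_on_smult [continuous_intros]: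
  fixes g :: "'a::topological_space \<Rightarrow> complex^'n"
  assumes "continuous_on A f" "continuous_on A g"
  shows "continuous_on A (\<lambda>x. f x *s g x)"
  unfolding vector_scalar_mult_def using assms by (intro continuous_intros)

lemma borel_measurable_circ_smult [measurable (raw)]:
  fixes g :: "'a \<Rightarrow> complex^'n"
  assumes [measurable]: "f \<in> borel_measurable M" "g \<in> borel_measurable M"
  shows "(\<lambda>x. circ (f x) *s g x) \<in> borel_measurable M"
proof -
  have "(\<lambda>(x, z). circ x *s z) \<in> (borel :: real measure) \<Otimes>\<^sub>M (borel :: (complex^'n) measure) \<rightarrow>\<^sub>M borel"
    unfolding borel_prod case_prod_beta
    by (intro borel_measurable_continuous_onI continuous_intros)
  then show ?thesis
    using measurable_compose[of "\<lambda>x. (f x, g x)" M "borel \<Otimes>\<^sub>M borel" "\<lambda>(x, z). circ x *s z" borel] by simp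
qed

lemma bounded_linear_smult_left: "bounded_linear (\<lambda>h. h *s (v :: complex^'n))"
proof (rule bounded_linear_intro)
  show "norm (x *s v) \<le> norm x * norm v" for x by simp
qed (auto simp: vec_eq_iff algebra_simps scaleR_conv_of_real[where 'a=complex])

lemma bounded_linear_smult_right: "bounded_linear (\<lambda>v. h *s (v :: complex^'n))"
proof (rule bounded_linear_intro)
  show "norm (h *s x) \<le> norm x * norm h" for x :: "complex^'n" by simp
qed (auto simp: vec_eq_iff algebra_simps scaleR_conv_of_real[where 'a=complex])

lemma orthogonal_transformation_rotation:
  "norm c = 1 \<Longrightarrow> orthogonal_transformation (\<lambda>z :: complex^'n. c *s z)"
  unfolding orthogonal_transformation
  using bounded_linear.linear[OF bounded_linear_smult_right] by auto

interpretation sphere_measure: finite_measure "sphere_measure :: 'a::euclidean_space measure"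
  by (rule finite_measure_sphere_measure)

lemma emeasure_space_sphere_measure [simp]: "emeasure (sphere_measure :: 'a::euclidean_space measure) (sphere 0 1) = 1"
  by (rule emeasure_sphere_measure_sphere)

lemma measurable_on_sphere:
  "h \<in> borel \<rightarrow>\<^sub>M N \<Longrightarrow> h \<in> measurable (sphere_measure :: 'a::euclidean_space measure) N"
  by (simp add: measurable_restrict_space1 cong: measurable_cong_sets[OF sets_sphere_measure refl])

lemma nn_integral_sphere_rotation:
  fixes h :: "complex^'n \<Rightarrow> ennreal" and T :: "complex^'n \<Rightarrow> complex^'n"
  assumes T: "orthogonal_transformation T" and h: "h \<in> borel_measurable borel"
  shows "(\<integral>\<^sup>+\<zeta>. h (T \<zeta>) \<partial>sphere_measure) = (\<integral>\<^sup>+\<zeta>. h \<zeta> \<partial>sphere_measure)"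
proof -
  have Tm: "T \<in> sphere_measure \<rightarrow>\<^sub>M sphere_measure"
    using T by (rule measurable_orthogonal_sphere)
  have "(\<integral>\<^sup>+\<zeta>. h \<zeta> \<partial>distr sphere_measure sphere_measure T) = (\<integral>\<^sup>+\<zeta>. h (T \<zeta>) \<partial>sphere_measure)"
    by (rule nn_integral_distr[OF Tm]) (use measurable_on_sphere[OF h] in simp)
  then show ?thesis by (simp add: distr_sphere_measure_orthogonal[OF T])
qed

text \<open>Rotation by \<open>circ x\<close> preserves the surface measure for each
  \<open>x\<close>; averaging over \<open>x\<close> and exchanging the integrals decomposes the
  sphere into circles, each of which lies in a complex line.\<close>

lemma nn_integral_sphere_circle_average:
  fixes h :: "complex^'n \<Rightarrow> ennreal"
  assumes h[measurable]: "h \<in> borel_measurable borel"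
  shows "(\<integral>\<^sup>+\<zeta>. h \<zeta> \<partial>sphere_measure) = (\<integral>\<^sup>+\<zeta>. (\<integral>\<^sup>+x. h (circ x *s \<zeta>) \<partial>circ_measure) \<partial>sphere_measure)"
proof -
  let ?\<sigma> = "sphere_measure :: (complex^'n) measure"
  interpret pair_sigma_finite circ_measure ?\<sigma> ..
  have [measurable]: "snd \<in> circ_measure \<Otimes>\<^sub>M ?\<sigma> \<rightarrow>\<^sub>M borel"
    by (rule measurable_compose[OF measurable_snd measurable_on_sphere]) simp
  have fm: "(\<lambda>(x, \<zeta>). h (circ x *s \<zeta>)) \<in> borel_measurable (circ_measure \<Otimes>\<^sub>M ?\<sigma>)"
    unfolding case_prod_beta by measurable
  have "(\<integral>\<^sup>+\<zeta>. h \<zeta> \<partial>?\<sigma>) = (\<integral>\<^sup>+x. (\<integral>\<^sup>+\<zeta>. h \<zeta> \<partial>?\<sigma>) \<partial>circ_measure)" by simp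
  also have "\<dots> = (\<integral>\<^sup>+x. (\<integral>\<^sup>+\<zeta>. h (circ x *s \<zeta>) \<partial>?\<sigma>) \<partial>circ_measure)"
    by (intro nn_integral_cong nn_integral_sphere_rotation[symmetric] orthogonal_transformation_rotation) auto
  also have "\<dots> = (\<integral>\<^sup>+\<zeta>. (\<integral>\<^sup>+x. h (circ x *s \<zeta>) \<partial>circ_measure) \<partial>?\<sigma>)"
    by (rule Fubini'[OF fm, symmetric])
  finally show ?thesis .
qed

text \<open>Dyadic radii form a finite set at each level, as the theorem on circles demands, and
  increase under refinement, as monotone convergence demands. The p-th power is built in.\<close>

definition dyadic_max :: "real \<Rightarrow> (complex^'n \<Rightarrow> complex) \<Rightarrow> nat \<Rightarrow> complex^'n \<Rightarrow> ennreal" where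
  "dyadic_max p F i \<zeta> = (MAX t\<in>(\<lambda>k. real k / 2 ^ i) ` {..<2 ^ i}. ennreal (norm (F (t *\<^sub>R \<zeta>)) powr p))"

definition radial_max :: "real \<Rightarrow> (complex^'n \<Rightarrow> complex) \<Rightarrow> complex^'n \<Rightarrow> ennreal" where
  "radial_max p F \<zeta> = (SUP i. dyadic_max p F i \<zeta>)"

lemma incseq_dyadic_max: "incseq (dyadic_max p F)"
proof (rule incseq_SucI, rule le_funI)
  fix i \<zeta>
  have "(\<lambda>k. real k / 2 ^ i) ` {..<2 ^ i} \<subseteq> (\<lambda>k. real k / 2 ^ Suc i) ` {..<2 ^ Suc i}"
  proof
    fix t assume "t \<in> (\<lambda>k. real k / 2 ^ i) ` {..<2 ^ i}"
    then obtain k where "k < 2 ^ i" "t = real k / 2 ^ i" by auto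
    then show "t \<in> (\<lambda>k. real k / 2 ^ Suc i) ` {..<2 ^ Suc i}"
      by (intro image_eqI[of _ _ "2 * k"]) auto
  qed
  then show "dyadic_max p F i \<zeta> \<le> dyadic_max p F (Suc i) \<zeta>"
    unfolding dyadic_max_def by (intro Max_mono image_mono) (auto simp: lessThan_empty_iff)
qed

text \<open>Dyadic truncations of \<open>t\<close> from below converge to \<open>t\<close>, so
  continuity extends the bound from dyadic radii to all radii.\<close>

lemma norm_powr_le_radial_max:
  fixes F :: "complex^'n \<Rightarrow> complex"
  assumes cF: "continuous_on (cball 0 1) F" and p: "0 < p" and t: "0 \<le> t" "t < 1" and \<zeta>: "norm \<zeta> \<le> 1"
  shows "ennreal (norm (F (t *\<^sub>R \<zeta>)) powr p) \<le> radial_max p F \<zeta>"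
proof (rule LIMSEQ_le_const2)
  define s where "s = (\<lambda>i. real (nat \<lfloor>t * 2 ^ i\<rfloor>) / 2 ^ i)"
  have s1: "s i \<le> t" "t - 1 / 2 ^ i \<le> s i" "0 \<le> s i" for i
  proof -
    have "real (nat \<lfloor>t * 2 ^ i\<rfloor>) = of_int \<lfloor>t * 2 ^ i\<rfloor>" using t by simp
    then have "real (nat \<lfloor>t * 2 ^ i\<rfloor>) \<le> t * 2 ^ i" "t * 2 ^ i - 1 \<le> real (nat \<lfloor>t * 2 ^ i\<rfloor>)" by linarith+
    then have "real (nat \<lfloor>t * 2 ^ i\<rfloor>) / 2 ^ i \<le> t * 2 ^ i / 2 ^ i" "(t * 2 ^ i - 1) / 2 ^ i \<le> real (nat \<lfloor>t * 2 ^ i\<rfloor>) / 2 ^ i"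
      by (intro divide_right_mono; simp)+
    then show "s i \<le> t" "t - 1 / 2 ^ i \<le> s i" "0 \<le> s i" by (auto simp: s_def diff_divide_distrib)
  qed
  have "s \<longlonglongrightarrow> t"
  proof (rule tendsto_sandwich)
    show "(\<lambda>i. t - 1 / 2 ^ i) \<longlonglongrightarrow> t"
      using tendsto_diff[OF tendsto_const[of t] LIMSEQ_divide_realpow_zero[of 2 1]] by simp
  qed (use s1 in auto)
  have "(\<lambda>i. F (s i *\<^sub>R \<zeta>)) \<longlonglongrightarrow> F (t *\<^sub>R \<zeta>)"
  proof (rule continuous_on_tendsto_compose[OF cF])
    show "(\<lambda>i. s i *\<^sub>R \<zeta>) \<longlonglongrightarrow> t *\<^sub>R \<zeta>" by (intro tendsto_intros) fact
    have "norm (u *\<^sub>R \<zeta>) \<le> 1" if "0 \<le> u" "u \<le> t" for u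
      using mult_mono[of u 1 "norm \<zeta>" 1] that t \<zeta> by auto
    then show "t *\<^sub>R \<zeta> \<in> cball 0 1" "\<forall>\<^sub>F i in sequentially. s i *\<^sub>R \<zeta> \<in> cball 0 1" 
      using s1 t by auto
  qed
  then show "(\<lambda>i. ennreal (norm (F (s i *\<^sub>R \<zeta>)) powr p)) \<longlonglongrightarrow> ennreal (norm (F (t *\<^sub>R \<zeta>)) powr p)"
    using p by (intro tendsto_ennrealI tendsto_powr' tendsto_norm) auto
  have "ennreal (norm (F (s i *\<^sub>R \<zeta>)) powr p) \<le> radial_max p F \<zeta>" for i
  proof -
    have "nat \<lfloor>t * 2 ^ i\<rfloor> < 2 ^ i"
    proof -
      have "\<lfloor>t * 2 ^ i\<rfloor> < 2 ^ i" using t by (simp add: floor_less_iff)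
      moreover have "0 \<le> \<lfloor>t * 2 ^ i\<rfloor>" using t by simp
      ultimately show ?thesis by (simp add: nat_less_iff)
    qed
    then have "ennreal (norm (F (s i *\<^sub>R \<zeta>)) powr p) \<le> dyadic_max p F i \<zeta>"
      unfolding dyadic_max_def by (intro Max_ge) (auto simp: s_def)
    also have "\<dots> \<le> radial_max p F \<zeta>" unfolding radial_max_def by (intro SUP_upper) auto
    finally show ?thesis .
  qed
  then show "\<exists>N. \<forall>i\<ge>N. ennreal (norm (F (s i *\<^sub>R \<zeta>)) powr p) \<le> radial_max p F \<zeta>" by blast
qed

text \<open>Made for the dilates of a Hardy function, which are continuous on the closed ball and
  whose slices are holomorphic beyond the unit disc. The constant is independent of
  \<open>R\<close>, hence of the dilation.\<close>

lemma nn_integral_radial_max: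
  fixes F :: "complex^'n \<Rightarrow> complex"
  assumes cF: "continuous_on (cball 0 1) F" and p: "0 < p" and R: "1 < R"
    and slice: "\<And>\<zeta>. norm \<zeta> = 1 \<Longrightarrow> (\<lambda>w. F (w *s \<zeta>)) holomorphic_on ball 0 R"
  shows "(\<integral>\<^sup>+\<zeta>. radial_max p F \<zeta> \<partial>sphere_measure) \<le> 257 * (\<integral>\<^sup>+\<zeta>. ennreal (norm (F \<zeta>) powr p) \<partial>sphere_measure)"
    and "radial_max p F \<in> borel_measurable sphere_measure"
proof -
  let ?\<sigma> = "sphere_measure :: (complex^'n) measure"
  \<comment> \<open>\<open>F\<close> is controlled on the closed ball only; its cut-off is Borel on
    the whole space, which the rotation and averaging lemmas require, and does not differ on the
    radii involved.\<close>
  define G where "G = (\<lambda>z. indicator (cball 0 1) z *\<^sub>R F z)"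
  have G[measurable]: "G \<in> borel_measurable borel"
    unfolding G_def by (intro borel_measurable_continuous_on_indicator cF) auto
  have GF: "G z = F z" if "norm z \<le> 1" for z using that by (simp add: G_def)
  have fin: "finite ((\<lambda>k. real k / 2 ^ i) ` {..<2 ^ i})" "(\<lambda>k. real k / 2 ^ i) ` {..<2 ^ i} \<noteq> {}" for i :: nat
    by (auto simp: lessThan_empty_iff)
  have dG: "dyadic_max p G i \<zeta> = dyadic_max p F i \<zeta>" if "norm \<zeta> = 1" for i \<zeta>
    unfolding dyadic_max_def image_image using that by (intro arg_cong[where f=Max] image_cong) (auto simp: GF)
  have dGm[measurable]: "dyadic_max p G i \<in> borel_measurable borel" for i
    unfolding dyadic_max_def by (intro borel_measurable_Max fin) measurable
  have m1: "dyadic_max p F i \<in> borel_measurable ?\<sigma>" for i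
  proof -
    have "dyadic_max p F i \<in> borel_measurable ?\<sigma> \<longleftrightarrow> dyadic_max p G i \<in> borel_measurable ?\<sigma>"
      by (rule measurable_cong) (simp add: dG)
    then show ?thesis using measurable_on_sphere[OF dGm] by blast
  qed
  then show "radial_max p F \<in> borel_measurable ?\<sigma>" 
    unfolding radial_max_def[abs_def] by (intro borel_measurable_SUP) auto
  have "(\<integral>\<^sup>+\<zeta>. dyadic_max p F i \<zeta> \<partial>?\<sigma>) \<le> 257 * (\<integral>\<^sup>+\<zeta>. ennreal (norm (F \<zeta>) powr p) \<partial>?\<sigma>)" for i
  proof -
    have "(\<integral>\<^sup>+\<zeta>. dyadic_max p F i \<zeta> \<partial>?\<sigma>) = (\<integral>\<^sup>+\<zeta>. dyadic_max p G i \<zeta> \<partial>?\<sigma>)"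
      by (intro nn_integral_cong) (simp add: dG)
    also have "\<dots> = (\<integral>\<^sup>+\<zeta>. (\<integral>\<^sup>+x. dyadic_max p G i (circ x *s \<zeta>) \<partial>circ_measure) \<partial>?\<sigma>)"
      by (rule nn_integral_sphere_circle_average) measurable
    also have "\<dots> \<le> (\<integral>\<^sup>+\<zeta>. 257 * (\<integral>\<^sup>+x. ennreal (norm (G (circ x *s \<zeta>)) powr p) \<partial>circ_measure) \<partial>?\<sigma>)"
    proof (intro nn_integral_mono)
      fix \<zeta> :: "complex^'n" assume "\<zeta> \<in> space ?\<sigma>"
      then have \<zeta>: "norm \<zeta> = 1" by simp
      have "(\<integral>\<^sup>+x. dyadic_max p G i (circ x *s \<zeta>) \<partial>circ_measure) =
        (\<integral>\<^sup>+x. (MAX t\<in>(\<lambda>k. real k / 2 ^ i) ` {..<2 ^ i}. ennreal (norm (F ((of_real t * circ x) *s \<zeta>)) powr p)) \<partial>circ_measure)"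
        by (intro nn_integral_cong) 
          (simp add: dG \<zeta>, simp add: dyadic_max_def scaleR_conv_smult vector_smult_assoc)
      also have "\<dots> \<le> 257 * (\<integral>\<^sup>+x. ennreal (norm (F (circ x *s \<zeta>)) powr p) \<partial>circ_measure)"
        by (rule radial_maximal_circle[OF slice[OF \<zeta>] R p fin]) auto
      also have "(\<integral>\<^sup>+x. ennreal (norm (F (circ x *s \<zeta>)) powr p) \<partial>circ_measure) = (\<integral>\<^sup>+x. ennreal (norm (G (circ x *s \<zeta>)) powr p) \<partial>circ_measure)"
        by (intro nn_integral_cong) (simp add: GF \<zeta>)
      finally show "(\<integral>\<^sup>+x. dyadic_max p G i (circ x *s \<zeta>) \<partial>circ_measure)
        \<le> 257 * (\<integral>\<^sup>+x. ennreal (norm (G (circ x *s \<zeta>)) powr p) \<partial>circ_measure)" .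
    qed
    also have "\<dots> = 257 * (\<integral>\<^sup>+\<zeta>. (\<integral>\<^sup>+x. ennreal (norm (G (circ x *s \<zeta>)) powr p) \<partial>circ_measure) \<partial>?\<sigma>)"
    proof (rule nn_integral_cmult)
      have "(\<lambda>z. \<integral>\<^sup>+x. ennreal (norm (G (circ x *s z)) powr p) \<partial>circ_measure) \<in> borel_measurable borel"
        by measurable
      then show "(\<lambda>z. \<integral>\<^sup>+x. ennreal (norm (G (circ x *s z)) powr p) \<partial>circ_measure) \<in> borel_measurable ?\<sigma>"
        by (rule measurable_on_sphere)
    qed
    also have "(\<integral>\<^sup>+\<zeta>. (\<integral>\<^sup>+x. ennreal (norm (G (circ x *s \<zeta>)) powr p) \<partial>circ_measure) \<partial>?\<sigma>) = (\<integral>\<^sup>+\<zeta>. ennreal (norm (G \<zeta>) powr p) \<partial>?\<sigma>)"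
      by (rule nn_integral_sphere_circle_average[symmetric]) measurable
    also have "\<dots> = (\<integral>\<^sup>+\<zeta>. ennreal (norm (F \<zeta>) powr p) \<partial>?\<sigma>)"
      by (intro nn_integral_cong) (simp add: GF)
    finally show ?thesis .
  qed
  then have "(SUP i. \<integral>\<^sup>+\<zeta>. dyadic_max p F i \<zeta> \<partial>?\<sigma>) \<le> 257 * (\<integral>\<^sup>+\<zeta>. ennreal (norm (F \<zeta>) powr p) \<partial>?\<sigma>)"
    by (intro SUP_least)
  also have "(SUP i. \<integral>\<^sup>+\<zeta>. dyadic_max p F i \<zeta> \<partial>?\<sigma>) = (\<integral>\<^sup>+\<zeta>. radial_max p F \<zeta> \<partial>?\<sigma>)"
    unfolding radial_max_def by (rule nn_integral_monotone_convergence_SUP[symmetric, OF incseq_dyadic_max m1])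
  finally show "(\<integral>\<^sup>+\<zeta>. radial_max p F \<zeta> \<partial>?\<sigma>) \<le> 257 * (\<integral>\<^sup>+\<zeta>. ennreal (norm (F \<zeta>) powr p) \<partial>?\<sigma>)" .
qed

section \<open>Holomorphic functions of several variables\<close>

definition holo_on :: "(complex^'n) set \<Rightarrow> (complex^'n \<Rightarrow> complex) \<Rightarrow> bool" where
  "holo_on S f \<longleftrightarrow> (\<forall>z\<in>S. \<exists>D. (f has_derivative D) (at z) \<and> (\<forall>c v. D (c *s v) = c * D v))"

lemma holo_ball_iff: "f \<in> holo_ball \<longleftrightarrow> holo_on (ball 0 1) f"
  by (simp add: holo_ball_def holo_on_def)

lemma holo_on_imp_continuous_on: "holo_on S f \<Longrightarrow> continuous_on S f"
  unfolding holo_on_def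
  by (intro continuous_at_imp_continuous_on) (blast intro: has_derivative_continuous)

lemma holo_on_cong:
  assumes "open S" "\<And>z. z \<in> S \<Longrightarrow> f z = g z" "holo_on S f"
  shows "holo_on S g"
  unfolding holo_on_def
proof
  fix z assume z: "z \<in> S"
  then obtain D where "(f has_derivative D) (at z)" "\<forall>c v. D (c *s v) = c * D v"
    using assms(3) by (auto simp: holo_on_def)
  then show "\<exists>D. (g has_derivative D) (at z) \<and> (\<forall>c v. D (c *s v) = c * D v)"
    using has_derivative_transform_within_open[of f D z UNIV S g] assms(1,2) z by auto
qed

lemma slice_has_field_derivative:
  fixes f D :: "complex^'n \<Rightarrow> complex"
  assumes D: "(f has_derivative D) (at (z + w *s v))" "\<And>c v. D (c *s v) = c * D v"
  shows "((\<lambda>w. f (z + w *s v)) has_field_derivative D v) (at w)"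
proof -
  have "((\<lambda>w. z + w *s v) has_derivative (\<lambda>h. h *s v)) (at w)"
    using has_derivative_add[OF has_derivative_const[of z] bounded_linear.has_derivative[OF bounded_linear_smult_left[of v] has_derivative_ident[of "at w"]]]
    by simp
  from has_derivative_compose[OF this D(1)]
  show ?thesis unfolding has_field_derivative_def using D(2)
    by (auto elim!: has_derivative_eq_rhs simp: fun_eq_iff mult.commute)
qed

lemma slice_holomorphic:
  assumes "holo_on S f" "\<And>w. w \<in> A \<Longrightarrow> z + w *s v \<in> S"
  shows "(\<lambda>w. f (z + w *s v)) holomorphic_on A"
  unfolding holomorphic_on_def field_differentiable_def
proof
  fix w assume "w \<in> A"
  then obtain D where "(f has_derivative D) (at (z + w *s v))" "\<forall>c v. D (c *s v) = c * D v"
    using assms unfolding holo_on_def by blast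
  then show "\<exists>f'. ((\<lambda>w. f (z + w *s v)) has_field_derivative f') (at w within A)"
    using slice_has_field_derivative[of f D z w v] has_field_derivative_at_within by blast
qed

lemma slice_holomorphic_0:
  assumes "holo_on S f" "\<And>w. w \<in> A \<Longrightarrow> w *s v \<in> S"
  shows "(\<lambda>w. f (w *s v)) holomorphic_on A"
  using slice_holomorphic[of S f A 0 v] assms by simp

text \<open>Complex linearity of \<open>D\<close> recombines the partial derivatives into one
  directional derivative, so the radial derivative can be computed on the complex line through
  \<open>z\<close>.\<close>

lemma radial_deriv_eq:
  fixes f :: "complex^'n \<Rightarrow> complex"
  assumes D: "(f has_derivative D) (at z)" "\<And>c v. D (c *s v) = c * D v"
  shows "radial_deriv f z = D z"
proof -
  have pd: "partial_deriv k f z = D (axis k 1)" for k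
  proof -
    have eq: "(\<chi> i. if i = k then w else z $ i) = (z - z $ k *s axis k 1) + w *s axis k 1" for w
      by (simp add: vec_eq_iff axis_def)
    have "(f has_derivative D) (at ((z - z $ k *s axis k 1) + z $ k *s axis k 1))" using D by simp
    from slice_has_field_derivative[OF this D(2)] show ?thesis
      unfolding partial_deriv_def eq by (rule DERIV_imp_deriv)
  qed
  have lin: "linear D" using has_derivative_linear[OF D(1)] .
  have z: "z = (\<Sum>k\<in>UNIV. z $ k *s axis k 1)"
    by (simp add: vec_eq_iff axis_def if_distrib cong: if_cong)
  have "D z = D (\<Sum>k\<in>UNIV. z $ k *s axis k 1)" using z by simp
  also have "\<dots> = (\<Sum>k\<in>UNIV. z $ k * D (axis k 1))"
    by (simp add: linear_sum[OF lin] D(2))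
  finally show ?thesis by (simp add: radial_deriv_def pd)
qed

lemma radial_deriv_slice:
  assumes f: "holo_on S f" and w: "w *s z \<in> S"
  shows "radial_deriv f (w *s z) = w * deriv (\<lambda>w. f (w *s z)) w"
proof -
  obtain D where D: "(f has_derivative D) (at (w *s z))" "\<And>c v. D (c *s v) = c * D v"
    using f w by (auto simp: holo_on_def)
  have "deriv (\<lambda>w. f (w *s z)) w = D z"
    using slice_has_field_derivative[of f D 0 w z] D by (intro DERIV_imp_deriv) simp
  then show ?thesis using radial_deriv_eq[OF D] D(2) by simp
qed

section \<open>Holomorphy of integrals depending on a parameter\<close>

text \<open>Cauchy's inequality on discs of radius 1/2 around points of the unit disc bounds the
  second derivative by \<open>2 * M * 4\<close>. The Taylor remainder used here divides by
  \<open>fact 1\<close>, so this bound enters without a further factor 1/2.\<close>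

lemma taylor_quadratic_bound:
  assumes h: "h holomorphic_on ball 0 2" and M: "\<And>w. norm w < 2 \<Longrightarrow> norm (h w) \<le> M" and w: "norm w \<le> 1"
  shows "norm (h w - h 0 - deriv h 0 * w) \<le> 8 * M * (norm w)\<^sup>2"
proof -
  have d: "(deriv ^^ i) h holomorphic_on ball 0 2" for i
    using h by (intro holomorphic_higher_deriv) auto
  have "norm ((\<lambda>i. (deriv ^^ i) h) 0 w - (\<Sum>i\<le>1. (deriv ^^ i) h 0 * (w - 0) ^ i / (fact i))) \<le> (8 * M) * norm (w - 0) ^ Suc 1 / fact 1"
  proof (rule complex_Taylor[where S = "cball 0 1"])
    fix i x assume "x \<in> cball (0::complex) 1"
    then have "x \<in> ball 0 2" by simp
    from holomorphic_derivI[OF d _ this, of i UNIV]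
    show "((deriv ^^ i) h has_field_derivative (deriv ^^ Suc i) h x) (at x within cball 0 1)"
      by (auto intro: has_field_derivative_at_within)
  next
    fix x assume x: "x \<in> cball (0::complex) 1"
    have sub: "cball x (1/2) \<subseteq> ball 0 2"
    proof
      fix y assume "y \<in> cball x (1/2)"
      then have "norm y \<le> norm x + 1/2" using norm_triangle_sub[of y x] by (simp add: dist_norm norm_minus_commute)
      then show "y \<in> ball 0 2" using x by simp
    qed
    have "norm ((deriv ^^ 2) h x) \<le> fact 2 * M / (1/2) ^ 2"
    proof (rule Cauchy_inequality)
      show "h holomorphic_on ball x (1/2)" using h sub ball_subset_cball by (meson holomorphic_on_subset order_trans)
      show "continuous_on (cball x (1/2)) h" using h sub by (meson holomorphic_on_imp_continuous_on holomorphic_on_subset)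
      show "norm (h y) \<le> M" if "norm (x - y) = 1/2" for y
        using that sub by (intro M) (auto simp: dist_norm subset_eq)
    qed simp
    then show "norm ((deriv ^^ Suc 1) h x) \<le> 8 * M" by (simp add: numeral_2_eq_2)
  qed (use w in auto)
  then show ?thesis by (simp add: power2_eq_square diff_diff_eq)
qed

text \<open>Only joint continuity of \<open>H\<close> is assumed, nothing about its derivative.
  Cauchy estimates on complex lines make the quadratic remainder uniform in \<open>t\<close>, and
  this gives both continuity of the derivative in \<open>t\<close> and differentiability of the
  integral.\<close>

lemma holo_on_integral:
  fixes H :: "complex^'n \<Rightarrow> real \<Rightarrow> complex"
  assumes S: "open S" and cont: "continuous_on (S \<times> {a..b}) (\<lambda>(z, t). H z t)"
    and holo: "\<And>t. t \<in> {a..b} \<Longrightarrow> holo_on S (\<lambda>z. H z t)" and ab: "a \<le> b"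
  shows "holo_on S (\<lambda>z. integral {a..b} (H z))"
  unfolding holo_on_def
proof
  fix z0 assume z0: "z0 \<in> S"
  obtain e where e: "0 < e" "cball z0 e \<subseteq> S" using S z0 open_contains_cball by blast
  define \<rho> where "\<rho> = e / 2"
  have \<rho>: "0 < \<rho>" "2 * \<rho> = e" using e by (auto simp: \<rho>_def)
  have "compact (cball z0 e \<times> {a..b})" by (intro compact_Times) auto
  moreover have "continuous_on (cball z0 e \<times> {a..b}) (\<lambda>(z, t). H z t)"
    by (rule continuous_on_subset[OF cont]) (use e in auto)
  ultimately have "bounded ((\<lambda>(z, t). H z t) ` (cball z0 e \<times> {a..b}))"
    by (intro compact_imp_bounded compact_continuous_image)
  then obtain M where M: "\<And>z t. z \<in> cball z0 e \<Longrightarrow> t \<in> {a..b} \<Longrightarrow> norm (H z t) \<le> M"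
    unfolding bounded_iff by (metis (no_types, lifting) SigmaI case_prod_conv image_eqI)
  have M0: "0 \<le> M" using order_trans[OF norm_ge_zero M[of z0 a]] e ab by simp
  have cH: "continuous_on {a..b} (H z)" if "z \<in> S" for z
  proof -
    have "continuous_on {a..b} (\<lambda>t. (\<lambda>(z, t). H z t) (z, t))"
      by (rule continuous_on_compose2[OF cont]) (use that in \<open>auto intro!: continuous_intros\<close>)
    then show ?thesis by simp
  qed
  have "\<exists>D. \<forall>t\<in>{a..b}. ((\<lambda>z. H z t) has_derivative D t) (at z0) \<and> (\<forall>c v. D t (c *s v) = c * D t v)"
    using holo z0 unfolding holo_on_def by (intro bchoice) blast
  then obtain D where D: "\<And>t. t \<in> {a..b} \<Longrightarrow> ((\<lambda>z. H z t) has_derivative D t) (at z0)"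
    "\<And>t c v. t \<in> {a..b} \<Longrightarrow> D t (c *s v) = c * D t v" by blast
  have lin: "linear (D t)" if "t \<in> {a..b}" for t using has_derivative_linear[OF D(1)[OF that]] .
  define K where "K = 8 * M / \<rho>\<^sup>2"
  have K0: "0 \<le> K" using M0 by (simp add: K_def)
  have rem: "norm (H (z0 + v) t - H z0 t - D t v) \<le> K * (norm v)\<^sup>2"
    if t: "t \<in> {a..b}" and v: "norm v \<le> \<rho>" for t v
  proof (cases "v = 0")
    case True
    then show ?thesis using linear_0[OF lin[OF t]] by simp
  next
    case False
    \<comment> \<open>The increment is rescaled to length \<open>\<rho>\<close>, half the radius of
      the compact ball, so that the disc of radius 2 on the line through \<open>z0\<close> stays
      where \<open>H\<close> is bounded by \<open>M\<close>.\<close>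
    define u where "u = of_real (\<rho> / norm v) *s v"
    define w where "w = complex_of_real (norm v / \<rho>)"
    have nu: "norm u = \<rho>" using False \<rho> by (simp add: u_def norm_divide)
    have wu: "w *s u = v" using False \<rho> 
      by (simp add: u_def w_def vector_smult_assoc of_real_mult[symmetric] del: of_real_mult of_real_divide)
    have nw: "norm w = norm v / \<rho>" "norm w \<le> 1" using \<rho> v by (auto simp: w_def norm_divide)
    have inS: "z0 + c *s u \<in> cball z0 e" if "norm c < 2" for c
      using mult_right_mono[of "norm c" 2 \<rho>] that \<rho> by (simp add: dist_norm nu)
    have "norm (H (z0 + w *s u) t - H (z0 + 0 *s u) t - deriv (\<lambda>w. H (z0 + w *s u) t) 0 * w) \<le> 8 * M * (norm w)\<^sup>2"
    proof (rule taylor_quadratic_bound)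
      show "(\<lambda>w. H (z0 + w *s u) t) holomorphic_on ball 0 2"
        using holo[OF t] by (rule slice_holomorphic[of S "\<lambda>z. H z t"]) (use inS e in auto)
    qed (use inS M t nw in auto)
    moreover have "deriv (\<lambda>w. H (z0 + w *s u) t) 0 = D t u"
      using slice_has_field_derivative[of "\<lambda>z. H z t" "D t" z0 0 u] D t by (intro DERIV_imp_deriv) auto
    moreover have "D t v = D t u * w" using D(2)[OF t, of w u] wu by simp
    ultimately show ?thesis using nw \<rho> by (simp add: wu K_def power_divide)
  qed
  have cD: "continuous_on {a..b} (\<lambda>t. D t v)" for v
  proof -
    \<comment> \<open>The derivative in direction \<open>v\<close> is the limit of difference
      quotients with step \<open>1 / Suc k\<close>; the remainder bound makes the error at most
      \<open>K * |v|^2 / Suc k\<close> for all \<open>t\<close> at once.\<close>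
    have U: "uniform_limit {a..b} (\<lambda>k t. of_nat (Suc k) * (H (z0 + (1 / of_nat (Suc k)) *s v) t - H z0 t)) (\<lambda>t. D t v) sequentially"
    proof (rule uniform_limitI)
      fix \<epsilon> :: real assume \<epsilon>: "0 < \<epsilon>"
      obtain k1 where k1: "norm v / \<rho> < of_nat k1" using reals_Archimedean2 by blast
      obtain k2 where k2: "K * (norm v)\<^sup>2 / \<epsilon> < of_nat k2" using reals_Archimedean2 by blast
      show "\<forall>\<^sub>F k in sequentially. \<forall>t\<in>{a..b}. dist (of_nat (Suc k) * (H (z0 + (1 / of_nat (Suc k)) *s v) t - H z0 t)) (D t v) < \<epsilon>"
        unfolding eventually_sequentially
      proof (intro exI[of _ "max k1 k2"] allI impI ballI)
        fix k t assume k: "max k1 k2 \<le> k" and t: "t \<in> {a..b}"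
        define n where "n = real (Suc k)"
        have n: "0 < n" "norm v / \<rho> < n" "K * (norm v)\<^sup>2 / \<epsilon> < n" using k k1 k2 by (auto simp: n_def)
        have cn: "complex_of_real n = of_nat (Suc k)" by (simp add: n_def)
        let ?v = "(1 / of_nat (Suc k)) *s v"
        have nv: "norm ?v = norm v / n" unfolding cn[symmetric] using n by (simp add: norm_divide)
        have "norm ?v \<le> \<rho>" unfolding nv using n \<rho> by (simp add: field_simps)
        from rem[OF t this] have *: "norm (H (z0 + ?v) t - H z0 t - D t ?v) \<le> K * (norm v / n)\<^sup>2" by (simp only: nv)
        have "of_nat (Suc k) * (H (z0 + ?v) t - H z0 t) - D t v = of_nat (Suc k) * (H (z0 + ?v) t - H z0 t - D t ?v)"
          unfolding cn[symmetric] using D(2)[OF t, of "1 / complex_of_real n" v] n by (simp add: algebra_simps)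
        then have "dist (of_nat (Suc k) * (H (z0 + ?v) t - H z0 t)) (D t v) = n * norm (H (z0 + ?v) t - H z0 t - D t ?v)"
          unfolding dist_norm using n by (simp add: norm_mult cn[symmetric] del: of_nat_Suc)
        also have "\<dots> \<le> n * (K * (norm v / n)\<^sup>2)" using * n by (intro mult_left_mono) auto
        also have "\<dots> = K * (norm v)\<^sup>2 / n" using n by (simp add: power2_eq_square)
        also have "\<dots> < \<epsilon>" using n \<epsilon> by (simp add: field_simps)
        finally show "dist (of_nat (Suc k) * (H (z0 + ?v) t - H z0 t)) (D t v) < \<epsilon>" .
      qed
    qed
    have CC: "\<forall>\<^sub>F k in sequentially. continuous_on {a..b} (\<lambda>t. of_nat (Suc k) * (H (z0 + (1 / of_nat (Suc k)) *s v) t - H z0 t))"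
    proof -
      obtain k1 where k1: "norm v / e < of_nat k1" using reals_Archimedean2 by blast
      show ?thesis unfolding eventually_sequentially
      proof (intro exI[of _ k1] allI impI)
        fix k assume "k1 \<le> k"
        then have "norm v / e < real (Suc k)" using k1 by simp
        then have "norm v < real (Suc k) * e" using e by (simp add: pos_divide_less_eq)
        then have "norm v / real (Suc k) < e" by (simp add: pos_divide_less_eq mult.commute)
        moreover have "norm ((1 / of_nat (Suc k) :: complex) *s v) = norm v / real (Suc k)"
          by (simp only: norm_vector_smult norm_divide norm_one norm_of_nat) simp
        ultimately have "z0 + (1 / of_nat (Suc k)) *s v \<in> cball z0 e" by (simp only: mem_cball dist_norm) (simp del: of_nat_Suc norm_vector_smult)
        then show "continuous_on {a..b} (\<lambda>t. of_nat (Suc k) * (H (z0 + (1 / of_nat (Suc k)) *s v) t - H z0 t))"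
          using e z0 by (intro continuous_intros cH) auto
      qed
    qed
    show ?thesis using uniform_limit_theorem[OF CC U] by simp
  qed
  have iD: "(\<lambda>t. D t v) integrable_on {a..b}" for v using cD by (rule integrable_continuous_real)
  have iH: "H z integrable_on {a..b}" if "z \<in> S" for z using cH[OF that] by (rule integrable_continuous_real)
  define E where "E = (\<lambda>v. integral {a..b} (\<lambda>t. D t v))"
  have homE: "E (c *s v) = c * E v" for c v
  proof -
    have "E (c *s v) = integral {a..b} (\<lambda>t. c * D t v)"
      unfolding E_def by (rule integral_cong) (simp add: D)
    then show ?thesis by (simp add: E_def)
  qed
  have linE: "linear E"
  proof (rule linearI)
    fix v w :: "complex^'n"
    have "E (v + w) = integral {a..b} (\<lambda>t. D t v + D t w)"
      unfolding E_def by (rule integral_cong) (simp add: linear_add[OF lin])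
    then show "E (v + w) = E v + E w" by (simp add: E_def integral_add iD)
    show "E (r *\<^sub>R v) = r *\<^sub>R E v" for r
      by (simp add: scaleR_conv_smult homE scaleR_conv_of_real)
  qed
  have "((\<lambda>z. integral {a..b} (H z)) has_derivative E) (at z0)"
    unfolding has_derivative_at_alt
  proof (intro conjI allI impI)
    show "bounded_linear E" using linE by (simp add: linear_conv_bounded_linear)
    fix \<epsilon> :: real assume \<epsilon>: "0 < \<epsilon>"
    define L where "L = K * (b - a) + 1"
    have L: "0 < L" "K * (b - a) \<le> L" using K0 ab by (auto simp: L_def intro!: add_nonneg_pos)
    show "\<exists>d>0. \<forall>y. norm (y - z0) < d \<longrightarrow>
       norm (integral {a..b} (H y) - integral {a..b} (H z0) - E (y - z0)) \<le> \<epsilon> * norm (y - z0)"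
    proof (intro exI[of _ "min \<rho> (\<epsilon> / L)"] conjI allI impI)
      show "0 < min \<rho> (\<epsilon> / L)" using \<rho> \<epsilon> L by simp
      fix y assume "norm (y - z0) < min \<rho> (\<epsilon> / L)"
      then have y: "norm (y - z0) \<le> \<rho>" "norm (y - z0) * L \<le> \<epsilon>" using L by (auto simp: field_simps)
      have yS: "y \<in> S" using e y \<rho> by (auto simp: subset_eq dist_norm norm_minus_commute)
      have "integral {a..b} (H y) - integral {a..b} (H z0) - E (y - z0) = integral {a..b} (\<lambda>t. H y t - H z0 t - D t (y - z0))"
        unfolding E_def using iH[OF yS] iH[OF z0] iD by (simp add: integral_diff integrable_diff)
      also have "norm \<dots> \<le> integral {a..b} (\<lambda>t. K * (norm (y - z0))\<^sup>2)"
        by (rule integral_norm_bound_integral)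
          (use iH[OF yS] iH[OF z0] iD rem[of _ "y - z0"] y in \<open>auto intro!: integrable_diff\<close>)
      also have "\<dots> = (K * (b - a)) * (norm (y - z0) * norm (y - z0))" using ab by (simp add: power2_eq_square)
      also have "\<dots> \<le> L * (norm (y - z0) * norm (y - z0))" using L by (intro mult_right_mono) auto
      also have "\<dots> = (norm (y - z0) * L) * norm (y - z0)" by (simp add: mult_ac)
      also have "\<dots> \<le> \<epsilon> * norm (y - z0)" using y by (intro mult_right_mono) auto
      finally show "norm (integral {a..b} (H y) - integral {a..b} (H z0) - E (y - z0)) \<le> \<epsilon> * norm (y - z0)" .
    qed
  qed
  then show "\<exists>D. ((\<lambda>z. integral {a..b} (H z)) has_derivative D) (at z0) \<and> (\<forall>c v. D (c *s v) = c * D v)"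
    using homE by blast
qed

lemma holo_on_mult:
  assumes f: "holo_on S f" and g: "holo_on S g"
  shows "holo_on S (\<lambda>z. f z * g z)"
  unfolding holo_on_def
proof
  fix z assume z: "z \<in> S"
  obtain D where D: "(f has_derivative D) (at z)" "\<And>c v. D (c *s v) = c * D v"
    using f z unfolding holo_on_def by blast
  obtain E where E: "(g has_derivative E) (at z)" "\<And>c v. E (c *s v) = c * E v"
    using g z unfolding holo_on_def by blast
  show "\<exists>D. ((\<lambda>z. f z * g z) has_derivative D) (at z) \<and> (\<forall>c v. D (c *s v) = c * D v)"
    using has_derivative_mult[OF D(1) E(1)] D(2) E(2)
    by (intro exI conjI) (auto simp: algebra_simps)
qed

lemma holo_on_const: "holo_on S (\<lambda>z. c)"
  unfolding holo_on_def by (intro ballI exI[of _ "\<lambda>_. 0"]) auto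

lemma holo_on_dilation:
  assumes f: "holo_on S f" and sub: "\<And>z. z \<in> T \<Longrightarrow> c *s z \<in> S"
  shows "holo_on T (\<lambda>z. f (c *s z))"
  unfolding holo_on_def
proof
  fix z assume "z \<in> T"
  then obtain D where D: "(f has_derivative D) (at (c *s z))" "\<And>c v. D (c *s v) = c * D v"
    using f sub unfolding holo_on_def by blast
  have "((\<lambda>z. c *s z) has_derivative (\<lambda>v. c *s v)) (at z)"
    using bounded_linear_smult_right by (rule bounded_linear_imp_has_derivative)
  from has_derivative_compose[OF this D(1)]
  show "\<exists>D. ((\<lambda>z. f (c *s z)) has_derivative D) (at z) \<and> (\<forall>c v. D (c *s v) = c * D v)"
    by (intro exI conjI) (auto simp: D(2))
qed

section \<open>The Volterra integral and bounds for the radial derivative\<close>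

text \<open>Cauchy's formula trades the derivative for values of \<open>h\<close> on a circle; in
  this shape it depends holomorphically and continuously on parameters by the integral
  lemma.\<close>

lemma deriv_circle_mean:
  assumes h: "h holomorphic_on U" and U: "cball w r \<subseteq> U" and r: "0 < r"
  shows "integral {0..1} (\<lambda>x. h (w + of_real r * circ x) / (of_real r * circ x)) = deriv h w"
proof -
  have c: "continuous_on (cball w r) h" using h U by (meson holomorphic_on_imp_continuous_on holomorphic_on_subset)
  have h': "h holomorphic_on ball w r" using h U ball_subset_cball by (meson holomorphic_on_subset order_trans)
  have "((\<lambda>u. h u / (u - w) ^ Suc 1) has_contour_integral ((2 * pi * \<i>) / (fact 1) * (deriv ^^ 1) h w)) (circlepath w r)"
    by (rule Cauchy_has_contour_integral_higher_derivative_circlepath[OF c h']) (use r in auto)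
  then have I: "((\<lambda>x. h (circlepath w r x) / (circlepath w r x - w) ^ 2 * vector_derivative (circlepath w r) (at x within {0..1})) 
      has_integral (2 * pi * \<i>) * deriv h w) {0..1}"
    unfolding has_contour_integral_def by (simp add: numeral_2_eq_2)
  have cp: "circlepath w r x = w + of_real r * circ x" for x by (simp add: circlepath circ_def)
  have vd: "vector_derivative (circlepath w r) (at x within {0..1}) = 2 * of_real pi * \<i> * r * circ x"
    if "x \<in> {0..1}" for x using that by (simp add: vector_derivative_circlepath01 circ_def)
  have I2: "((\<lambda>x. (2 * pi * \<i>) * (h (w + of_real r * circ x) / (of_real r * circ x))) has_integral (2 * pi * \<i>) * deriv h w) {0..1}"
    by (rule has_integral_eq[OF _ I]) (use r in \<open>simp add: vd cp power2_eq_square\<close>)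
  have "((\<lambda>x. h (w + of_real r * circ x) / (of_real r * circ x)) has_integral deriv h w) {0..1}"
  proof -
    have "inverse (2 * pi * \<i>) * (2 * pi * \<i> * X) = X" for X by (simp add: field_simps)
    then show ?thesis
      using has_integral_mult_right[OF I2, of "inverse (2 * pi * \<i>)"] by (simp only:)
  qed
  then show ?thesis by (rule integral_unique)
qed

text \<open>Cauchy's formula for the derivative of \<open>w \<mapsto> g (w *s z)\<close> at
  \<open>w = t\<close>. For \<open>t > 0\<close> this is the radial derivative at \<open>t z\<close>
  divided by \<open>t\<close>, and unlike that quotient it is continuous at \<open>t = 0\<close>,
  where division by zero would give 0.\<close>

definition radial_quot :: "real \<Rightarrow> (complex^'n \<Rightarrow> complex) \<Rightarrow> complex^'n \<Rightarrow> real \<Rightarrow> complex" where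
  "radial_quot r g z t = integral {0..1} (\<lambda>x. g ((of_real t + of_real r * circ x) *s z) / (of_real r * circ x))"

text \<open>The radius \<open>1 - s\<close> is admissible because
  \<open>(1 + r) * s = 1 - (1 - s)^2 < 1\<close>: for \<open>|z| < s\<close> and
  \<open>t \<le> 1\<close> the whole circle is mapped into the unit ball.\<close>

lemma radial_quot_props:
  fixes g :: "complex^'n \<Rightarrow> complex"
  assumes g: "g \<in> holo_ball" and s: "0 < s" "s < 1"
  defines "r \<equiv> 1 - s"
  shows "\<And>t. t \<in> {0..1} \<Longrightarrow> holo_on (ball 0 s) (\<lambda>z. radial_quot r g z t)"
    and "continuous_on (ball 0 s \<times> {0..1}) (\<lambda>(z, t). radial_quot r g z t)"
    and "\<And>z t. z \<in> ball 0 s \<Longrightarrow> t \<in> {0<..1} \<Longrightarrow> radial_quot r g z t = radial_deriv g (of_real t *s z) / of_real t"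
proof -
  have g': "holo_on (ball 0 1) g" using g by (simp add: holo_ball_iff)
  have cg: "continuous_on (ball 0 1) g" using g' by (rule holo_on_imp_continuous_on)
  have r: "0 < r" "r < 1" using s by (auto simp: r_def)
  have rs: "(1 + r) * s < 1"
  proof -
    have "(1 + r) * s = 1 - (1 - s)\<^sup>2" by (simp add: r_def power2_eq_square algebra_simps)
    then show ?thesis using s by simp
  qed
  have inb: "norm (c *s z) < 1" if "norm c \<le> 1 + r" "norm z < s" for c and z :: "complex^'n"
    using mult_mono[of "norm c" "1 + r" "norm z" s] that r rs by simp
  have nc: "norm (of_real t + of_real r * circ x) \<le> 1 + r" if "t \<in> {0..1}" for t x
    using norm_triangle_ineq[of "of_real t" "of_real r * circ x"] that r by (simp add: norm_mult)
  have inb2: "norm ((of_real t + of_real r * circ x) *s z) < 1" if "t \<in> {0..1}" "norm z < s" for t x and z :: "complex^'n"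
    using inb[OF nc] that by blast
  show "holo_on (ball 0 s) (\<lambda>z. radial_quot r g z t)" if t: "t \<in> {0..1}" for t
    unfolding radial_quot_def
  proof (rule holo_on_integral)
    show "continuous_on (ball 0 s \<times> {0..1}) (\<lambda>(z, x). g ((of_real t + of_real r * circ x) *s z) / (of_real r * circ x))"
      unfolding case_prod_beta
      by (intro continuous_intros continuous_on_compose2[OF cg]) (use inb2[OF t] r in auto)
    fix x :: real assume x: "x \<in> {0..1}"
    show "holo_on (ball 0 s) (\<lambda>z. g ((of_real t + of_real r * circ x) *s z) / (of_real r * circ x))"
      unfolding divide_inverse
      by (intro holo_on_mult holo_on_const holo_on_dilation[OF g']) (use inb2[OF t] in auto)
  qed auto
  have "continuous_on (ball 0 s \<times> {0..1}) (\<lambda>y. integral (cbox 0 1) (\<lambda>x. g ((of_real (snd y) + of_real r * circ x) *s fst y) / (of_real r * circ x)))"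
    by (rule integral_continuous_on_param)
      (unfold case_prod_beta, intro continuous_intros continuous_on_compose2[OF cg], use inb2 r in auto)
  then show "continuous_on (ball 0 s \<times> {0..1}) (\<lambda>(z, t). radial_quot r g z t)"
    by (simp add: radial_quot_def case_prod_beta)
  show "radial_quot r g z t = radial_deriv g (of_real t *s z) / of_real t" if z: "z \<in> ball 0 s" and t: "t \<in> {0<..1}" for z t
  proof -
    have "radial_quot r g z t = deriv (\<lambda>w. g (w *s z)) (of_real t)"
      unfolding radial_quot_def
    proof (rule deriv_circle_mean)
      show "(\<lambda>w. g (w *s z)) holomorphic_on ball 0 (1 / s)"
      proof (rule slice_holomorphic_0[OF g'])
        fix w :: complex assume w: "w \<in> ball 0 (1 / s)"
        then have "norm w * norm z < (1 / s) * s" using z s by (intro mult_strict_mono') auto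
        then show "w *s z \<in> ball 0 1" using s by simp
      qed
      have "1 + r < 1 / s" using rs s by (simp add: field_simps)
      then show "cball (complex_of_real t) r \<subseteq> ball 0 (1 / s)"
        using t by (intro subsetI) (auto simp: dist_norm, 
          smt (verit) norm_of_real norm_triangle_sub norm_minus_commute)
    qed (use r in auto)
    moreover have "radial_deriv g (of_real t *s z) = of_real t * deriv (\<lambda>w. g (w *s z)) (of_real t)"
    proof (rule radial_deriv_slice[OF g'])
      have "t * norm z \<le> 1 * norm z" using t by (intro mult_right_mono) auto
      then show "of_real t *s z \<in> ball 0 1" using z t s by simp
    qed
    ultimately show ?thesis using t by simp
  qed
qed

text \<open>The two integrands can differ only at \<open>t = 0\<close>, a null set; the new one is
  continuous on the closed interval.\<close>

lemma volterra_integrand: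
  fixes f g :: "complex^'n \<Rightarrow> complex"
  assumes f: "f \<in> holo_ball" and g: "g \<in> holo_ball" and s: "0 < s" "s < 1" and z: "z \<in> ball 0 s"
  shows "volterra g f z = integral {0..1} (\<lambda>t. f (of_real t *s z) * radial_quot (1 - s) g z t)"
    and "continuous_on {0..1} (\<lambda>t. f (of_real t *s z) * radial_quot (1 - s) g z t)"
proof -
  note Q = radial_quot_props[OF g s]
  have cf: "continuous_on (ball 0 1) f" using f by (simp add: holo_ball_iff holo_on_imp_continuous_on)
  show "volterra g f z = integral {0..1} (\<lambda>t. f (of_real t *s z) * radial_quot (1 - s) g z t)"
    unfolding volterra_def
  proof (rule integral_spike[of "{0}"])
    fix t :: real assume "t \<in> {0..1} - {0}"
    then have "t \<in> {0<..1}" by auto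
    then show "f (of_real t *s z) * radial_quot (1 - s) g z t = f (t *\<^sub>R z) * radial_deriv g (t *\<^sub>R z) / of_real t"
      using Q(3)[OF z, of t] by (simp add: scaleR_conv_smult)
  qed auto
  have "continuous_on {0..1} (\<lambda>t. (\<lambda>(z, t). radial_quot (1 - s) g z t) (z, t))"
    by (rule continuous_on_compose2[OF Q(2)]) (use z in \<open>auto intro!: continuous_intros\<close>)
  moreover have "norm (of_real t *s z) < 1" if "t \<in> {0..1}" for t
    using mult_mono[of t 1 "norm z" s] that z s by auto
  ultimately show "continuous_on {0..1} (\<lambda>t. f (of_real t *s z) * radial_quot (1 - s) g z t)"
    by (intro continuous_intros continuous_on_compose2[OF cf]) auto
qed

text \<open>The statement is local: the regularized integrand is available on each ball of radius
  \<open>s < 1\<close>, and \<open>s\<close> is taken between \<open>|z|\<close> and 1.\<close>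

lemma volterra_holo_ball:
  fixes f g :: "complex^'n \<Rightarrow> complex"
  assumes f: "f \<in> holo_ball" and g: "g \<in> holo_ball"
  shows "volterra g f \<in> holo_ball"
  unfolding holo_ball_iff holo_on_def
proof
  fix z :: "complex^'n" assume z: "z \<in> ball 0 1"
  then obtain s where s: "norm z < s" "s < 1" using dense by auto
  then have s0: "0 < s" using norm_ge_zero le_less_trans by blast
  note Q = radial_quot_props[OF g s0 s(2)]
  have f': "holo_on (ball 0 1) f" using f by (simp add: holo_ball_iff)
  have cf: "continuous_on (ball 0 1) f" using f' by (rule holo_on_imp_continuous_on)
  have inb: "norm (of_real t *s y) < 1" if "t \<in> {0..1}" "norm y < s" for t and y :: "complex^'n"
    using mult_mono[of t 1 "norm y" s] that s by auto
  have "holo_on (ball 0 s) (\<lambda>z. integral {0..1} (\<lambda>t. f (of_real t *s z) * radial_quot (1 - s) g z t))"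
  proof (rule holo_on_integral)
    have 1: "continuous_on (ball 0 s \<times> {0..1}) (\<lambda>y. f (of_real (snd y) *s fst y))"
      by (intro continuous_intros continuous_on_compose2[OF cf]) (use inb in auto)
    show "continuous_on (ball 0 s \<times> {0..1}) (\<lambda>(z, t). f (of_real t *s z) * radial_quot (1 - s) g z t)"
      using continuous_on_mult[OF 1 Q(2)] by (simp add: case_prod_beta)
    show "holo_on (ball 0 s) (\<lambda>z. f (of_real t *s z) * radial_quot (1 - s) g z t)" if "t \<in> {0..1}" for t
      by (intro holo_on_mult holo_on_dilation[OF f'] Q(1) that) (use inb that in auto)
  qed auto
  then have "holo_on (ball 0 s) (volterra g f)"
    by (rule holo_on_cong[rotated 2]) (use volterra_integrand(1)[OF f g s0 s(2)] in auto)
  then show "\<exists>D. (volterra g f has_derivative D) (at z) \<and> (\<forall>c v. D (c *s v) = c * D v)"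
    using s(1) unfolding holo_on_def by auto
qed

text \<open>The factor \<open>|z|\<close> appears because the radial derivative is
  \<open>|z|\<close> times a slice derivative, and Cauchy's inequality with radius 1/4 bounds the
  latter by \<open>4 * M\<close>. It will cancel the \<open>1 / t\<close> of the Volterra
  integrand.\<close>

lemma radial_deriv_near_0:
  fixes g :: "complex^'n \<Rightarrow> complex"
  assumes g: "g \<in> holo_ball"
  shows "\<exists>C\<ge>0. \<forall>z. norm z \<le> 1 / 2 \<longrightarrow> norm (radial_deriv g z) \<le> C * norm z"
proof -
  have g': "holo_on (ball 0 1) g" using g by (simp add: holo_ball_iff)
  have cg: "continuous_on (ball 0 1) g" using g' by (rule holo_on_imp_continuous_on)
  have "compact (g ` cball 0 (3 / 4))"
    by (intro compact_continuous_image continuous_on_subset[OF cg]) auto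
  then have "bounded (g ` cball 0 (3 / 4))" by (rule compact_imp_bounded)
  then obtain M where M: "\<And>z. norm z \<le> 3 / 4 \<Longrightarrow> norm (g z) \<le> M"
    unfolding bounded_iff by (metis imageI mem_cball_0)
  have M0: "0 \<le> M" using order_trans[OF norm_ge_zero M[of 0]] by simp
  show ?thesis
  proof (intro exI[of _ "4 * M"] conjI allI impI)
    fix z :: "complex^'n" assume z: "norm z \<le> 1 / 2"
    show "norm (radial_deriv g z) \<le> 4 * M * norm z"
    proof (cases "z = 0")
      case True
      then show ?thesis by (simp add: radial_deriv_def)
    next
      case False
      define u where "u = complex_of_real (1 / norm z) *s z"
      have u: "norm u = 1" "of_real (norm z) *s u = z" using False by (auto simp: u_def vector_smult_assoc norm_divide)
      have "norm ((deriv ^^ 1) (\<lambda>w. g (w *s u)) (of_real (norm z))) \<le> fact 1 * M / (1 / 4) ^ 1"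
      proof (rule Cauchy_inequality)
        have sub: "norm w \<le> 3 / 4" if "w \<in> cball (complex_of_real (norm z)) (1 / 4)" for w
          using norm_triangle_sub[of w "of_real (norm z)"] that z by (simp add: dist_norm norm_minus_commute)
        have h: "(\<lambda>w. g (w *s u)) holomorphic_on cball (of_real (norm z)) (1 / 4)"
          using g' by (rule slice_holomorphic_0) (use sub u in force)
        then show "(\<lambda>w. g (w *s u)) holomorphic_on ball (of_real (norm z)) (1 / 4)"
          using ball_subset_cball holomorphic_on_subset by blast
        show "continuous_on (cball (of_real (norm z)) (1 / 4)) (\<lambda>w. g (w *s u))"
          using h by (rule holomorphic_on_imp_continuous_on)
        show "norm (g (w *s u)) \<le> M" if "norm (of_real (norm z) - w) = 1 / 4" for w
          using sub[of w] that u by (intro M) (auto simp: dist_norm)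
      qed simp
      then have "norm (deriv (\<lambda>w. g (w *s u)) (of_real (norm z))) \<le> 4 * M" by simp
      moreover have "radial_deriv g z = of_real (norm z) * deriv (\<lambda>w. g (w *s u)) (of_real (norm z))"
        using radial_deriv_slice[OF g', of "of_real (norm z)" u] u z by simp
      ultimately show ?thesis
        by (auto simp: norm_mult mult.commute[of "4 * M"] intro!: mult_left_mono)
    qed
  qed (use M0 in simp)
qed

text \<open>The Bloch condition with the additional factor \<open>|z|\<close>. Outside the ball of
  radius 1/2 that factor costs at most 2; inside, the previous lemma supplies it.\<close>

lemma bloch_radial_deriv_bound:
  fixes g :: "complex^'n \<Rightarrow> complex"
  assumes g: "g \<in> bloch \<alpha>" and \<alpha>: "0 \<le> \<alpha>"
  shows "\<exists>C\<ge>0. \<forall>z. norm z < 1 \<longrightarrow> norm (radial_deriv g z) \<le> C * norm z * (1 - (norm z)\<^sup>2) powr (- \<alpha>)"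
proof -
  have gh: "g \<in> holo_ball" using g \<alpha> by (simp add: bloch_def)
  obtain C where C: "C \<ge> 0" "\<And>z. norm z \<le> 1 / 2 \<Longrightarrow> norm (radial_deriv g z) \<le> C * norm z"
    using radial_deriv_near_0[OF gh] by blast
  let ?S = "SUP z\<in>ball 0 1. ennreal ((1 - (norm z)\<^sup>2) powr \<alpha> * norm (radial_deriv g z))"
  have "?S < \<infinity>" using g \<alpha> by (simp add: bloch_def)
  then obtain B where B: "?S = ennreal B" "0 \<le> B" by (cases ?S) auto
  have B': "(1 - (norm z)\<^sup>2) powr \<alpha> * norm (radial_deriv g z) \<le> B" if "norm z < 1" for z
  proof -
    have "ennreal ((1 - (norm z)\<^sup>2) powr \<alpha> * norm (radial_deriv g z)) \<le> ?S"
      by (rule SUP_upper) (use that in simp)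
    then show ?thesis using B by simp
  qed
  show ?thesis
  proof (intro exI[of _ "C + 2 * B"] conjI allI impI)
    fix z :: "complex^'n" assume z: "norm z < 1"
    let ?w = "1 - (norm z)\<^sup>2"
    have w: "0 < ?w" "?w \<le> 1" using z by (auto simp: abs_square_less_1)
    show "norm (radial_deriv g z) \<le> (C + 2 * B) * norm z * ?w powr (- \<alpha>)"
    proof (cases "norm z \<le> 1 / 2")
      case True
      have "1 \<le> ?w powr (- \<alpha>)" using w \<alpha> by (simp add: powr_minus one_le_inverse_iff powr_le1)
      then have "C * norm z * 1 \<le> (C + 2 * B) * norm z * ?w powr (- \<alpha>)"
        using C B by (intro mult_mono) auto
      then show ?thesis using C(2)[OF True] by simp
    next
      case False
      have "norm (radial_deriv g z) = ?w powr (- \<alpha>) * (?w powr \<alpha> * norm (radial_deriv g z))"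
        using w by (simp add: powr_minus)
      also have "\<dots> \<le> ?w powr (- \<alpha>) * B" using B'[OF z] by (intro mult_left_mono) auto
      also have "\<dots> \<le> ?w powr (- \<alpha>) * ((C + 2 * B) * norm z)"
      proof (rule mult_left_mono)
        have "B = 2 * B * (1 / 2)" by simp
        also have "\<dots> \<le> (C + 2 * B) * norm z" using False B C by (intro mult_mono) auto
        finally show "B \<le> (C + 2 * B) * norm z" .
      qed simp
      finally show ?thesis by (simp add: mult.commute)
    qed
  qed (use C B in simp)
qed

section \<open>Pointwise growth of Hardy functions\<close>

lemma Basis_complex_vec:
  "(Basis :: (complex^'n) set) = (\<lambda>(i, u). axis i u) ` (UNIV \<times> {1, \<i>})"
  by (auto simp: Basis_vec_def Basis_complex_def image_iff)

lemma inj_axis_complex: "inj_on (\<lambda>(i, u). axis i u :: complex^'n) (UNIV \<times> {1, \<i>})"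
  by (auto simp: inj_on_def axis_eq_axis)

lemma prod_Basis_complex_vec:
  "(\<Prod>j\<in>Basis. h j) = (\<Prod>i\<in>UNIV. h (axis i 1 :: complex^'n) * h (axis i \<i>))"
proof -
  have "(\<Prod>j\<in>Basis. h j) = (\<Prod>x\<in>UNIV \<times> {1, \<i>}. h ((\<lambda>(i, u). axis i u) x))"
    unfolding Basis_complex_vec by (subst prod.reindex[OF inj_axis_complex]) simp
  also have "\<dots> = (\<Prod>i\<in>UNIV. \<Prod>u\<in>{1, \<i>}. h (axis i u))"
    by (subst prod.cartesian_product) (simp add: case_prod_beta)
  finally show ?thesis by simp
qed

lemma sum_Basis_complex_vec:
  "(\<Sum>j\<in>Basis. h j) = (\<Sum>i\<in>UNIV. h (axis i 1 :: complex^'n) + h (axis i \<i>))"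
proof -
  have "(\<Sum>j\<in>Basis. h j) = (\<Sum>x\<in>UNIV \<times> {1, \<i>}. h ((\<lambda>(i, u). axis i u) x))"
    unfolding Basis_complex_vec by (subst sum.reindex[OF inj_axis_complex]) simp
  also have "\<dots> = (\<Sum>i\<in>UNIV. \<Sum>u\<in>{1, \<i>}. h (axis i u))"
    by (subst sum.cartesian_product) (simp add: case_prod_beta)
  finally show ?thesis by simp
qed

lemma DIM_complex_vec: "DIM(complex^'n) = 2 * CARD('n)"
  by simp

lemma norm_vec_power2: "(norm (x :: complex^'n))\<^sup>2 = (\<Sum>i\<in>UNIV. (norm (x $ i))\<^sup>2)"
  by (simp add: norm_vec_def L2_set_def sum_nonneg)

definition aniso :: "'n \<Rightarrow> real \<Rightarrow> real \<Rightarrow> complex^'n \<Rightarrow> complex^'n" where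
  "aniso k a b w = (\<chi> i. of_real (if i = k then a else b) * w $ i)"

lemma borel_measurable_aniso [measurable]: "aniso k a b \<in> borel \<rightarrow>\<^sub>M borel"
  unfolding aniso_def by (intro borel_measurable_continuous_onI continuous_intros)

lemma aniso_smult: "aniso k a b (c *s w) = c *s aniso k a b w"
  by (simp add: aniso_def vec_eq_iff)

text \<open>Each complex coordinate consists of two real ones, so the Jacobian of the dilation is
  \<open>a^2\<close> for coordinate \<open>k\<close> and \<open>b^2\<close> for each other
  coordinate.\<close>

lemma lborel_aniso:
  fixes t :: "complex^'n"
  assumes a: "0 < a" and b: "0 < b"
  shows "lborel = density (distr lborel borel (\<lambda>w. t + aniso k a b w)) (\<lambda>_. ennreal (a ^ 2 * b ^ (2 * (CARD('n) - 1))))"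
proof -
  define c where "c = (\<lambda>j::complex^'n. if j $ k \<noteq> 0 then a else b)"
  have wi: "w \<bullet> axis j 1 = Re (w $ j)" "w \<bullet> axis j \<i> = Im (w $ j)" for w :: "complex^'n" and j
    by (simp_all add: inner_axis inner_complex_def)
  have ci: "c (axis j 1) = (if j = k then a else b)" "c (axis j \<i>) = (if j = k then a else b)" for j
    by (simp_all add: c_def axis_def)
  have T: "t + aniso k a b w = t + (\<Sum>j\<in>Basis. (c j * (w \<bullet> j)) *\<^sub>R j)" for w
  proof -
    have "(\<Sum>j\<in>Basis. (c j * (w \<bullet> j)) *\<^sub>R j) = aniso k a b w"
      unfolding sum_Basis_complex_vec
    proof (rule vec_eq_iff[THEN iffD2], rule allI)
      fix i
      have "(\<Sum>j\<in>UNIV. (c (axis j 1) * (w \<bullet> axis j 1)) *\<^sub>R axis j 1 + (c (axis j \<i>) * (w \<bullet> axis j \<i>)) *\<^sub>R axis j \<i>) $ i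
        = (\<Sum>j\<in>UNIV. if j = i then of_real (if i = k then a else b) * w $ i else 0)"
        unfolding sum_component wi ci
        by (intro sum.cong) (auto simp: axis_def complex_eq_iff)
      then show "(\<Sum>j\<in>UNIV. (c (axis j 1) * (w \<bullet> axis j 1)) *\<^sub>R axis j 1 + (c (axis j \<i>) * (w \<bullet> axis j \<i>)) *\<^sub>R axis j \<i>) $ i = aniso k a b w $ i"
        by (simp add: aniso_def)
    qed
    then show ?thesis by simp
  qed
  have "(\<Prod>j\<in>Basis. \<bar>c j\<bar>) = (\<Prod>i\<in>UNIV. if i = k then a ^ 2 else b ^ 2)"
    unfolding prod_Basis_complex_vec using a b by (intro prod.cong) (auto simp: ci power2_eq_square)
  also have "\<dots> = a ^ 2 * (\<Prod>i\<in>UNIV - {k}. b ^ 2)"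
    by (subst prod.remove[of _ k]) (auto intro!: prod.cong)
  also have "\<dots> = a ^ 2 * b ^ (2 * (CARD('n) - 1))" by (simp add: card_Diff_singleton power_mult)
  finally have P: "(\<Prod>j\<in>Basis. \<bar>c j\<bar>) = a ^ 2 * b ^ (2 * (CARD('n) - 1))" .
  show ?thesis
    using lborel_affine_euclidean[of c t] a b unfolding T[symmetric] P by (auto simp: c_def)
qed

lemma nn_integral_aniso:
  fixes t :: "complex^'n" and h :: "complex^'n \<Rightarrow> ennreal"
  assumes a: "0 < a" and b: "0 < b" and h[measurable]: "h \<in> borel_measurable borel"
  shows "(\<integral>\<^sup>+x. h x \<partial>lborel) = ennreal (a ^ 2 * b ^ (2 * (CARD('n) - 1))) * (\<integral>\<^sup>+w. h (t + aniso k a b w) \<partial>lborel)"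
proof -
  have m[measurable]: "(\<lambda>w. t + aniso k a b w) \<in> borel \<rightarrow>\<^sub>M borel"
    by measurable
  have "(\<integral>\<^sup>+x. h x \<partial>lborel) = (\<integral>\<^sup>+x. h x \<partial>density (distr lborel borel (\<lambda>w. t + aniso k a b w)) (\<lambda>_. ennreal (a ^ 2 * b ^ (2 * (CARD('n) - 1)))))"
    by (rule arg_cong[where f="\<lambda>M. nn_integral M h", OF lborel_aniso[OF a b]])
  also have "\<dots> = ennreal (a ^ 2 * b ^ (2 * (CARD('n) - 1))) * (\<integral>\<^sup>+x. h x \<partial>distr lborel borel (\<lambda>w. t + aniso k a b w))"
    by (subst nn_integral_density) (auto simp: nn_integral_cmult)
  also have "(\<integral>\<^sup>+x. h x \<partial>distr lborel borel (\<lambda>w. t + aniso k a b w)) = (\<integral>\<^sup>+w. h (t + aniso k a b w) \<partial>lborel)"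
    by (subst nn_integral_distr) auto
  finally show ?thesis .
qed

text \<open>Values off the ball are arbitrary, hence possibly not measurable; extension by zero
  gives a Borel function on the whole space.\<close>

definition ball_ext :: "(complex^'n \<Rightarrow> complex) \<Rightarrow> complex^'n \<Rightarrow> complex" where
  "ball_ext f z = indicator (ball 0 1) z *\<^sub>R f z"

lemma ball_ext_eq [simp]: "norm z < 1 \<Longrightarrow> ball_ext f z = f z"
  by (simp add: ball_ext_def)

lemma borel_measurable_ball_ext:
  "f \<in> holo_ball \<Longrightarrow> ball_ext f \<in> borel_measurable borel"
  unfolding ball_ext_def[abs_def] holo_ball_iff
  by (intro borel_measurable_continuous_on_indicator holo_on_imp_continuous_on) auto

text \<open>The Poisson majorant at radius 0, where the kernel is identically 1.\<close>

lemma mean_value_circle: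
  assumes h: "h holomorphic_on ball 0 R" and R: "1 < R" and p: "0 < p"
  shows "ennreal (norm (h 0) powr p) \<le> (\<integral>\<^sup>+x. ennreal (norm (h (circ x)) powr p) \<partial>circ_measure)"
proof -
  have c: "continuous_on UNIV (\<lambda>x. norm (h (circ x)) powr p)"
    using p R by (intro continuous_on_norm_powr continuous_on_compose2[OF holomorphic_on_imp_continuous_on[OF h]] continuous_intros) auto
  have "norm (h 0) powr p \<le> integral {0..1} (\<lambda>x. norm (h (circ x)) powr p)"
    using norm_powr_le_poisson[OF h R p, of 0 0] by (simp add: poisson_def)
  then have "ennreal (norm (h 0) powr p) \<le> ennreal (integral {0..1} (\<lambda>x. norm (h (circ x)) powr p))"
    by (rule ennreal_leI)
  also have "\<dots> = (\<integral>\<^sup>+x. ennreal (norm (h (circ x)) powr p) \<partial>circ_measure)"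
    by (rule nn_integral_circ_measure[symmetric])
      (auto intro: continuous_on_subset[OF c] borel_measurable_continuous_onI[OF c])
  finally show ?thesis .
qed

text \<open>\<open>aniso\<close> is complex linear, so circles \<open>circ x *s w\<close> go to
  circles centred at \<open>z\<close> in complex lines. The one-variable mean value inequality holds
  on each of them, and rotation invariance of volume removes the average over
  \<open>x\<close>.\<close>

lemma mean_value_aniso:
  fixes f :: "complex^'n \<Rightarrow> complex"
  assumes f: "f \<in> holo_ball" and p: "0 < p" 
    and sub: "\<And>w. norm w < 1 \<Longrightarrow> norm (z + aniso k a b w) < 1"
  shows "ennreal (norm (f z) powr p) * emeasure lborel (ball (0::complex^'n) 1)
    \<le> (\<integral>\<^sup>+w. ennreal (norm (ball_ext f (z + aniso k a b w)) powr p) * indicator (ball 0 1) w \<partial>lborel)"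
proof -
  let ?u = "\<lambda>w. ennreal (norm (ball_ext f (z + aniso k a b w)) powr p) * indicator (ball 0 1) w"
  have [measurable]: "ball_ext f \<in> borel_measurable borel" by (rule borel_measurable_ball_ext[OF f])
  have m[measurable]: "(\<lambda>w. z + aniso k a b w) \<in> borel \<rightarrow>\<^sub>M borel"
    by measurable
  have [measurable]: "ball (0::complex^'n) 1 \<in> sets borel" by simp
  have um[measurable]: "?u \<in> borel_measurable borel" by measurable
  interpret lc: pair_sigma_finite circ_measure "lborel :: (complex^'n) measure" ..
  have "ennreal (norm (f z) powr p) * emeasure lborel (ball (0::complex^'n) 1)
      = (\<integral>\<^sup>+w. ennreal (norm (f z) powr p) * indicator (ball (0::complex^'n) 1) w \<partial>lborel)"
    by (rule nn_integral_cmult_indicator[symmetric]) simp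
  also have "\<dots> \<le> (\<integral>\<^sup>+w. (\<integral>\<^sup>+x. ?u (circ x *s w) \<partial>circ_measure) \<partial>lborel)"
  proof (rule nn_integral_mono)
    fix w :: "complex^'n"
    show "ennreal (norm (f z) powr p) * indicator (ball 0 1) w \<le> (\<integral>\<^sup>+x. ?u (circ x *s w) \<partial>circ_measure)"
    proof (cases "norm w < 1")
      case True
      \<comment> \<open>The slice is holomorphic as long as \<open>c *s w\<close> stays in the unit
        ball. For \<open>w = 0\<close> it is constant and any radius above 1 would do.\<close>
      define R where "R = (if w = 0 then 2 else 1 / norm w)"
      have R: "1 < R" using True by (simp add: R_def)
      have hol: "(\<lambda>c. f (z + c *s aniso k a b w)) holomorphic_on ball 0 R"
      proof (rule slice_holomorphic)
        show "holo_on (ball 0 1) f" using f by (simp add: holo_ball_iff)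
        fix c :: complex assume "c \<in> ball 0 R"
        then have "norm (c *s w) < 1" by (cases "w = 0") (auto simp: R_def field_simps)
        from sub[OF this] show "z + c *s aniso k a b w \<in> ball 0 1" by (simp add: aniso_smult)
      qed
      have "ennreal (norm (f z) powr p) \<le> (\<integral>\<^sup>+x. ennreal (norm (f (z + circ x *s aniso k a b w)) powr p) \<partial>circ_measure)"
        using mean_value_circle[OF hol R p] by simp
      also have "\<dots> = (\<integral>\<^sup>+x. ?u (circ x *s w) \<partial>circ_measure)"
      proof (rule nn_integral_cong)
        fix x :: real
        have "norm (z + circ x *s aniso k a b w) < 1" using sub[of "circ x *s w"] True by (simp add: aniso_smult)
        then show "ennreal (norm (f (z + circ x *s aniso k a b w)) powr p) = ?u (circ x *s w)"
          using True by (simp add: aniso_smult)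
      qed
      finally show ?thesis using True by simp
    qed simp
  qed
  also have "\<dots> = (\<integral>\<^sup>+x. (\<integral>\<^sup>+w. ?u (circ x *s w) \<partial>lborel) \<partial>circ_measure)"
  proof (rule lc.Fubini')
    show "(\<lambda>(x, w). ?u (circ x *s w)) \<in> borel_measurable (circ_measure \<Otimes>\<^sub>M lborel)"
      unfolding case_prod_beta by (rule measurable_compose[OF _ um]) measurable
  qed
  also have "\<dots> = (\<integral>\<^sup>+x. (\<integral>\<^sup>+w. ?u w \<partial>lborel) \<partial>circ_measure)"
  proof (rule nn_integral_cong)
    fix x :: real
    have "(\<integral>\<^sup>+w. ?u w \<partial>lborel) = (\<integral>\<^sup>+w. ?u w \<partial>distr lborel borel (\<lambda>w. circ x *s w))"
      by (simp add: lborel_distr_orthogonal orthogonal_transformation_rotation)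
    also have "\<dots> = (\<integral>\<^sup>+w. ?u (circ x *s w) \<partial>lborel)"
      by (rule nn_integral_distr) (use um in \<open>auto intro!: borel_measurable_continuous_onI continuous_intros\<close>)
    finally show "(\<integral>\<^sup>+w. ?u (circ x *s w) \<partial>lborel) = (\<integral>\<^sup>+w. ?u w \<partial>lborel)" by simp
  qed
  also have "\<dots> = (\<integral>\<^sup>+w. ?u w \<partial>lborel)" by simp
  finally show ?thesis .
qed

text \<open>Displacement by at most \<open>\<delta> / 2\<close> in coordinate \<open>k\<close> and
  \<open>sqrt \<delta> / 2\<close> in the others: the latter contributes at most
  \<open>\<delta> / 4\<close> to the squared norm, so this is at most \<open>(1 - \<delta>/2)^2 +
  \<delta>/4 = 1 - 3\<delta>/4 + \<delta>^2/4 < 1\<close>.\<close>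

lemma aniso_ball_shell:
  fixes w z :: "complex^'n" and k :: 'n and \<delta> :: real
  assumes \<delta>: "0 < \<delta>" "\<delta> \<le> 1" and w: "norm w < 1"
  defines "z \<equiv> axis k (of_real (1 - \<delta>)) + aniso k (\<delta> / 2) (sqrt \<delta> / 2) w"
  shows "1 - 3 * \<delta> / 2 < norm z" "norm z < 1" "norm (1 - z $ k) \<le> 3 * \<delta> / 2"
proof -
  define a where "a = \<delta> / 2"
  define b where "b = sqrt \<delta> / 2"
  define r where "r = 1 - \<delta>"
  have ab: "0 < a" "0 < b" using \<delta> by (auto simp: a_def b_def)
  have r: "0 \<le> r" using \<delta> by (simp add: r_def)
  have z: "z = axis k (of_real r) + aniso k a b w" by (simp add: z_def a_def b_def r_def)
  have wk: "norm (w $ k) < 1" by (rule le_less_trans[OF Finite_Cartesian_Product.norm_nth_le w])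
  have comp: "z $ k = of_real r + of_real a * w $ k"
    by (simp add: z aniso_def axis_def)
  have "r - a < norm (of_real r + of_real a * w $ k)"
  proof -
    have "norm (of_real r :: complex) - norm (of_real a * w $ k) \<le> norm (of_real r + of_real a * w $ k)"
      by (rule norm_diff_ineq)
    moreover have "norm (of_real a * w $ k) < a" using wk ab by (simp add: norm_mult)
    ultimately show ?thesis using r by simp
  qed
  also have "\<dots> \<le> norm z" unfolding comp[symmetric] by (rule Finite_Cartesian_Product.norm_nth_le)
  finally show "1 - 3 * \<delta> / 2 < norm z" using \<delta> by (simp add: r_def a_def)
  have "(norm z)\<^sup>2 = (norm (of_real r + of_real a * w $ k))\<^sup>2 + (\<Sum>i\<in>UNIV - {k}. (norm (of_real b * w $ i))\<^sup>2)"
    unfolding norm_vec_power2 by (subst sum.remove[of _ k]) (auto simp: z aniso_def axis_def intro!: sum.cong)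
  also have "(norm (of_real r + of_real a * w $ k))\<^sup>2 \<le> (r + a)\<^sup>2"
  proof (rule power_mono)
    have "norm (of_real r + of_real a * w $ k) \<le> norm (of_real r :: complex) + norm (of_real a * w $ k)"
      by (rule norm_triangle_ineq)
    also have "norm (of_real a * w $ k) \<le> a" using wk ab mult_left_le[of "norm (w $ k)" a] by (simp add: norm_mult)
    finally show "norm (of_real r + of_real a * w $ k) \<le> r + a" using r by simp
  qed simp
  also have "(\<Sum>i\<in>UNIV - {k}. (norm (of_real b * w $ i))\<^sup>2) \<le> (\<Sum>i\<in>UNIV. (norm (of_real b * w $ i))\<^sup>2)"
    by (rule sum_mono2) auto
  also have "\<dots> = b\<^sup>2 * (norm w)\<^sup>2"
    using ab by (simp add: norm_vec_power2 norm_mult power_mult_distrib sum_distrib_left)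
  also have "\<dots> \<le> b\<^sup>2 * 1" using w by (intro mult_left_mono) (auto simp: power_le_one)
  also have "(r + a)\<^sup>2 + b\<^sup>2 * 1 = 1 - 3 * \<delta> / 4 + \<delta>\<^sup>2 / 4"
  proof -
    have "b\<^sup>2 = \<delta> / 4" using \<delta> by (simp add: b_def power_divide)
    then show ?thesis unfolding r_def a_def by (simp add: power2_eq_square algebra_simps)
  qed
  also have "\<dots> < 1"
  proof -
    have "\<delta>\<^sup>2 \<le> \<delta>" using \<delta> by (simp add: power2_eq_square mult_left_le)
    then show ?thesis using \<delta> by simp
  qed
  finally show "norm z < 1" by (simp add: abs_square_less_1)
  have "1 - z $ k = of_real \<delta> - of_real a * w $ k" unfolding comp by (simp add: r_def)
  then have "norm (1 - z $ k) \<le> norm (of_real \<delta> :: complex) + norm (of_real a * w $ k)"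
    by (metis norm_triangle_ineq4)
  also have "norm (of_real a * w $ k) \<le> a" using wk ab mult_left_le[of "norm (w $ k)" a] by (simp add: norm_mult)
  finally show "norm (1 - z $ k) \<le> 3 * \<delta> / 2" using \<delta> by (simp add: a_def)
qed

text \<open>The Jacobian has order \<open>\<delta>^(n+1)\<close>, one power more than the sharp
  growth exponent; that power is matched by the thickness of the shell.\<close>

lemma aniso_det:
  assumes "0 \<le> \<delta>"
  shows "(\<delta> / 2) ^ 2 * (sqrt \<delta> / 2) ^ (2 * (CARD('n) - 1)) = \<delta> * \<delta> ^ CARD('n::finite) / 4 ^ CARD('n)"
proof -
  have n: "1 \<le> CARD('n)" by (simp add: Suc_leI)
  have "(sqrt \<delta> / 2) ^ (2 * (CARD('n) - 1)) = (\<delta> / 4) ^ (CARD('n) - 1)"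
    using assms by (simp add: power_mult power_divide)
  then have "(\<delta> / 2) ^ 2 * (sqrt \<delta> / 2) ^ (2 * (CARD('n) - 1)) = \<delta> * ((\<delta> / 4) * (\<delta> / 4) ^ (CARD('n) - 1))"
    by (simp add: power2_eq_square)
  also have "(\<delta> / 4) * (\<delta> / 4) ^ (CARD('n) - 1) = (\<delta> / 4) ^ CARD('n)" using n by (simp add: power_eq_if)
  finally show ?thesis by (simp add: power_divide)
qed

text \<open>The mean value over the ellipsoid is bounded by an integral over the shell containing
  it. Bernoulli's inequality bounds the relative volume of the shell by
  \<open>2n * (3\<delta>/2) = 3n\<delta>\<close>; dividing by the Jacobian
  \<open>\<delta> * \<delta>^n / 4^n\<close> gives the stated constant.\<close>

lemma growth_axis:
  fixes f :: "complex^'n \<Rightarrow> complex" and K :: real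
  assumes f: "f \<in> holo_ball" and p: "0 < p" and r: "0 \<le> r" "r < 1"
    and K: "\<And>s. 0 \<le> s \<Longrightarrow> s < 1 \<Longrightarrow> (\<integral>\<^sup>+\<zeta>. ennreal (norm (f (s *\<^sub>R \<zeta>)) powr p) \<partial>sphere_measure) \<le> ennreal K"
    and K0: "0 \<le> K"
  shows "norm (f (axis k (of_real r))) powr p \<le> 3 * real CARD('n) * 4 ^ CARD('n) * K / (1 - r) ^ CARD('n)"
proof -
  let ?n = "CARD('n)"
  define \<delta> where "\<delta> = 1 - r"
  have \<delta>: "0 < \<delta>" "\<delta> \<le> 1" "r = 1 - \<delta>" using r by (auto simp: \<delta>_def)
  define a where "a = \<delta> / 2"
  define b where "b = sqrt \<delta> / 2"
  have ab: "0 < a" "0 < b" using \<delta> by (auto simp: a_def b_def)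
  define z where "z = (axis k (of_real r) :: complex^'n)"
  define s0 where "s0 = 1 - 3 * \<delta> / 2"
  have n: "1 \<le> ?n" by (simp add: Suc_leI)
  have in1: "s0 < norm (z + aniso k a b w) \<and> norm (z + aniso k a b w) < 1" if w: "norm w < 1" for w
    using aniso_ball_shell[OF \<delta>(1,2) w, of k] by (simp add: s0_def z_def a_def b_def \<delta>(3))
  define u where "u = (\<lambda>x. ennreal (norm (ball_ext f x) powr p))"
  have [measurable]: "ball_ext f \<in> borel_measurable borel" by (rule borel_measurable_ball_ext[OF f])
  have [measurable]: "u \<in> borel_measurable borel" unfolding u_def by measurable
  define h where "h = (\<lambda>x. u x * indicator {x. s0 < norm x \<and> norm x < 1} x)"
  have [measurable]: "h \<in> borel_measurable borel" unfolding h_def by measurable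
  let ?V = "emeasure lborel (ball (0::complex^'n) 1)"
  let ?det = "a ^ 2 * b ^ (2 * (?n - 1))"
  have det: "?det = \<delta> * \<delta> ^ ?n / 4 ^ ?n"
    unfolding a_def b_def by (rule aniso_det) (use \<delta> in simp)
  have hK: "(\<integral>\<^sup>+x. h x \<partial>lborel) \<le> ennreal K * ennreal (3 * ?n * \<delta>) * ?V"
  proof -
    \<comment> \<open>\<open>s0\<close> is negative when \<open>\<delta> > 2/3\<close>. Replacing it
      by 0 then loses only the origin from the shell, a null set.\<close>
    define s where "s = max 0 s0"
    have s: "0 \<le> s" "s < 1" using \<delta> by (auto simp: s_def s0_def)
    have Ku: "(\<integral>\<^sup>+\<zeta>. u (\<rho> *\<^sub>R \<zeta>) \<partial>sphere_measure) \<le> ennreal K" if "s < \<rho>" "\<rho> < 1" for \<rho>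
    proof -
      have "(\<integral>\<^sup>+\<zeta>. u (\<rho> *\<^sub>R \<zeta>) \<partial>sphere_measure) = (\<integral>\<^sup>+\<zeta>. ennreal (norm (f (\<rho> *\<^sub>R \<zeta>)) powr p) \<partial>sphere_measure)"
        by (intro nn_integral_cong) (use s that in \<open>simp add: u_def\<close>)
      then show ?thesis using K[of \<rho>] s that by simp
    qed
    have "(\<integral>\<^sup>+x. h x \<partial>lborel) \<le> (\<integral>\<^sup>+x. u x * indicator {x. s < norm x \<and> norm x < 1} x \<partial>lborel)"
      by (rule nn_integral_mono_AE, rule AE_mp[OF AE_lborel_singleton[of 0]]) (auto simp: h_def s_def indicator_def)
    also have "\<dots> \<le> ennreal K * ennreal (1 - s ^ DIM(complex^'n)) * ?V"
      by (rule nn_integral_shell_le[OF _ s Ku]) measurable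
    also have "\<dots> \<le> ennreal K * ennreal (3 * ?n * \<delta>) * ?V"
    proof (intro mult_right_mono mult_left_mono ennreal_leI)
      have "1 + real (2 * ?n) * (s - 1) \<le> (1 + (s - 1)) ^ (2 * ?n)"
        by (rule Bernoulli_inequality) (use s in simp)
      then have "1 - s ^ (2 * ?n) \<le> 2 * ?n * (1 - s)" by (simp add: algebra_simps)
      also have "\<dots> \<le> 2 * ?n * (3 * \<delta> / 2)" by (intro mult_left_mono) (auto simp: s_def s0_def max_def)
      finally show "1 - s ^ DIM(complex^'n) \<le> 3 * ?n * \<delta>" by (simp add: mult_ac)
    qed auto
    finally show ?thesis .
  qed
  have "ennreal (norm (f z) powr p) * ?V \<le> (\<integral>\<^sup>+w. u (z + aniso k a b w) * indicator (ball 0 1) w \<partial>lborel)"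
    unfolding u_def by (rule mean_value_aniso[OF f p]) (use in1 in auto)
  also have "\<dots> \<le> (\<integral>\<^sup>+w. h (z + aniso k a b w) \<partial>lborel)"
    by (rule nn_integral_mono) (use in1 in \<open>auto simp: h_def indicator_def\<close>)
  finally have "ennreal ?det * (ennreal (norm (f z) powr p) * ?V) \<le> ennreal ?det * (\<integral>\<^sup>+w. h (z + aniso k a b w) \<partial>lborel)"
    by (rule mult_left_mono) simp
  also have "\<dots> = (\<integral>\<^sup>+x. h x \<partial>lborel)" by (rule nn_integral_aniso[OF ab, symmetric]) measurable
  also note hK
  finally have fin: "ennreal ?det * (ennreal (norm (f z) powr p) * ?V) \<le> ennreal K * ennreal (3 * ?n * \<delta>) * ?V" .
  obtain V where V: "?V = ennreal V" "0 < V" by (rule emeasure_unit_ball_ennreal)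
  have "ennreal (?det * (norm (f z) powr p * V)) \<le> ennreal (K * (3 * ?n * \<delta>) * V)"
    using fin V K0 \<delta> ab by (simp add: ennreal_mult)
  then have "?det * (norm (f z) powr p * V) \<le> K * (3 * ?n * \<delta>) * V"
    using V K0 \<delta> by (simp add: ennreal_le_iff)
  then have "?det * norm (f z) powr p \<le> K * (3 * ?n * \<delta>)" using V by (simp add: mult.assoc[symmetric])
  then have "\<delta> * (\<delta> ^ ?n * norm (f z) powr p) \<le> \<delta> * (3 * ?n * 4 ^ ?n * K)"
    unfolding det by (simp add: field_simps)
  then have "\<delta> ^ ?n * norm (f z) powr p \<le> 3 * ?n * 4 ^ ?n * K" using \<delta> by simp
  then show ?thesis using \<delta> by (simp add: z_def[symmetric] \<delta>_def[symmetric] field_simps)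
qed

section \<open>Reduction to a coordinate axis by unitary maps\<close>

definition herm :: "complex^'n \<Rightarrow> complex^'n \<Rightarrow> complex" where
  "herm w v = (\<Sum>i\<in>UNIV. w $ i * cnj (v $ i))"

lemma norm_diff_smult_power2:
  "(norm (w - c *s v))\<^sup>2 = (norm w)\<^sup>2 - 2 * Re (cnj c * herm w v) + (norm c)\<^sup>2 * (norm v)\<^sup>2"
proof -
  have "(norm (w $ i - c * v $ i))\<^sup>2 = (norm (w $ i))\<^sup>2 - 2 * Re (cnj c * (w $ i * cnj (v $ i))) + (norm c)\<^sup>2 * (norm (v $ i))\<^sup>2" for i
    unfolding cmod_power2 by (simp add: power2_eq_square algebra_simps)
  then show ?thesis
    by (simp add: norm_vec_power2 herm_def sum_distrib_left sum.distrib sum_subtractf)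
qed

text \<open>A complex Householder reflection, composed with a scalar rotation.\<close>

lemma unitary_to_axis:
  fixes z :: "complex^'n" and k :: 'n
  shows "\<exists>U :: complex^'n \<Rightarrow> complex^'n. orthogonal_transformation U \<and> (\<forall>c w. U (c *s w) = c *s U w) \<and> U (axis k (of_real (norm z))) = z"
proof (cases "z = 0")
  case True
  show ?thesis
    by (rule exI[of _ "\<lambda>x. x"]) (simp add: True orthogonal_transformation_id axis_def vec_eq_iff)
next
  case False
  define r where "r = norm z"
  have r: "0 < r" using False by (simp add: r_def)
  \<comment> \<open>This phase makes the \<open>k\<close>-th coordinate of \<open>b\<close> real and
    nonnegative. A complex reflection exchanges two unit vectors only if their Hermitian product is
    real; the phase is restored in \<open>U\<close>.\<close>
  define e where "e = (if z $ k = 0 then 1 else z $ k / of_real (norm (z $ k)))"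
  have e: "norm e = 1" by (auto simp: e_def norm_divide)
  have ee: "cnj e * e = 1" using complex_norm_square[of e] e by (simp add: mult.commute)
  define b where "b = (cnj e / of_real r) *s z"
  have ez: "(e * of_real r) *s b = z"
    using ee r by (simp add: b_def vector_smult_assoc mult.commute[of e])
  have nb: "norm b = 1" using e r by (simp add: b_def norm_divide r_def)
  have "cnj (z $ k) * z $ k = of_real (norm (z $ k)) * of_real (norm (z $ k))"
    using complex_norm_square[of "z $ k"] by (simp add: mult.commute power2_eq_square)
  then have "cnj e * z $ k = of_real (norm (z $ k))"
    by (auto simp: e_def)
  then have bk: "b $ k = of_real (norm (z $ k) / r)" by (simp add: b_def)
  define \<beta> where "\<beta> = norm (z $ k) / r"
  define v where "v = axis k 1 - b"
  have hv: "herm (axis k 1) v = of_real (1 - \<beta>)"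
    by (simp add: herm_def v_def axis_def bk \<beta>_def if_distrib[of "\<lambda>x. x * _"] cong: if_cong)
  have nax: "norm (axis k 1 :: complex^'n) = 1"
  proof -
    have "(norm (axis k 1 :: complex^'n))\<^sup>2 = (\<Sum>i\<in>UNIV. if i = k then 1 else 0)"
      unfolding norm_vec_power2 by (intro sum.cong) (auto simp: axis_def)
    then show ?thesis using norm_ge_zero[of "axis k 1 :: complex^'n"] by (auto simp: power2_eq_1_iff)
  qed
  have haxb: "herm (axis k 1) b = of_real \<beta>"
    by (simp add: herm_def axis_def bk \<beta>_def if_distrib[of "\<lambda>x. x * _"] cong: if_cong)
  have nv: "(norm v)\<^sup>2 = 2 * (1 - \<beta>)"
    using norm_diff_smult_power2[of "axis k 1" 1 b] by (simp add: v_def haxb nb nax)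
  define H where "H = (\<lambda>w. w - (2 * herm w v / of_real ((norm v)\<^sup>2)) *s v)"
  have herm_add: "herm (x + y) v = herm x v + herm y v" for x y
    by (simp add: herm_def algebra_simps sum.distrib)
  have herm_smult: "herm (c *s x) v = c * herm x v" for c x
    by (simp add: herm_def sum_distrib_left mult.assoc)
  have Hs: "H (c *s w) = c *s H w" for c w
    by (simp add: H_def herm_smult vec_eq_iff algebra_simps)
  have Ha: "H (x + y) = H x + H y" for x y
    by (simp add: H_def herm_add vec_eq_iff algebra_simps add_divide_distrib)
  have nH: "norm (H w) = norm w" for w
  proof (cases "v = 0")
    case False
    define h where "h = herm w v"
    have nv0: "(norm v)\<^sup>2 \<noteq> 0" using False by simp
    have e: "cnj h * h = of_real ((norm h)\<^sup>2)"
      by (simp only: complex_norm_square mult.commute)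
    have "cnj (2 * h / of_real ((norm v)\<^sup>2)) * h = 2 * (cnj h * h) / of_real ((norm v)\<^sup>2)" by simp
    also have "\<dots> = of_real (2 * (norm h)\<^sup>2 / (norm v)\<^sup>2)" unfolding e by simp
    finally have E: "cnj (2 * h / of_real ((norm v)\<^sup>2)) * h = of_real (2 * (norm h)\<^sup>2 / (norm v)\<^sup>2)" .
    have 1: "Re (cnj (2 * h / of_real ((norm v)\<^sup>2)) * h) = 2 * (norm h)\<^sup>2 / (norm v)\<^sup>2"
      unfolding E by (rule Re_complex_of_real)
    have 2: "(norm (2 * h / of_real ((norm v)\<^sup>2)))\<^sup>2 * (norm v)\<^sup>2 = 4 * (norm h)\<^sup>2 / (norm v)\<^sup>2"
      using nv0 by (simp add: norm_divide norm_mult power_divide power_mult_distrib power2_eq_square)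
    have "(norm (H w))\<^sup>2 = (norm w)\<^sup>2"
      unfolding H_def norm_diff_smult_power2 h_def[symmetric] 1 2 by simp
    then show ?thesis by simp
  qed (simp add: H_def)
  have Hk: "H (axis k 1) = b"
  \<comment> \<open>For \<open>v = 0\<close> the vector \<open>b\<close> already is the axis vector
    and \<open>H\<close> is the identity.\<close>
  proof (cases "v = 0")
    case True
    then show ?thesis by (simp add: H_def) (simp add: v_def)
  next
    case False
    then have "1 - \<beta> \<noteq> 0" using nv by auto
    then have "2 * herm (axis k 1) v / of_real ((norm v)\<^sup>2) = 1" 
      unfolding hv nv by (metis divide_self_if mult_eq_0_iff of_real_eq_0_iff of_real_mult of_real_numeral zero_neq_numeral)
    then show ?thesis by (simp add: H_def) (simp add: v_def)
  qed
  define U where "U = (\<lambda>w. e *s H w)"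
  have Us: "U (c *s w) = c *s U w" for c w by (simp add: U_def Hs vector_smult_assoc mult.commute)
  have "orthogonal_transformation U"
    unfolding orthogonal_transformation
  proof (intro conjI allI linearI)
    show "U (x + y) = U x + U y" for x y by (simp add: U_def Ha vector_add_ldistrib)
    show "U (c *\<^sub>R x) = c *\<^sub>R U x" for c x by (simp add: scaleR_conv_smult Us)
    show "norm (U w) = norm w" for w by (simp add: U_def e nH)
  qed
  moreover have "U (axis k (of_real r)) = z"
  proof -
    have "axis k (of_real r) = of_real r *s (axis k 1 :: complex^'n)" by (simp add: vec_eq_iff axis_def)
    then show ?thesis using ez by (simp add: Us) (simp add: U_def Hk vector_smult_assoc mult.commute)
  qed
  ultimately show ?thesis using Us unfolding r_def by blast
qed

lemma holo_ball_comp_unitary: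
  fixes f :: "complex^'n \<Rightarrow> complex" and U :: "complex^'n \<Rightarrow> complex^'n"
  assumes f: "f \<in> holo_ball" and U: "orthogonal_transformation U" "\<And>c w. U (c *s w) = c *s U w"
  shows "(\<lambda>z. f (U z)) \<in> holo_ball"
  unfolding holo_ball_iff holo_on_def
proof
  fix z assume "z \<in> ball (0::complex^'n) 1"
  then have "U z \<in> ball 0 1" using U(1) by (simp add: orthogonal_transformation)
  then obtain D where D: "(f has_derivative D) (at (U z))" "\<And>c v. D (c *s v) = c * D v"
    using f unfolding holo_ball_def by blast
  have "bounded_linear U" using U(1) by (simp add: orthogonal_transformation_linear linear_conv_bounded_linear[symmetric])
  then have "(U has_derivative U) (at z)" by (rule bounded_linear_imp_has_derivative)
  from has_derivative_compose[OF this D(1)]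
  show "\<exists>D. ((\<lambda>z. f (U z)) has_derivative D) (at z) \<and> (\<forall>c v. D (c *s v) = c * D v)"
    by (intro exI conjI) (auto simp: D(2) U(2))
qed

text \<open>The integral means of \<open>f\<close> are invariant under a complex linear isometry,
  because it preserves the surface measure and commutes with dilations. So \<open>z\<close> may be
  moved onto an axis.\<close>

lemma hardy_growth:
  fixes f :: "complex^'n \<Rightarrow> complex" and K :: real
  assumes f: "f \<in> holo_ball" and p: "0 < p" and z: "norm z < 1"
    and K: "\<And>s. 0 \<le> s \<Longrightarrow> s < 1 \<Longrightarrow> (\<integral>\<^sup>+\<zeta>. ennreal (norm (f (s *\<^sub>R \<zeta>)) powr p) \<partial>sphere_measure) \<le> ennreal K"
    and K0: "0 \<le> K"
  shows "norm (f z) powr p \<le> 3 * real CARD('n) * 4 ^ CARD('n) * K / (1 - norm z) ^ CARD('n)"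
proof -
  obtain k :: 'n where True by simp
  obtain U where U: "orthogonal_transformation U" "\<And>c w. U (c *s w) = c *s U w" "U (axis k (of_real (norm z))) = z"
    using unitary_to_axis[of k z] by blast
  have fU: "(\<lambda>z. f (U z)) \<in> holo_ball" by (rule holo_ball_comp_unitary[OF f U(1,2)])
  have "norm (f (U (axis k (of_real (norm z))))) powr p \<le> 3 * real CARD('n) * 4 ^ CARD('n) * K / (1 - norm z) ^ CARD('n)"
  proof (rule growth_axis[OF fU p _ z _ K0])
    fix s :: real assume s: "0 \<le> s" "s < 1"
    have [measurable]: "ball_ext f \<in> borel_measurable borel" by (rule borel_measurable_ball_ext[OF f])
    have nU: "norm (U w) = norm w" for w using U(1) by (simp add: orthogonal_transformation)
    have "(\<integral>\<^sup>+\<zeta>. ennreal (norm (f (U (s *\<^sub>R \<zeta>))) powr p) \<partial>sphere_measure) =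
        (\<integral>\<^sup>+\<zeta>. ennreal (norm (ball_ext f (s *\<^sub>R U \<zeta>)) powr p) \<partial>sphere_measure)"
      using s by (intro nn_integral_cong) (simp add: scaleR_conv_smult U(2) nU)
    also have "\<dots> = (\<integral>\<^sup>+\<zeta>. ennreal (norm (ball_ext f (s *\<^sub>R \<zeta>)) powr p) \<partial>sphere_measure)"
      by (rule nn_integral_sphere_rotation[OF U(1), of "\<lambda>\<zeta>. ennreal (norm (ball_ext f (s *\<^sub>R \<zeta>)) powr p)"]) measurable
    also have "\<dots> = (\<integral>\<^sup>+\<zeta>. ennreal (norm (f (s *\<^sub>R \<zeta>)) powr p) \<partial>sphere_measure)"
      using s by (intro nn_integral_cong) simp
    finally show "(\<integral>\<^sup>+\<zeta>. ennreal (norm (f (U (s *\<^sub>R \<zeta>))) powr p) \<partial>sphere_measure) \<le> ennreal K"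
      using K[OF s] by simp
  qed simp
  then show ?thesis by (simp add: U(3))
qed

section \<open>The inclusion\<close>

text \<open>Integrability has to be secured, since the Bochner integral in \<open>hardy_norm\<close>
  takes the default value 0 otherwise. It follows from boundedness of \<open>f\<close> on the
  compact ball of radius \<open>s < 1\<close>.\<close>

lemma nn_integral_hardy:
  fixes f :: "complex^'n \<Rightarrow> complex"
  assumes f: "f \<in> holo_ball" and p: "0 < p" and s: "0 \<le> s" "s < 1"
  shows "(\<integral>\<^sup>+\<zeta>. ennreal (norm (f (s *\<^sub>R \<zeta>)) powr p) \<partial>sphere_measure) =
    ennreal (\<integral>\<zeta>. norm (f (s *\<^sub>R \<zeta>)) powr p \<partial>sphere_measure)"
proof (rule nn_integral_eq_integral)
  let ?\<sigma> = "sphere_measure :: (complex^'n) measure"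
  have [measurable]: "ball_ext f \<in> borel_measurable borel" by (rule borel_measurable_ball_ext[OF f])
  have cf: "continuous_on (ball 0 1) f" using f by (simp add: holo_ball_iff holo_on_imp_continuous_on)
  have "bounded (f ` cball 0 s)"
    by (intro compact_imp_bounded compact_continuous_image continuous_on_subset[OF cf]) (use s in auto)
  then obtain M where M: "\<And>z. norm z \<le> s \<Longrightarrow> norm (f z) \<le> M"
    unfolding bounded_iff by (metis imageI mem_cball_0)
  show "integrable ?\<sigma> (\<lambda>\<zeta>. norm (f (s *\<^sub>R \<zeta>)) powr p)"
  proof (rule sphere_measure.integrable_const_bound[of _ "M powr p"])
    show "AE \<zeta> in ?\<sigma>. norm (norm (f (s *\<^sub>R \<zeta>)) powr p) \<le> M powr p"
      by (rule AE_I2) (use s p in \<open>auto intro!: powr_mono2 M\<close>)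
    have "(\<lambda>\<zeta>. norm (ball_ext f (s *\<^sub>R \<zeta>)) powr p) \<in> borel_measurable ?\<sigma>"
      by (rule measurable_on_sphere) measurable
    moreover have "(\<lambda>\<zeta>. norm (ball_ext f (s *\<^sub>R \<zeta>)) powr p) \<in> borel_measurable ?\<sigma> \<longleftrightarrow>
       (\<lambda>\<zeta>. norm (f (s *\<^sub>R \<zeta>)) powr p) \<in> borel_measurable ?\<sigma>"
      by (rule measurable_cong) (use s in simp)
    ultimately show "(\<lambda>\<zeta>. norm (f (s *\<^sub>R \<zeta>)) powr p) \<in> borel_measurable ?\<sigma>" by blast
  qed
qed auto

text \<open>Working form of membership: p-th means bounded uniformly in \<open>s\<close>, as
  extended nonnegative integrals and without the root.\<close>

lemma hardy_iff:
  fixes f :: "complex^'n \<Rightarrow> complex"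
  assumes p: "0 < p"
  shows "f \<in> hardy p \<longleftrightarrow> f \<in> holo_ball \<and>
    (\<exists>K\<ge>0. \<forall>s\<in>{0..<1}. (\<integral>\<^sup>+\<zeta>. ennreal (norm (f (s *\<^sub>R \<zeta>)) powr p) \<partial>sphere_measure) \<le> ennreal K)"
proof (cases "f \<in> holo_ball")
  case True
  define I where "I = (\<lambda>s. \<integral>\<zeta>. norm (f (s *\<^sub>R \<zeta>)) powr p \<partial>sphere_measure)"
  have I: "(\<integral>\<^sup>+\<zeta>. ennreal (norm (f (s *\<^sub>R \<zeta>)) powr p) \<partial>sphere_measure) = ennreal (I s)" if "s \<in> {0..<1}" for s
    using nn_integral_hardy[OF True p, of s] that by (simp add: I_def)
  have I0: "0 \<le> I s" for s unfolding I_def by (intro integral_nonneg_AE) auto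
  have N: "hardy_norm p f = (SUP s\<in>{0..<1}. ennreal (I s powr (1 / p)))"
    by (simp add: hardy_norm_def I_def)
  have "hardy_norm p f < \<infinity> \<longleftrightarrow> (\<exists>K\<ge>0. \<forall>s\<in>{0..<1}. I s \<le> K)"
  proof
    assume "hardy_norm p f < \<infinity>"
    then obtain B where B: "hardy_norm p f = ennreal B" "0 \<le> B" by (cases "hardy_norm p f") auto
    have "I s \<le> B powr p" if "s \<in> {0..<1}" for s
    proof -
      have "ennreal (I s powr (1 / p)) \<le> ennreal B"
        unfolding B(1)[symmetric] N by (rule SUP_upper[OF that])
      then have "I s powr (1 / p) \<le> B" using B by simp
      then have "(I s powr (1 / p)) powr p \<le> B powr p" using p by (intro powr_mono2) auto
      then show ?thesis using p I0[of s] by (simp add: powr_powr)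
    qed
    then show "\<exists>K\<ge>0. \<forall>s\<in>{0..<1}. I s \<le> K" by (intro exI[of _ "B powr p"]) auto
  next
    assume "\<exists>K\<ge>0. \<forall>s\<in>{0..<1}. I s \<le> K"
    then obtain K where K: "K \<ge> 0" "\<And>s. s \<in> {0..<1} \<Longrightarrow> I s \<le> K" by blast
    have "hardy_norm p f \<le> ennreal (K powr (1 / p))"
      unfolding N by (intro SUP_least ennreal_leI powr_mono2) (use K p I0 in auto)
    then show "hardy_norm p f < \<infinity>" by (simp add: le_less_trans)
  qed
  also have "\<dots> \<longleftrightarrow> (\<exists>K\<ge>0. \<forall>s\<in>{0..<1}. (\<integral>\<^sup>+\<zeta>. ennreal (norm (f (s *\<^sub>R \<zeta>)) powr p) \<partial>sphere_measure) \<le> ennreal K)"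
    by (intro ex_cong1 conj_cong ball_cong refl) (simp add: I ennreal_le_iff)
  finally show ?thesis using True by (simp add: hardy_def)
qed (simp add: hardy_def)

text \<open>On the left part the power \<open>-e - 1\<close> is not integrable up to 1 and its
  integral is governed by the end point \<open>1 - \<delta>\<close>; on the right part
  \<open>\<beta> - 1 > -1\<close> is integrable. Hedberg's bound and the logarithmic example both
  rest on this.\<close>

lemma integral_split_power_bound:
  fixes F :: "real \<Rightarrow> complex"
  assumes F: "continuous_on {0..1} F" and \<delta>: "0 < \<delta>" "\<delta> \<le> 1" and e: "0 < e" and \<beta>: "0 < \<beta>"
    and K1: "\<And>t. 0 \<le> t \<Longrightarrow> t \<le> 1 - \<delta> \<Longrightarrow> norm (F t) \<le> K1 * (1 - t) powr (- e - 1)"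
    and K2: "\<And>t. 1 - \<delta> \<le> t \<Longrightarrow> t < 1 \<Longrightarrow> norm (F t) \<le> K2 * (1 - t) powr (\<beta> - 1)"
    and K0: "0 \<le> K1"
  shows "norm (integral {0..1} F) \<le> K1 * \<delta> powr (- e) / e + K2 * \<delta> powr \<beta> / \<beta>"
proof -
  have i1: "((\<lambda>t. K1 * (1 - t) powr (- e - 1)) has_integral K1 * (1 - (1 - \<delta>)) powr (- e) / e - K1 * (1 - 0) powr (- e) / e) {0..1 - \<delta>}"
  proof (rule fundamental_theorem_of_calculus)
    fix t assume "t \<in> {0..1 - \<delta>}"
    then have "0 < 1 - t" using \<delta> by auto
    then have "((\<lambda>t. K1 * (1 - t) powr (- e) / e) has_real_derivative K1 * (1 - t) powr (- e - 1)) (at t)"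
      using e by (auto intro!: derivative_eq_intros simp: powr_diff powr_one_gt_zero_iff field_simps)
    then show "((\<lambda>t. K1 * (1 - t) powr (- e) / e) has_vector_derivative K1 * (1 - t) powr (- e - 1)) (at t within {0..1 - \<delta>})"
      by (simp add: has_real_derivative_iff_has_vector_derivative has_vector_derivative_at_within)
  qed (use \<delta> in auto)
  have i2: "((\<lambda>t. K2 * (1 - t) powr (\<beta> - 1)) has_integral (- K2 * (1 - 1) powr \<beta> / \<beta>) - (- K2 * (1 - (1 - \<delta>)) powr \<beta> / \<beta>)) {1 - \<delta>..1}"
  proof (rule fundamental_theorem_of_calculus_interior)
    show "continuous_on {1 - \<delta>..1} (\<lambda>t. - K2 * (1 - t) powr \<beta> / \<beta>)"
      using \<beta> by (intro continuous_intros continuous_on_powr') auto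
    fix t assume "t \<in> {1 - \<delta><..<1}"
    then have "0 < 1 - t" by auto
    then have "((\<lambda>t. - K2 * (1 - t) powr \<beta> / \<beta>) has_real_derivative K2 * (1 - t) powr (\<beta> - 1)) (at t)"
      using \<beta> by (auto intro!: derivative_eq_intros simp: powr_diff powr_one_gt_zero_iff field_simps)
    then show "((\<lambda>t. - K2 * (1 - t) powr \<beta> / \<beta>) has_vector_derivative K2 * (1 - t) powr (\<beta> - 1)) (at t)"
      by (simp add: has_real_derivative_iff_has_vector_derivative)
  qed (use \<delta> in auto)
  \<comment> \<open>At \<open>t = 1\<close> the power has the default value 0 and would not dominate
    \<open>F 1\<close>, so the comparison function is changed at this single point.\<close>
  have i2': "((\<lambda>t. if t = 1 then norm (F 1) else K2 * (1 - t) powr (\<beta> - 1)) has_integral K2 * \<delta> powr \<beta> / \<beta>) {1 - \<delta>..1}"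
    by (rule has_integral_spike[of "{1}", OF _ _ i2[simplified]]) auto
  have F1: "F integrable_on {0..1 - \<delta>}" "F integrable_on {1 - \<delta>..1}" "F integrable_on {0..1}"
    using \<delta> by (auto intro!: integrable_continuous_real continuous_on_subset[OF F])
  have "integral {0..1} F = integral {0..1 - \<delta>} F + integral {1 - \<delta>..1} F"
    by (rule Henstock_Kurzweil_Integration.integral_combine[symmetric]) (use \<delta> F1 in auto)
  then have "norm (integral {0..1} F) \<le> norm (integral {0..1 - \<delta>} F) + norm (integral {1 - \<delta>..1} F)"
    by (simp add: norm_triangle_ineq)
  also have "norm (integral {0..1 - \<delta>} F) \<le> integral {0..1 - \<delta>} (\<lambda>t. K1 * (1 - t) powr (- e - 1))"
    by (rule integral_norm_bound_integral) (use F1 i1 K1 in auto)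
  also have "\<dots> = K1 * \<delta> powr (- e) / e - K1 / e" using integral_unique[OF i1] by simp
  also have "\<dots> \<le> K1 * \<delta> powr (- e) / e" using K0 e by simp
  also have "norm (integral {1 - \<delta>..1} F) \<le> integral {1 - \<delta>..1} (\<lambda>t. if t = 1 then norm (F 1) else K2 * (1 - t) powr (\<beta> - 1))"
    by (rule integral_norm_bound_integral) (use F1 i2' K2 in auto)
  also have "\<dots> = K2 * \<delta> powr \<beta> / \<beta>" using i2' by (rule integral_unique)
  finally show ?thesis by simp
qed

text \<open>
  Hedberg's interpolation: the growth bound controls the integrand away from \<open>t = 1\<close>, the maximal
  function controls it near \<open>t = 1\<close>, and the splitting point equates the two bounds.
\<close>

lemma hedberg_bound:
  fixes F :: "real \<Rightarrow> complex"
  assumes F: "continuous_on {0..1} F" and a: "0 < a" and b: "0 < b" and \<beta>: "0 < \<beta>" and ab: "a = b + \<beta>"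
    and A: "0 < A" and m: "0 \<le> m" and C: "0 \<le> C"
    and FA: "\<And>t. 0 \<le> t \<Longrightarrow> t < 1 \<Longrightarrow> norm (F t) \<le> C * (A * (1 - t) powr (- a)) * (1 - t) powr (\<beta> - 1)"
    and Fm: "\<And>t. 0 \<le> t \<Longrightarrow> t < 1 \<Longrightarrow> norm (F t) \<le> C * m * (1 - t) powr (\<beta> - 1)"
  shows "norm (integral {0..1} F) \<le> C * (1 / b + 1 / \<beta>) * max A (A powr (1 - b / a) * m powr (b / a))"
proof (cases "m \<le> A")
  case True
  \<comment> \<open>No splitting is profitable here: \<open>\<delta> = 1\<close> shrinks the left
    interval to a point, and the maximal function alone bounds the integrand.\<close>
  have "norm (integral {0..1} F) \<le> (C * A) * 1 powr (- b) / b + (C * m) * 1 powr \<beta> / \<beta>"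
  proof (rule integral_split_power_bound[OF F _ _ b \<beta>])
    fix t :: real assume t: "0 \<le> t" "t \<le> 1 - 1"
    then have "norm (F t) \<le> C * A" using FA[of t] by simp
    then show "norm (F t) \<le> (C * A) * (1 - t) powr (- b - 1)" using t by simp
  qed (use Fm A C in auto)
  also have "\<dots> \<le> C * A / b + C * A / \<beta>"
    using mult_left_mono[OF True C] \<beta> by (simp add: divide_right_mono)
  also have "\<dots> = C * (1 / b + 1 / \<beta>) * A" by (simp add: algebra_simps)
  also have "\<dots> \<le> C * (1 / b + 1 / \<beta>) * max A (A powr (1 - b / a) * m powr (b / a))"
    using C b \<beta> by (intro mult_left_mono) auto
  finally show ?thesis .
next
  case False
  then have m0: "0 < m" "A < m" using A by auto
  \<comment> \<open>Solution of \<open>A * \<delta> powr (- b) = m * \<delta> powr \<beta>\<close>,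
    using \<open>a = b + \<beta>\<close>; it is at most 1 because \<open>A < m\<close>.\<close>
  define \<delta> where "\<delta> = (A / m) powr (1 / a)"
  have \<delta>: "0 < \<delta>" "\<delta> \<le> 1" using A m0 a by (auto simp: \<delta>_def intro!: powr_le1)
  let ?X = "A powr (1 - b / a) * m powr (b / a)"
  have 1: "A * \<delta> powr (- b) = ?X"
  proof -
    have "\<delta> powr (- b) = (A / m) powr (- (b / a))" using A m0 by (simp add: \<delta>_def powr_powr)
    then have "A * \<delta> powr (- b) = A * (A powr (- (b / a)) / m powr (- (b / a)))" using A m0 by (simp add: powr_divide)
    also have "\<dots> = A * A powr (- (b / a)) * m powr (b / a)" using m0 by (simp add: powr_minus field_simps)
    also have "A * A powr (- (b / a)) = A powr (1 - b / a)" using A by (simp add: powr_diff powr_minus field_simps)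
    finally show ?thesis .
  qed
  have 2: "m * \<delta> powr \<beta> = ?X"
  proof -
    have e: "\<beta> / a = 1 - b / a" using ab a by (simp add: field_simps)
    have "\<delta> powr \<beta> = (A / m) powr (1 - b / a)" using A m0 by (simp add: \<delta>_def powr_powr e[symmetric])
    then have "m * \<delta> powr \<beta> = A powr (1 - b / a) * (m / m powr (1 - b / a))" using A m0 by (simp add: powr_divide)
    also have "m / m powr (1 - b / a) = m powr (b / a)" using m0 by (simp add: powr_diff)
    finally show ?thesis .
  qed
  have "norm (integral {0..1} F) \<le> (C * A) * \<delta> powr (- b) / b + (C * m) * \<delta> powr \<beta> / \<beta>"
  proof (rule integral_split_power_bound[OF F \<delta> b \<beta>])
    fix t :: real assume t: "0 \<le> t" "t \<le> 1 - \<delta>"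
    then have "t < 1" using \<delta> by simp
    then have "norm (F t) \<le> C * A * ((1 - t) powr (- a) * (1 - t) powr (\<beta> - 1))" using FA[of t] t by (simp add: mult_ac)
    also have "(1 - t) powr (- a) * (1 - t) powr (\<beta> - 1) = (1 - t) powr (- b - 1)"
      unfolding powr_add[symmetric] by (simp add: ab)
    finally show "norm (F t) \<le> (C * A) * (1 - t) powr (- b - 1)" .
  qed (use Fm A C \<delta> in auto)
  also have "\<dots> = C * (A * \<delta> powr (- b)) / b + C * (m * \<delta> powr \<beta>) / \<beta>" by (simp add: mult_ac)
  also have "\<dots> = C * (1 / b + 1 / \<beta>) * ?X" unfolding 1 2 by (simp add: algebra_simps)
  also have "\<dots> \<le> C * (1 / b + 1 / \<beta>) * max A ?X"
    using C b \<beta> by (intro mult_left_mono) auto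
  finally show ?thesis .
qed

text \<open>The constant depends on \<open>g\<close> only, not on \<open>f\<close>, the dilation or
  the ray. The factor \<open>|z| = s t\<close> in the bound for the radial derivative absorbs
  \<open>1 / t\<close>, and \<open>1 - (s t)^2 \<ge> 1 - t\<close> handles the weight because
  \<alpha> is nonnegative.\<close>

lemma volterra_integrand_bound:
  fixes f g :: "complex^'n \<Rightarrow> complex"
  assumes g: "g \<in> bloch \<alpha>" and \<alpha>: "0 \<le> \<alpha>"
  shows "\<exists>C\<ge>0. \<forall>f\<in>holo_ball. \<forall>s \<zeta>. 0 < s \<and> s < 1 \<and> norm \<zeta> = 1 \<longrightarrow>
    (\<exists>F. continuous_on {0..1} F \<and> volterra g f (s *\<^sub>R \<zeta>) = integral {0..1} F \<and>
      (\<forall>t\<in>{0..<1}. norm (F t) \<le> C * norm (f ((s * t) *\<^sub>R \<zeta>)) * (1 - t) powr (- \<alpha>)))"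
proof -
  have gh: "g \<in> holo_ball" using g \<alpha> by (simp add: bloch_def)
  obtain C where C: "C \<ge> 0" "\<And>z. norm z < 1 \<Longrightarrow> norm (radial_deriv g z) \<le> C * norm z * (1 - (norm z)\<^sup>2) powr (- \<alpha>)"
    using bloch_radial_deriv_bound[OF g \<alpha>] by blast
  show ?thesis
  proof (intro exI[of _ C] conjI ballI allI impI)
    fix f :: "complex^'n \<Rightarrow> complex" and s :: real and \<zeta> :: "complex^'n"
    assume f: "f \<in> holo_ball" and "0 < s \<and> s < 1 \<and> norm \<zeta> = 1"
    then have s: "0 < s" "s < 1" and \<zeta>: "norm \<zeta> = 1" by auto
    obtain s' where s': "s < s'" "s' < 1" using dense s by blast
    have s'0: "0 < s'" using s s' by simp
    have z: "s *\<^sub>R \<zeta> \<in> ball 0 s'" using s s' \<zeta> by simp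
    define F where "F = (\<lambda>t. f (of_real t *s (s *\<^sub>R \<zeta>)) * radial_quot (1 - s') g (s *\<^sub>R \<zeta>) t)"
    note V = volterra_integrand[OF f gh s'0 s'(2) z, folded F_def]
    have pos: "norm (F t) \<le> C * norm (f ((s * t) *\<^sub>R \<zeta>)) * (1 - t) powr (- \<alpha>)" if t: "0 < t" "t < 1" for t
    proof -
      have "radial_quot (1 - s') g (s *\<^sub>R \<zeta>) t = radial_deriv g (of_real t *s (s *\<^sub>R \<zeta>)) / of_real t"
        by (rule radial_quot_props(3)[OF gh s'0 s'(2) z]) (use t in auto)
      moreover have z2: "of_real t *s (s *\<^sub>R \<zeta>) = (s * t) *\<^sub>R \<zeta>"
        by (simp add: scaleR_conv_smult vector_smult_assoc mult.commute)
      ultimately have Ft: "norm (F t) = norm (f ((s * t) *\<^sub>R \<zeta>)) * (norm (radial_deriv g ((s * t) *\<^sub>R \<zeta>)) / t)"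
        using t by (simp add: F_def norm_mult norm_divide)
      have "norm (radial_deriv g ((s * t) *\<^sub>R \<zeta>)) / t \<le> C * (1 - t) powr (- \<alpha>)"
      proof -
        have st: "0 < s * t" "s * t < 1" "s * t \<le> t" using s t mult_strict_mono[of s 1 t 1] by (auto simp: mult_le_cancel_right1)
        have nz: "norm ((s * t) *\<^sub>R \<zeta>) = s * t" using st \<zeta> s t by (simp add: abs_mult)
        have "norm (radial_deriv g ((s * t) *\<^sub>R \<zeta>)) \<le> C * (s * t) * (1 - (s * t)\<^sup>2) powr (- \<alpha>)"
          using C(2)[of "(s * t) *\<^sub>R \<zeta>"] st unfolding nz by simp
        also have "\<dots> \<le> C * t * (1 - t) powr (- \<alpha>)"
        proof (intro mult_mono mult_left_mono)
          have "(s * t)\<^sup>2 \<le> s * t" using st by (simp add: power2_eq_square mult_left_le)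
          then have "1 - t \<le> 1 - (s * t)\<^sup>2" using st by linarith
          then show "(1 - (s * t)\<^sup>2) powr (- \<alpha>) \<le> (1 - t) powr (- \<alpha>)"
            using \<alpha> t by (intro powr_mono2') auto
        qed (use C st t in auto)
        finally show ?thesis using t by (simp add: field_simps)
      qed
      then have "norm (f ((s * t) *\<^sub>R \<zeta>)) * (norm (radial_deriv g ((s * t) *\<^sub>R \<zeta>)) / t)
          \<le> norm (f ((s * t) *\<^sub>R \<zeta>)) * (C * (1 - t) powr (- \<alpha>))"
        by (rule mult_left_mono) simp
      then show ?thesis unfolding Ft by (simp only: mult_ac)
    qed
    \<comment> \<open>The quotient formula for the integrand is available only for
      \<open>t > 0\<close>; both sides are continuous at 0, so the bound persists in the
      limit.\<close>
    have zero: "norm (F 0) \<le> C * norm (f ((s * 0) *\<^sub>R \<zeta>)) * (1 - 0) powr (- \<alpha>)"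
    proof -
      have cf: "continuous_on (ball 0 1) f" using f by (simp add: holo_ball_iff holo_on_imp_continuous_on)
      have "((\<lambda>t. norm (F t)) \<longlongrightarrow> norm (F 0)) (at 0 within {0<..<1})"
        using V(2) by (intro tendsto_norm) (auto simp: continuous_on_def intro: tendsto_within_subset[of F _ 0 "{0..1}"])
      moreover have "((\<lambda>t. C * norm (f ((s * t) *\<^sub>R \<zeta>)) * (1 - t) powr (- \<alpha>)) \<longlongrightarrow> C * norm (f ((s * 0) *\<^sub>R \<zeta>)) * (1 - 0) powr (- \<alpha>)) (at 0 within {0<..<1})"
      proof (intro tendsto_intros)
        have "(f \<longlongrightarrow> f 0) (at 0)" using cf by (auto simp: continuous_on_eq_continuous_at isCont_def)
        moreover have "isCont f 0" using cf by (auto simp: continuous_on_eq_continuous_at)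
        ultimately show "((\<lambda>t. f ((s * t) *\<^sub>R \<zeta>)) \<longlongrightarrow> f ((s * 0) *\<^sub>R \<zeta>)) (at 0 within {0<..<1})"
          by (intro isCont_tendsto_compose[of _ f]) (auto intro!: tendsto_eq_intros)
      qed auto
      moreover have "\<forall>\<^sub>F t in at (0::real) within {0<..<1}. norm (F t) \<le> C * norm (f ((s * t) *\<^sub>R \<zeta>)) * (1 - t) powr (- \<alpha>)"
        unfolding eventually_at_filter by (intro always_eventually allI impI) (use pos in auto)
      moreover have "at (0::real) within {0<..<1} \<noteq> bot"
        by (simp add: at_within_eq_bot_iff closure_greaterThanLessThan) 
      ultimately show ?thesis using tendsto_le by blast
    qed
    show "\<exists>F. continuous_on {0..1} F \<and> volterra g f (s *\<^sub>R \<zeta>) = integral {0..1} F \<and>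
      (\<forall>t\<in>{0..<1}. norm (F t) \<le> C * norm (f ((s * t) *\<^sub>R \<zeta>)) * (1 - t) powr (- \<alpha>))"
    proof (intro exI[of _ F] conjI ballI V)
      fix t :: real assume "t \<in> {0..<1}"
      then show "norm (F t) \<le> C * norm (f ((s * t) *\<^sub>R \<zeta>)) * (1 - t) powr (- \<alpha>)"
        using pos[of t] zero by (cases "t = 0") auto
    qed
  qed (use C in simp)
qed

lemma volterra_0:
  assumes "g \<in> holo_ball" 
  shows "volterra g f 0 = 0"
proof -
  have "radial_deriv g 0 = 0" by (simp add: radial_deriv_def)
  then show ?thesis by (simp add: volterra_def)
qed

text \<open>With \<open>b / a = p / q\<close> the q-th power of Hedberg's bound is affine in the
  radial maximal function of \<open>|f|^p\<close>, whose integral is at most \<open>257 * K\<close>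
  for every dilate. Hence the q-th means are bounded independently of \<open>s\<close>.\<close>

lemma volterra_mem_hardy:
  fixes f g :: "complex^'n \<Rightarrow> complex"
  assumes p: "0 < p" and pq: "p < q" and \<alpha>: "\<alpha> = 1 + real CARD('n) / q - real CARD('n) / p" "0 \<le> \<alpha>"
    and f: "f \<in> hardy p" and g: "g \<in> bloch \<alpha>"
  shows "volterra g f \<in> hardy q"
proof -
  let ?n = "CARD('n)" and ?\<sigma> = "sphere_measure :: (complex^'n) measure"
  have n: "0 < real ?n" by simp
  have q: "0 < q" using p pq by simp
  define a where "a = real ?n / p"
  define b where "b = real ?n / q"
  define \<beta> where "\<beta> = 1 - \<alpha>"
  have b: "0 < b" and a: "0 < a" and ab: "a = b + \<beta>" using p q n \<alpha> by (auto simp: a_def b_def \<beta>_def)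
  have \<beta>: "0 < \<beta>" using p pq n by (simp add: \<beta>_def \<alpha> divide_strict_left_mono)
  have ba: "b / a = p / q" using n p q by (simp add: a_def b_def)
  have fh: "f \<in> holo_ball" using f by (simp add: hardy_def)
  have gh: "g \<in> holo_ball" using g \<alpha>(2) by (simp add: bloch_def)
  have Th: "volterra g f \<in> holo_ball" by (rule volterra_holo_ball[OF fh gh])
  obtain K where K: "K \<ge> 0" "\<And>s. s \<in> {0..<1} \<Longrightarrow> (\<integral>\<^sup>+\<zeta>. ennreal (norm (f (s *\<^sub>R \<zeta>)) powr p) \<partial>?\<sigma>) \<le> ennreal K"
    using f hardy_iff[OF p, of f] by blast
  define C0 where "C0 = 3 * real ?n * 4 ^ ?n * K"
  define A where "A = (C0 + 1) powr (1 / p)"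
  have C0: "0 \<le> C0" using K by (simp add: C0_def)
  have A: "0 < A" using C0 by (simp add: A_def)
  have growth: "norm (f z) \<le> A * (1 - norm z) powr (- a)" if z: "norm z < 1" for z
  proof -
    have d: "0 < 1 - norm z" using z by simp
    have "norm (f z) powr p \<le> C0 / (1 - norm z) ^ ?n"
      unfolding C0_def using hardy_growth[OF fh p z, of K] K by simp
    also have "\<dots> \<le> (C0 + 1) / (1 - norm z) ^ ?n" using d by (intro divide_right_mono) auto
    also have "\<dots> = (C0 + 1) * (1 - norm z) powr (- real ?n)"
      using d by (simp add: powr_minus powr_realpow divide_inverse)
    finally have "(norm (f z) powr p) powr (1 / p) \<le> ((C0 + 1) * (1 - norm z) powr (- real ?n)) powr (1 / p)"
      using p by (intro powr_mono2) auto
    also have "\<dots> = A * (1 - norm z) powr (- a)" by (simp add: powr_mult powr_powr A_def a_def)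
    finally show ?thesis using p by (simp add: powr_powr)
  qed
  obtain C' where C': "C' \<ge> 0" "\<And>s \<zeta>. 0 < s \<Longrightarrow> s < 1 \<Longrightarrow> norm \<zeta> = 1 \<Longrightarrow>
    (\<exists>F. continuous_on {0..1} F \<and> volterra g f (s *\<^sub>R \<zeta>) = integral {0..1} F \<and>
      (\<forall>t\<in>{0..<1}. norm (F t) \<le> C' * norm (f ((s * t) *\<^sub>R \<zeta>)) * (1 - t) powr (- \<alpha>)))"
    using volterra_integrand_bound[OF g \<alpha>(2)] fh by blast
  \<comment> \<open>The added 1, like the one in \<open>A\<close>, keeps the constant positive even
    if the underlying bound vanishes. The pointwise estimate is then trivial where the maximal
    function is infinite.\<close>
  define C where "C = (C' + 1) * (1 / b + 1 / \<beta>)"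
  have C: "0 < C" unfolding C_def using C'(1) b \<beta> by (intro mult_pos_pos add_nonneg_pos) auto
  have T0: "volterra g f (0 *\<^sub>R \<zeta>) = 0" for \<zeta> using volterra_0[OF gh] by simp
  have main: "(\<integral>\<^sup>+\<zeta>. ennreal (norm (volterra g f (s *\<^sub>R \<zeta>)) powr q) \<partial>?\<sigma>)
      \<le> ennreal (C powr q * (A powr q + A powr (q - p) * (257 * K)))" if s: "s \<in> {0..<1}" for s
  proof (cases "s = 0")
    case True
    then show ?thesis by (simp add: volterra_0[OF gh])
  next
    case False
    then have s: "0 < s" "s < 1" using s by auto
    \<comment> \<open>Dilation by \<open>s\<close> makes the function continuous on the closed ball,
      with slices holomorphic on the disc of radius \<open>1 / s\<close>. Its p-th mean on the
      sphere is the mean of \<open>f\<close> at radius \<open>s\<close>.\<close>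
    define fs where "fs = (\<lambda>z. f (s *\<^sub>R z))"
    have f': "holo_on (ball 0 1) f" using fh by (simp add: holo_ball_iff)
    have sm: "s * norm x < 1" if "norm x \<le> 1" for x :: "complex^'n"
    proof -
      have "s * norm x \<le> s" by (rule mult_left_le) (use that s in auto)
      then show ?thesis using s by linarith
    qed
    have cfs: "continuous_on (cball 0 1) fs"
      unfolding fs_def
      by (intro continuous_on_compose2[OF holo_on_imp_continuous_on[OF f']] continuous_intros)
        (use s sm in auto)
    have slice: "(\<lambda>w. fs (w *s \<zeta>)) holomorphic_on ball 0 (1 / s)" if "norm \<zeta> = 1" for \<zeta>
    proof -
      have "(\<lambda>w. f (w *s (of_real s *s \<zeta>))) holomorphic_on ball 0 (1 / s)"
        by (rule slice_holomorphic_0[OF f']) (use s that in \<open>auto simp: field_simps norm_mult\<close>)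
      then show ?thesis by (simp add: fs_def scaleR_conv_smult vector_smult_assoc mult.commute)
    qed
    have Rs: "1 < 1 / s" using s by simp
    note rm = nn_integral_radial_max[OF cfs p Rs slice]
    have pt: "ennreal (norm (volterra g f (s *\<^sub>R \<zeta>)) powr q) \<le>
        ennreal (C powr q) * (ennreal (A powr q) + ennreal (A powr (q - p)) * radial_max p fs \<zeta>)" if \<zeta>: "norm \<zeta> = 1" for \<zeta>
    proof (cases "radial_max p fs \<zeta> = \<infinity>")
      case True
      then show ?thesis using A C by (simp add: ennreal_mult_top)
    next
      case False
      then obtain M where M: "radial_max p fs \<zeta> = ennreal M" "0 \<le> M" by (cases "radial_max p fs \<zeta>") auto
      define m where "m = M powr (1 / p)"
      have fm: "norm (f ((s * t) *\<^sub>R \<zeta>)) \<le> m" if t: "0 \<le> t" "t < 1" for t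
      proof -
        have "ennreal (norm (fs (t *\<^sub>R \<zeta>)) powr p) \<le> ennreal M"
          unfolding M(1)[symmetric] by (rule norm_powr_le_radial_max[OF cfs p t]) (use \<zeta> in simp)
        then have "norm (fs (t *\<^sub>R \<zeta>)) powr p \<le> M" using M by simp
        then have "(norm (fs (t *\<^sub>R \<zeta>)) powr p) powr (1 / p) \<le> m" unfolding m_def using p by (intro powr_mono2) auto
        then show ?thesis using p by (simp add: powr_powr fs_def)
      qed
      obtain F where F: "continuous_on {0..1} F" "volterra g f (s *\<^sub>R \<zeta>) = integral {0..1} F"
        "\<And>t. t \<in> {0..<1} \<Longrightarrow> norm (F t) \<le> C' * norm (f ((s * t) *\<^sub>R \<zeta>)) * (1 - t) powr (- \<alpha>)"
        using C'(2)[OF s \<zeta>] by blast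
      have \<beta>\<alpha>: "\<beta> - 1 = - \<alpha>" by (simp add: \<beta>_def)
      have "norm (integral {0..1} F) \<le> (C' + 1) * (1 / b + 1 / \<beta>) * max A (A powr (1 - b / a) * m powr (b / a))"
      proof (rule hedberg_bound[OF F(1) a b \<beta> ab A])
        fix t :: real assume t: "0 \<le> t" "t < 1"
        have "norm (F t) \<le> C' * norm (f ((s * t) *\<^sub>R \<zeta>)) * (1 - t) powr (- \<alpha>)" using F(3)[of t] t by simp
        also have "\<dots> \<le> (C' + 1) * norm (f ((s * t) *\<^sub>R \<zeta>)) * (1 - t) powr (- \<alpha>)"
          by (intro mult_right_mono) auto
        finally have Ft: "norm (F t) \<le> (C' + 1) * norm (f ((s * t) *\<^sub>R \<zeta>)) * (1 - t) powr (- \<alpha>)" .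
        also have "\<dots> \<le> (C' + 1) * m * (1 - t) powr (- \<alpha>)"
          using fm[OF t] C' by (intro mult_right_mono mult_left_mono) auto
        finally show "norm (F t) \<le> (C' + 1) * m * (1 - t) powr (\<beta> - 1)" by (simp only: \<beta>\<alpha>)
        have st: "s * t \<le> t" "0 \<le> s * t" using s t by (auto simp: mult_left_le_one_le)
        have nz: "norm ((s * t) *\<^sub>R \<zeta>) = s * t" using st \<zeta> s t by (simp add: abs_mult)
        have "norm (f ((s * t) *\<^sub>R \<zeta>)) \<le> A * (1 - s * t) powr (- a)"
          using growth[of "(s * t) *\<^sub>R \<zeta>", unfolded nz] st t by simp
        also have "\<dots> \<le> A * (1 - t) powr (- a)" using A a st t by (intro mult_left_mono powr_mono2') auto
        finally have "(C' + 1) * norm (f ((s * t) *\<^sub>R \<zeta>)) * (1 - t) powr (- \<alpha>) \<le> (C' + 1) * (A * (1 - t) powr (- a)) * (1 - t) powr (- \<alpha>)"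
          using C' by (intro mult_right_mono mult_left_mono) auto
        with Ft show "norm (F t) \<le> (C' + 1) * (A * (1 - t) powr (- a)) * (1 - t) powr (\<beta> - 1)" unfolding \<beta>\<alpha> by linarith
      qed (use C' in \<open>auto simp: m_def\<close>)
      then have "norm (volterra g f (s *\<^sub>R \<zeta>)) \<le> C * max A (A powr (1 - p / q) * m powr (p / q))"
        unfolding F(2) C_def ba .
      then have "norm (volterra g f (s *\<^sub>R \<zeta>)) powr q \<le> (C * max A (A powr (1 - p / q) * m powr (p / q))) powr q"
        using q by (intro powr_mono2) auto
      also have "\<dots> = C powr q * (max A (A powr (1 - p / q) * m powr (p / q))) powr q"
        by (rule powr_mult)
      also have "\<dots> \<le> C powr q * (A powr q + A powr (q - p) * M)"
      proof (rule mult_left_mono)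
        have "(A powr (1 - p / q) * m powr (p / q)) powr q = A powr (q - p) * M"
          using p q M by (simp add: powr_mult powr_powr m_def left_diff_distrib)
        then show "(max A (A powr (1 - p / q) * m powr (p / q))) powr q \<le> A powr q + A powr (q - p) * M"
          using M by (auto simp: max_def)
      qed simp
      finally have "ennreal (norm (volterra g f (s *\<^sub>R \<zeta>)) powr q) \<le> ennreal (C powr q * (A powr q + A powr (q - p) * M))"
        by (rule ennreal_leI)
      then show ?thesis using M by (simp add: ennreal_mult ennreal_plus)
    qed
    have "(\<integral>\<^sup>+\<zeta>. ennreal (norm (volterra g f (s *\<^sub>R \<zeta>)) powr q) \<partial>?\<sigma>)
       \<le> (\<integral>\<^sup>+\<zeta>. ennreal (C powr q) * (ennreal (A powr q) + ennreal (A powr (q - p)) * radial_max p fs \<zeta>) \<partial>?\<sigma>)"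
      by (rule nn_integral_mono) (use pt in simp)
    also have "\<dots> = ennreal (C powr q) * (ennreal (A powr q) + ennreal (A powr (q - p)) * (\<integral>\<^sup>+\<zeta>. radial_max p fs \<zeta> \<partial>?\<sigma>))"
      using rm(2) by (simp add: nn_integral_cmult nn_integral_add)
    also have "\<dots> \<le> ennreal (C powr q) * (ennreal (A powr q) + ennreal (A powr (q - p)) * (257 * ennreal K))"
    proof (intro mult_left_mono add_left_mono)
      have "(\<integral>\<^sup>+\<zeta>. radial_max p fs \<zeta> \<partial>?\<sigma>) \<le> 257 * (\<integral>\<^sup>+\<zeta>. ennreal (norm (fs \<zeta>) powr p) \<partial>?\<sigma>)" by (rule rm(1))
      also have "\<dots> \<le> 257 * ennreal K" using K(2)[of s] s by (intro mult_left_mono) (auto simp: fs_def)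
      finally show "(\<integral>\<^sup>+\<zeta>. radial_max p fs \<zeta> \<partial>?\<sigma>) \<le> 257 * ennreal K" .
    qed auto
    also have "\<dots> = ennreal (C powr q * (A powr q + A powr (q - p) * (257 * K)))"
      using K by (simp add: ennreal_mult ennreal_plus)
    finally show ?thesis .
  qed
  show ?thesis unfolding hardy_iff[OF q]
  proof (intro conjI exI ballI)
    show "0 \<le> C powr q * (A powr q + A powr (q - p) * (257 * K))" using K by auto
  qed (use Th main in auto)
qed

section \<open>A logarithmically perturbed singularity\<close>

text \<open>The nonisotropic (Koranyi) ball around the unit vector of axis \<open>k\<close>.
  Nearness of \<open>\<zeta> $ k\<close> to 1 within \<open>d\<close> restricts the remaining
  coordinates to size of order \<open>sqrt d\<close>, so the measure has order
  \<open>d^n\<close>.\<close>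

definition cap :: "'n \<Rightarrow> real \<Rightarrow> (complex^'n) set" where
  "cap k d = {\<zeta> \<in> sphere 0 1. norm (1 - \<zeta> $ k) \<le> d}"

lemma closed_cap:
  fixes k :: "'n::finite"
  shows "closed (cap k d)"
proof -
  have "cap k d = sphere 0 1 \<inter> {\<zeta> :: (complex, 'n) vec. norm (1 - vec_nth \<zeta> k) \<le> d}" by (auto simp: cap_def)
  moreover have "closed {\<zeta> :: (complex, 'n) vec. norm (1 - vec_nth \<zeta> k) \<le> d}"
    by (intro closed_Collect_le continuous_intros)
  ultimately show ?thesis by (simp add: closed_Int)
qed

lemma cap_subset_sphere: "cap k d \<subseteq> sphere 0 1"
  by (auto simp: cap_def)

lemma cap_borel [measurable]: "cap k d \<in> sets borel"
  using closed_cap by (rule borel_closed)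

lemma cap_sets: "cap k d \<in> sets sphere_measure"
proof -
  have "cap k d \<in> sets (restrict_space borel (sphere 0 1))"
    unfolding sets_restrict_space
    by (rule image_eqI[of _ _ "cap k d", OF _ cap_borel]) (auto simp: cap_def)
  then show ?thesis by (simp add: sets_sphere_measure)
qed

text \<open>Normalizing moves the \<open>k\<close>-th coordinate by at most \<open>1 - |z|\<close>;
  this relates points of a thin shell to the cap containing their directions.\<close>

lemma norm_1_minus_normalized:
  fixes z :: "complex^'n"
  assumes z: "z \<noteq> 0" "norm z \<le> 1"
  shows "norm (1 - (z /\<^sub>R norm z) $ k) \<le> norm (1 - z $ k) + (1 - norm z)"
    and "norm (1 - z $ k) \<le> norm (1 - (z /\<^sub>R norm z) $ k) + (1 - norm z)"
proof -
  let ?u = "(z /\<^sub>R norm z) $ k"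
  have nz: "0 < norm z" using z by simp
  have zk: "z $ k = of_real (norm z) * ?u" using nz by (simp add: scaleR_conv_of_real[where 'a=complex])
  have "norm ?u \<le> norm (z /\<^sub>R norm z)" by (rule Finite_Cartesian_Product.norm_nth_le)
  then have u: "norm ?u \<le> 1" using nz by simp
  have "?u - z $ k = of_real (1 - norm z) * ?u" unfolding zk by (simp add: algebra_simps)
  then have "norm (?u - z $ k) = (1 - norm z) * norm ?u" using z by (simp only: norm_mult norm_of_real)
  also have "\<dots> \<le> (1 - norm z) * 1" using u z by (intro mult_left_mono) auto
  finally have d: "norm (?u - z $ k) \<le> 1 - norm z" by simp
  show "norm (1 - ?u) \<le> norm (1 - z $ k) + (1 - norm z)"
    using norm_triangle_ineq[of "1 - z $ k" "z $ k - ?u"] d by (simp add: norm_minus_commute)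
  show "norm (1 - z $ k) \<le> norm (1 - ?u) + (1 - norm z)"
    using norm_triangle_ineq[of "1 - ?u" "?u - z $ k"] d by simp
qed

lemma emeasure_aniso_image_le:
  fixes S Q :: "(complex^'n) set"
  assumes ab: "0 < a" "0 < b" and S[measurable]: "S \<in> sets borel" and Q[measurable]: "Q \<in> sets borel"
    and sub: "\<And>w. t + aniso k a b w \<in> S \<Longrightarrow> w \<in> Q"
  shows "emeasure lborel S \<le> ennreal (a ^ 2 * b ^ (2 * (CARD('n) - 1))) * emeasure lborel Q"
proof -
  have "emeasure lborel S = (\<integral>\<^sup>+x. indicator S x \<partial>lborel)" by simp
  also have "\<dots> = ennreal (a ^ 2 * b ^ (2 * (CARD('n) - 1))) * (\<integral>\<^sup>+w. indicator S (t + aniso k a b w) \<partial>lborel)"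
    by (rule nn_integral_aniso[OF ab]) measurable
  also have "\<dots> \<le> ennreal (a ^ 2 * b ^ (2 * (CARD('n) - 1))) * (\<integral>\<^sup>+w. indicator Q w \<partial>lborel)"
    by (intro mult_left_mono nn_integral_mono) (auto simp: indicator_def dest: sub)
  finally show ?thesis by simp
qed

lemma emeasure_aniso_image_ge:
  fixes S Q :: "(complex^'n) set"
  assumes ab: "0 < a" "0 < b" and S[measurable]: "S \<in> sets borel" and Q[measurable]: "Q \<in> sets borel"
    and sub: "\<And>w. w \<in> Q \<Longrightarrow> t + aniso k a b w \<in> S"
  shows "ennreal (a ^ 2 * b ^ (2 * (CARD('n) - 1))) * emeasure lborel Q \<le> emeasure lborel S"
proof -
  have "ennreal (a ^ 2 * b ^ (2 * (CARD('n) - 1))) * (\<integral>\<^sup>+w. indicator Q w \<partial>lborel)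
    \<le> ennreal (a ^ 2 * b ^ (2 * (CARD('n) - 1))) * (\<integral>\<^sup>+w. indicator S (t + aniso k a b w) \<partial>lborel)"
    by (intro mult_left_mono nn_integral_mono) (auto simp: indicator_def dest: sub)
  also have "\<dots> = (\<integral>\<^sup>+x. indicator S x \<partial>lborel)"
    by (rule nn_integral_aniso[OF ab, symmetric]) measurable
  finally show ?thesis by simp
qed

text \<open>The part of the cone over the cap with \<open>|z| > 1 - d\<close> lies in an ellipsoid
  with axes of order \<open>d\<close> and \<open>sqrt d\<close>: \<open>|1 - z_k| \<le> 2d\<close>
  forces \<open>|z_i|^2 \<le> 1 - |z_k|^2 \<le> 4d\<close> for the other coordinates. Its volume is
  at least \<open>d\<close> times the measure of the cap, up to the volume of the ball. For
  \<open>d > 1\<close> total mass 1 suffices, as \<open>C \<ge> 1\<close>.\<close>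

lemma emeasure_cap_le:
  "\<exists>C\<ge>1. \<forall>d>0. emeasure sphere_measure (cap (k::'n::finite) d) \<le> ennreal (C * d ^ CARD('n))"
proof -
  let ?n = "CARD('n)"
  let ?\<sigma> = "sphere_measure :: (complex^'n) measure"
  have n: "1 \<le> ?n" by (simp add: Suc_leI)
  \<comment> \<open>All rescaled coordinates have modulus at most 1, so the norm is at most
    \<open>n\<close>; the ball is open, hence the extra 1.\<close>
  define Q where "Q = ball (0::complex^'n) (real ?n + 1)"
  have "emeasure lborel Q \<noteq> \<infinity>" using emeasure_lborel_ball_finite[of "0::complex^'n" "real ?n + 1"] by (auto simp: Q_def)
  then obtain B where B: "emeasure lborel Q = ennreal B" "0 \<le> B" by (cases "emeasure lborel Q") auto
  obtain V where V: "emeasure lborel (ball (0::complex^'n) 1) = ennreal V" "0 < V" by (rule emeasure_unit_ball_ennreal)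
  define C where "C = max 1 (4 ^ ?n * B / V)"
  show ?thesis
  proof (intro exI[of _ C] conjI allI impI)
    fix d :: real assume d: "0 < d"
    have s1: "emeasure ?\<sigma> (cap k d) \<le> 1"
      using emeasure_space[of ?\<sigma> "cap k d"] by simp
    show "emeasure ?\<sigma> (cap k d) \<le> ennreal (C * d ^ ?n)"
    proof (cases "d \<le> 1")
      case False
      have "1 * 1 \<le> C * d ^ ?n" using False by (intro mult_mono) (auto simp: C_def one_le_power)
      then have "ennreal 1 \<le> ennreal (C * d ^ ?n)" by (intro ennreal_leI) simp
      then show ?thesis using s1 by (metis ennreal_1 order_trans)
    next
      case True
      define S where "S = {z::complex^'n. 1 - d < norm z \<and> norm z < 1 \<and> z /\<^sub>R norm z \<in> cap k d}"
      have [measurable]: "S \<in> sets borel" unfolding S_def by measurable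
      have e1: "emeasure lborel S \<le> ennreal ((2 * d) ^ 2 * (2 * sqrt d) ^ (2 * (?n - 1))) * emeasure lborel Q"
      proof (rule emeasure_aniso_image_le[where t = "axis k 1" and k = k])
        fix w assume zS: "axis k 1 + aniso k (2 * d) (2 * sqrt d) w \<in> S"
        define z where "z = axis k 1 + aniso k (2 * d) (2 * sqrt d) w"
        have z: "1 - d < norm z" "norm z < 1" "norm (1 - (z /\<^sub>R norm z) $ k) \<le> d"
          using zS by (auto simp: S_def z_def[symmetric] cap_def)
        have z0: "z \<noteq> 0" using z(1) True by auto
        have zk: "norm (1 - z $ k) \<le> 2 * d" using norm_1_minus_normalized(2)[OF z0, of k] z by simp
        have wi: "norm (w $ i) \<le> 1" for i
        proof (cases "i = k")
          case True
          have "z $ k = 1 + of_real (2 * d) * w $ k" by (simp add: z_def aniso_def axis_def)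
          then have "norm (1 - z $ k) = 2 * d * norm (w $ k)" using d by (simp add: norm_mult)
          then show ?thesis using zk d True by simp
        next
          case False
          have "(norm (z $ k))\<^sup>2 + (norm (z $ i))\<^sup>2 = (\<Sum>j\<in>{k, i}. (norm (z $ j))\<^sup>2)" using False by simp
          also have "\<dots> \<le> (norm z)\<^sup>2" unfolding norm_vec_power2 by (rule sum_mono2) auto
          also have "\<dots> \<le> 1" using z by (simp add: power_le_one)
          finally have s: "(norm (z $ i))\<^sup>2 \<le> 1 - (norm (z $ k))\<^sup>2" by simp
          have zk1: "1 - 2 * d \<le> norm (z $ k)"
            using norm_triangle_ineq2[of 1 "1 - z $ k"] zk by simp
          have zk2: "norm (z $ k) \<le> 1" using Finite_Cartesian_Product.norm_nth_le[of z k] z by simp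
          have "1 - (norm (z $ k))\<^sup>2 = (1 - norm (z $ k)) * (1 + norm (z $ k))" by (simp add: power2_eq_square algebra_simps)
          also have "\<dots> \<le> (2 * d) * 2" using zk1 zk2 d by (intro mult_mono) auto
          finally have "(norm (z $ i))\<^sup>2 \<le> (2 * sqrt d)\<^sup>2" using s d by (simp add: power_mult_distrib)
          then have zi: "norm (z $ i) \<le> 2 * sqrt d" by (rule power2_le_imp_le) (use d in simp)
          have "z $ i = of_real (2 * sqrt d) * w $ i" using False by (simp add: z_def aniso_def axis_def)
          then have "norm (z $ i) = 2 * sqrt d * norm (w $ i)" using d by (simp add: norm_mult)
          then show ?thesis using zi d by simp
        qed
        have "norm w \<le> (\<Sum>i\<in>UNIV. norm (w $ i))" unfolding norm_vec_def by (rule L2_set_le_sum) simp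
        also have "\<dots> \<le> (\<Sum>i\<in>(UNIV::'n set). 1)" by (intro sum_mono wi)
        finally show "w \<in> Q" by (simp add: Q_def)
      qed (use d in \<open>auto simp: Q_def\<close>)
      have e2: "emeasure lborel S = ennreal (1 - (1 - d) ^ DIM(complex^'n)) * emeasure ?\<sigma> (cap k d) * ennreal V"
        unfolding S_def V(1)[symmetric] by (rule emeasure_shell_cone[OF cap_borel cap_subset_sphere]) (use d True in auto)
      obtain x where x: "emeasure ?\<sigma> (cap k d) = ennreal x" "0 \<le> x"
        using s1 by (cases "emeasure ?\<sigma> (cap k d)") (auto simp: top_unique)
      \<comment> \<open>This gives \<open>1 - (1 - d)^(2n) \<ge> d\<close>, the lower bound for the
        radial mass of the shell.\<close>
      have le1: "(1 - d) ^ (2 * ?n) \<le> (1 - d) ^ 1" using d True n by (intro power_decreasing) auto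
      have dt: "(2 * d) ^ 2 * (2 * sqrt d) ^ (2 * (?n - 1)) = d * (d ^ ?n * 4 ^ ?n)"
      proof -
        have "(2 * sqrt d) ^ (2 * (?n - 1)) = (4 * d) ^ (?n - 1)" using d by (simp add: power_mult power_mult_distrib)
        then have "(2 * d) ^ 2 * (2 * sqrt d) ^ (2 * (?n - 1)) = d * ((4 * d) * (4 * d) ^ (?n - 1))"
          by (simp add: power2_eq_square)
        also have "(4 * d) * (4 * d) ^ (?n - 1) = (4 * d) ^ ?n" using n by (simp add: power_eq_if)
        finally show ?thesis by (simp add: power_mult_distrib)
      qed
      have p0: "0 \<le> 1 - (1 - d) ^ (2 * ?n)" using le1 d by simp
      define P where "P = 1 - (1 - d) ^ (2 * ?n)"
      define D where "D = d * (d ^ ?n * 4 ^ ?n)"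
      have "ennreal P * ennreal x * ennreal V \<le> ennreal D * ennreal B"
        using e1 unfolding e2 dt B(1) x(1) DIM_complex_vec P_def D_def .
      then have "ennreal (P * x * V) \<le> ennreal (D * B)"
        using V B(2) x(2) p0 d by (simp add: ennreal_mult P_def[symmetric] D_def)
      then have "ennreal ((1 - (1 - d) ^ (2 * ?n)) * x * V) \<le> ennreal (d * (d ^ ?n * 4 ^ ?n) * B)"
        unfolding P_def D_def .
      then have "(1 - (1 - d) ^ (2 * ?n)) * x * V \<le> d * (d ^ ?n * 4 ^ ?n) * B"
        using B d by (simp add: ennreal_le_iff)
      moreover have "d * x * V \<le> (1 - (1 - d) ^ (2 * ?n)) * x * V"
        using le1 x V by (intro mult_right_mono) auto
      ultimately have "d * (x * V) \<le> d * (d ^ ?n * 4 ^ ?n * B)" by (simp add: mult_ac)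
      then have "x * V \<le> d ^ ?n * 4 ^ ?n * B" using d by simp
      then have "x \<le> (4 ^ ?n * B / V) * d ^ ?n" using V by (simp add: field_simps)
      also have "\<dots> \<le> C * d ^ ?n" using d by (intro mult_right_mono) (auto simp: C_def)
      finally show ?thesis using x by (simp add: ennreal_leI)
    qed
  qed (simp add: C_def)
qed

text \<open>The ellipsoid of the growth estimate, now with \<open>\<delta> = d / 3\<close>: its
  points have \<open>|1 - z_k| \<le> 3\<delta>/2\<close> and \<open>1 - |z| < 3\<delta>/2\<close>,
  so their directions lie in the cap of radius \<open>3\<delta> = d\<close>. The constant collects
  \<open>3n\<close> from the shell, \<open>4^n\<close> from the Jacobian and \<open>3^n\<close> from
  \<open>d = 3\<delta>\<close>.\<close>

lemma emeasure_cap_ge: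
  "\<exists>c>0. \<forall>d>0. d \<le> 1 \<longrightarrow> ennreal (c * d ^ CARD('n)) \<le> emeasure sphere_measure (cap (k::'n::finite) d)"
proof -
  let ?n = "CARD('n)"
  let ?\<sigma> = "sphere_measure :: (complex^'n) measure"
  obtain V where V: "emeasure lborel (ball (0::complex^'n) 1) = ennreal V" "0 < V" by (rule emeasure_unit_ball_ennreal)
  show ?thesis
  proof (intro exI[of _ "1 / (3 * ?n * 12 ^ ?n)"] conjI allI impI)
    fix d :: real assume d: "0 < d" "d \<le> 1"
    define \<delta> where "\<delta> = d / 3"
    have \<delta>: "0 < \<delta>" "\<delta> \<le> 1" "d = 3 * \<delta>" "\<delta> \<le> 1 / 3" using d by (auto simp: \<delta>_def)
    define s where "s = 1 - 3 * \<delta> / 2"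
    have s: "0 \<le> s" "s < 1" using \<delta> by (auto simp: s_def)
    define S where "S = {z::complex^'n. s < norm z \<and> norm z < 1 \<and> z /\<^sub>R norm z \<in> cap k d}"
    have [measurable]: "S \<in> sets borel" unfolding S_def by measurable
    have e1: "ennreal ((\<delta> / 2) ^ 2 * (sqrt \<delta> / 2) ^ (2 * (?n - 1))) * emeasure lborel (ball (0::complex^'n) 1) \<le> emeasure lborel S"
    proof (rule emeasure_aniso_image_ge[where t = "axis k (of_real (1 - \<delta>))" and k = k])
      fix w :: "complex^'n" assume "w \<in> ball 0 1"
      then have w: "norm w < 1" by simp
      define z where "z = axis k (of_real (1 - \<delta>)) + aniso k (\<delta> / 2) (sqrt \<delta> / 2) w"
      have z: "s < norm z" "norm z < 1" "norm (1 - z $ k) \<le> 3 * \<delta> / 2"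
        using aniso_ball_shell[OF \<delta>(1,2) w, of k] by (auto simp: z_def s_def)
      have z0: "z \<noteq> 0" using z(1) s by auto
      have "norm (1 - (z /\<^sub>R norm z) $ k) \<le> d"
        using norm_1_minus_normalized(1)[OF z0, of k] z \<delta> by (simp add: s_def)
      then have "z \<in> S" using z z0 by (simp add: S_def cap_def)
      then show "axis k (of_real (1 - \<delta>)) + aniso k (\<delta> / 2) (sqrt \<delta> / 2) w \<in> S" by (simp add: z_def)
    qed (use \<delta> in auto)
    have e2: "emeasure lborel S = ennreal (1 - s ^ DIM(complex^'n)) * emeasure ?\<sigma> (cap k d) * ennreal V"
      unfolding S_def V(1)[symmetric] by (rule emeasure_shell_cone[OF cap_borel cap_subset_sphere s])
    have s1: "emeasure ?\<sigma> (cap k d) \<le> 1"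
      using emeasure_space[of ?\<sigma> "cap k d"] by simp
    obtain x where x: "emeasure ?\<sigma> (cap k d) = ennreal x" "0 \<le> x"
      using s1 by (cases "emeasure ?\<sigma> (cap k d)") (auto simp: top_unique)
    have le1: "1 - s ^ (2 * ?n) \<le> 3 * ?n * \<delta>"
    proof -
      have "1 + real (2 * ?n) * (s - 1) \<le> (1 + (s - 1)) ^ (2 * ?n)"
        by (rule Bernoulli_inequality) (use s in simp)
      then show ?thesis by (simp add: s_def algebra_simps)
    qed
    have p0: "0 \<le> 1 - s ^ (2 * ?n)" using s by (simp add: power_le_one)
    define P where "P = 1 - s ^ (2 * ?n)"
    define D where "D = \<delta> * \<delta> ^ ?n / 4 ^ ?n"
    have D0: "0 \<le> D" using \<delta> by (simp add: D_def)
    have "ennreal D * ennreal V \<le> ennreal P * ennreal x * ennreal V"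
      using e1 unfolding e2 aniso_det[OF less_imp_le[OF \<delta>(1)]] V(1) x(1) DIM_complex_vec P_def D_def .
    then have "ennreal (D * V) \<le> ennreal (P * x * V)"
      using V(2) x(2) p0 D0 by (simp add: ennreal_mult P_def[symmetric])
    then have "ennreal (\<delta> * \<delta> ^ ?n / 4 ^ ?n * V) \<le> ennreal ((1 - s ^ (2 * ?n)) * x * V)"
      unfolding P_def D_def .
    then have "\<delta> * \<delta> ^ ?n / 4 ^ ?n * V \<le> (1 - s ^ (2 * ?n)) * x * V"
      using V p0 x by (simp add: ennreal_le_iff)
    also have "\<dots> \<le> (3 * ?n * \<delta>) * x * V" using le1 x V by (intro mult_right_mono) auto
    finally have "\<delta> * (\<delta> ^ ?n / 4 ^ ?n) * V \<le> \<delta> * (3 * ?n * x) * V" by (simp add: mult_ac)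
    from mult_left_le_imp_le[OF mult_right_le_imp_le[OF this V(2)] \<delta>(1)]
    have "\<delta> ^ ?n / 4 ^ ?n \<le> 3 * ?n * x" .
    then have "\<delta> ^ ?n / 4 ^ ?n / (3 * ?n) \<le> x" by (simp add: field_simps)
    also have "\<delta> ^ ?n / 4 ^ ?n / (3 * ?n) = 1 / (3 * ?n * 12 ^ ?n) * d ^ ?n"
    proof -
      have "d ^ ?n = 3 ^ ?n * \<delta> ^ ?n" using \<delta> by (simp add: power_mult_distrib)
      moreover have "(12::real) ^ ?n = 3 ^ ?n * 4 ^ ?n" by (simp flip: power_mult_distrib)
      ultimately show ?thesis by simp
    qed
    finally show "ennreal (1 / (3 * ?n * 12 ^ ?n) * d ^ ?n) \<le> emeasure ?\<sigma> (cap k d)"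
      using x by (simp add: ennreal_leI)
  qed simp
qed

section \<open>The singular function and the size of its modulus\<close>

lemma holo_ball_coordinate:
  assumes h: "h holomorphic_on ball 0 1"
  shows "(\<lambda>z :: complex^'n. h (z $ k)) \<in> holo_ball"
  unfolding holo_ball_def
proof (intro CollectI ballI)
  fix z :: "complex^'n" assume "z \<in> ball 0 1"
  then have zk: "z $ k \<in> ball 0 1"
    using Finite_Cartesian_Product.norm_nth_le[of z k] by simp
  have "(h has_field_derivative deriv h (z $ k)) (at (z $ k))"
    by (rule holomorphic_derivI[OF h _ zk]) auto
  then have 1: "(h has_derivative (*) (deriv h (z $ k))) (at (z $ k))"
    by (simp add: has_field_derivative_def)
  have "((\<lambda>z. z $ k) has_derivative (\<lambda>z. z $ k)) (at z)"
    by (intro bounded_linear_imp_has_derivative bounded_linear_vec_nth)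
  from has_derivative_compose[OF this 1]
  show "\<exists>D. ((\<lambda>z. h (z $ k)) has_derivative D) (at z) \<and> (\<forall>c v. D (c *s v) = c * D v)"
    by (intro exI conjI) auto
qed

text \<open>Real model for the modulus of the singular function at distance \<open>u\<close> from
  the singularity. The offset \<open>L\<close> keeps \<open>L - ln u\<close> positive on the range
  \<open>u \<le> 2\<close> that occurs.\<close>

definition power_log :: "real \<Rightarrow> real \<Rightarrow> real \<Rightarrow> real \<Rightarrow> real" where
  "power_log L e \<kappa> u = u powr (- e) * (L - ln u) powr (- \<kappa>)"

lemma power_log_nonneg: "0 \<le> power_log L e \<kappa> u"
  by (simp add: power_log_def)

text \<open>The derivative of the logarithm of this function in \<open>ln u\<close> is
  \<open>- e + \<kappa> / (L - ln u)\<close>, so the power beats the logarithmic factor once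
  \<open>L\<close> is large. The condition at the larger point \<open>v\<close> suffices, as
  \<open>L - ln u\<close> grows when \<open>u\<close> decreases.\<close>

lemma power_log_antimono:
  assumes u: "0 < u" "u \<le> v" and L: "0 < L - ln v" and \<kappa>: "0 \<le> \<kappa>" "\<kappa> \<le> e * (L - ln v)"
  shows "power_log L e \<kappa> v \<le> power_log L e \<kappa> u"
proof -
  have v: "0 < v" using u by simp
  have luv: "ln u \<le> ln v" using u by simp
  have Lu: "0 < L - ln u" using L luv by simp
  have "ln (L - ln u) - ln (L - ln v) = ln ((L - ln u) / (L - ln v))" using L Lu by (simp add: ln_div)
  also have "\<dots> \<le> (L - ln u) / (L - ln v) - 1" using L Lu by (intro ln_le_minus_one) simp
  also have "\<dots> = (ln v - ln u) / (L - ln v)" using L by (simp add: field_simps)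
  finally have "\<kappa> * (ln (L - ln u) - ln (L - ln v)) \<le> \<kappa> * ((ln v - ln u) / (L - ln v))"
    using \<kappa> by (intro mult_left_mono) auto
  also have "\<dots> = (\<kappa> / (L - ln v)) * (ln v - ln u)" by simp
  also have "\<dots> \<le> e * (ln v - ln u)"
    using \<kappa> L luv by (intro mult_right_mono) (auto simp: field_simps)
  finally have "- e * ln v - \<kappa> * ln (L - ln v) \<le> - e * ln u - \<kappa> * ln (L - ln u)" by (simp add: algebra_simps)
  then have "exp (- e * ln v - \<kappa> * ln (L - ln v)) \<le> exp (- e * ln u - \<kappa> * ln (L - ln u))" by simp
  then show ?thesis using u v L Lu by (simp add: power_log_def powr_def exp_diff exp_minus divide_inverse)
qed

definition log_singular :: "real \<Rightarrow> real \<Rightarrow> real \<Rightarrow> 'n \<Rightarrow> complex^'n \<Rightarrow> complex" where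
  "log_singular a \<kappa> L k z = exp (- of_real a * Ln (1 - z $ k) - of_real \<kappa> * Ln (of_real L - Ln (1 - z $ k)))"

text \<open>\<open>Re (1 - w) > 0\<close> and \<open>ln |1 - w| \<le> ln 2 < 1 \<le> L\<close> keep
  the arguments of both logarithms off the cut. The imaginary part of the inner logarithm is below
  \<open>pi / 2 < 2\<close>, which accounts for the offset \<open>L + 2\<close> in the upper
  bound.\<close>

lemma Re_log_pos:
  assumes w: "norm w < 1" and L: "1 \<le> L"
  shows "1 - w \<notin> \<real>\<^sub>\<le>\<^sub>0" "of_real L - Ln (1 - w) \<notin> \<real>\<^sub>\<le>\<^sub>0"
    "L - ln (norm (1 - w)) \<le> norm (of_real L - Ln (1 - w))"
    "norm (of_real L - Ln (1 - w)) \<le> L + 2 - ln (norm (1 - w))"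
    "0 < L - ln (norm (1 - w))" "0 < norm (1 - w)" "norm (1 - w) \<le> 2"
proof -
  have Re: "0 < Re (1 - w)" using complex_Re_le_cmod[of w] w by simp
  then show "1 - w \<notin> \<real>\<^sub>\<le>\<^sub>0" by (auto simp: complex_nonpos_Reals_iff)
  have nz: "1 - w \<noteq> 0" using Re by auto
  then show n0: "0 < norm (1 - w)" by simp
  show n2: "norm (1 - w) \<le> 2" using norm_triangle_ineq4[of 1 w] w by simp
  have "ln (norm (1 - w)) \<le> ln 2" using n0 n2 by simp
  also have "\<dots> < 1" using ln_2_less_1 .
  finally show l: "0 < L - ln (norm (1 - w))" using L by simp
  have R: "Re (of_real L - Ln (1 - w)) = L - ln (norm (1 - w))" using nz by simp
  then show "of_real L - Ln (1 - w) \<notin> \<real>\<^sub>\<le>\<^sub>0" using l by (auto simp: complex_nonpos_Reals_iff)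
  show "L - ln (norm (1 - w)) \<le> norm (of_real L - Ln (1 - w))"
    using complex_Re_le_cmod[of "of_real L - Ln (1 - w)"] R by simp
  have "\<bar>Im (Ln (1 - w))\<bar> < pi / 2" by (rule Re_Ln_pos_lt_imp[OF Re])
  then have "\<bar>Im (of_real L - Ln (1 - w))\<bar> \<le> 2" using pi_less_4 by simp
  then show "norm (of_real L - Ln (1 - w)) \<le> L + 2 - ln (norm (1 - w))"
    using cmod_le[of "of_real L - Ln (1 - w)"] R l by simp
qed

lemma log_singular_holo_ball:
  assumes L: "1 \<le> L"
  shows "log_singular a \<kappa> L k \<in> holo_ball"
proof -
  have "(\<lambda>w. exp (- of_real a * Ln (1 - w) - of_real \<kappa> * Ln (of_real L - Ln (1 - w)))) holomorphic_on ball 0 1"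
    by (intro holomorphic_intros) (use Re_log_pos(1,2)[OF _ L] in auto)
  from holo_ball_coordinate[OF this, of k] show ?thesis
    by (simp add: log_singular_def[abs_def])
qed

text \<open>The real exponents make the modulus depend only on \<open>|1 - z_k|\<close> and on the
  modulus of the inner logarithmic term. Replacing \<open>L\<close> by \<open>L + 2\<close> absorbs
  the imaginary part of that term.\<close>

lemma norm_log_singular:
  fixes z :: "complex^'n"
  assumes z: "norm z < 1" and L: "1 \<le> L" and \<kappa>: "0 \<le> \<kappa>"
  shows "norm (log_singular a \<kappa> L k z) \<le> power_log L a \<kappa> (norm (1 - z $ k))"
    and "power_log (L + 2) a \<kappa> (norm (1 - z $ k)) \<le> norm (log_singular a \<kappa> L k z)"
proof -
  have zk: "norm (z $ k) < 1" using z Finite_Cartesian_Product.norm_nth_le[of z k] by simp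
  note R = Re_log_pos[OF zk L]
  define u where "u = norm (1 - z $ k)"
  define \<Lambda> where "\<Lambda> = of_real L - Ln (1 - z $ k)"
  have \<Lambda>: "L - ln u \<le> norm \<Lambda>" "norm \<Lambda> \<le> L + 2 - ln u" "0 < L - ln u" "0 < u"
    using R by (auto simp: u_def \<Lambda>_def)
  have nz: "1 - z $ k \<noteq> 0" "\<Lambda> \<noteq> 0" using \<Lambda> by (auto simp: u_def)
  have "norm (log_singular a \<kappa> L k z) = exp (- a * ln u - \<kappa> * ln (norm \<Lambda>))"
    unfolding log_singular_def norm_exp_eq_Re \<Lambda>_def[symmetric] using nz by (simp add: u_def)
  also have "\<dots> = u powr (- a) * norm \<Lambda> powr (- \<kappa>)"
    using \<Lambda> nz by (simp add: powr_def exp_diff exp_minus divide_inverse)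
  finally have N: "norm (log_singular a \<kappa> L k z) = u powr (- a) * norm \<Lambda> powr (- \<kappa>)" .
  show "norm (log_singular a \<kappa> L k z) \<le> power_log L a \<kappa> (norm (1 - z $ k))"
    unfolding N power_log_def u_def[symmetric] using \<Lambda> \<kappa> by (intro mult_left_mono powr_mono2') auto
  show "power_log (L + 2) a \<kappa> (norm (1 - z $ k)) \<le> norm (log_singular a \<kappa> L k z)"
    unfolding N power_log_def u_def[symmetric] using \<Lambda> \<kappa> by (intro mult_left_mono powr_mono2') auto
qed

lemma norm_1_minus_dilate:
  fixes \<zeta> :: complex
  assumes \<zeta>: "norm \<zeta> \<le> 1" and s: "0 \<le> s" "s \<le> 1"
  shows "norm (1 - of_real s * \<zeta>) \<le> norm (1 - \<zeta>) + (1 - s)"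
    and "1 - s \<le> norm (1 - of_real s * \<zeta>)"
    and "norm (1 - \<zeta>) \<le> 2 * norm (1 - of_real s * \<zeta>)"
proof -
  have "norm (of_real (1 - s) * \<zeta>) = (1 - s) * norm \<zeta>" using s by (simp only: norm_mult norm_of_real)
  also have "\<dots> \<le> (1 - s) * 1" using s \<zeta> by (intro mult_left_mono) auto
  finally have d: "norm (of_real (1 - s) * \<zeta>) \<le> 1 - s" by simp
  have e1: "1 - of_real s * \<zeta> = (1 - \<zeta>) + of_real (1 - s) * \<zeta>" by (simp add: algebra_simps)
  show "norm (1 - of_real s * \<zeta>) \<le> norm (1 - \<zeta>) + (1 - s)"
    unfolding e1 by (rule order_trans[OF norm_triangle_ineq add_left_mono[OF d]])
  have "s * norm \<zeta> \<le> s" using mult_left_mono[OF \<zeta> s(1)] by simp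
  then show l: "1 - s \<le> norm (1 - of_real s * \<zeta>)"
    using norm_triangle_ineq2[of 1 "of_real s * \<zeta>"] s by (simp add: norm_mult)
  have e2: "1 - \<zeta> = (1 - of_real s * \<zeta>) - of_real (1 - s) * \<zeta>" by (simp add: algebra_simps)
  have "norm (1 - \<zeta>) \<le> norm (1 - of_real s * \<zeta>) + norm (of_real (1 - s) * \<zeta>)"
    by (subst e2) (rule norm_triangle_ineq4)
  then show "norm (1 - \<zeta>) \<le> 2 * norm (1 - of_real s * \<zeta>)"
    using d l by linarith
qed

section \<open>Divergence of the p-th means\<close>

text \<open>Geometric growth makes the sum comparable to its last term. The induction step needs
  \<open>4 / (k + 1) \<le> 6 / (k + 2)\<close>, which holds for \<open>k \<ge> 1\<close> and fixes
  the constant 4; the step from 0 is separate.\<close>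

lemma sum_dyadic_harmonic_le:
  fixes n k :: nat
  assumes n: "1 \<le> n"
  shows "(\<Sum>j\<le>k. (2::real) ^ (j * n) / (real j + 1)) \<le> 4 * 2 ^ (k * n) / (real k + 1)"
proof (induction k)
  case (Suc k)
  define x where "x = (2::real) ^ (k * n)"
  define y where "y = (2::real) ^ n"
  have x: "0 < x" by (simp add: x_def)
  have y: "2 \<le> y" using power_increasing[OF n, of "2::real"] by (simp add: y_def)
  have e: "(2::real) ^ (Suc k * n) = x * y" by (simp add: x_def y_def power_add)
  show ?case
  proof (cases "k = 0")
    case True
    then show ?thesis using y by (simp add: y_def)
  next
    case False
    then have k: "1 \<le> real k" by simp
    have "4 * x / (real k + 1) \<le> 3 * (x * 2) / (real k + 2)"
      using k x by (simp add: field_simps)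
    also have "\<dots> \<le> 3 * (x * y) / (real k + 2)"
      using k x y by (intro divide_right_mono mult_left_mono) auto
    finally have "4 * x / (real k + 1) \<le> 3 * (x * y) / (real k + 2)" .
    moreover have "(\<Sum>j\<le>Suc k. (2::real) ^ (j * n) / (real j + 1)) \<le> 4 * x / (real k + 1) + x * y / (real k + 2)"
      using Suc e by (simp add: x_def add.commute)
    moreover have "3 * (x * y) / (real k + 2) + x * y / (real k + 2) = 4 * 2 ^ (Suc k * n) / (real (Suc k) + 1)"
      unfolding e by (simp add: add_divide_distrib[symmetric] add.commute)
    ultimately show ?thesis by linarith
  qed
qed simp

lemma borel_measurable_cap_indicator:
  "(\<lambda>\<zeta>. c * indicator (cap k d) \<zeta> :: ennreal) \<in> borel_measurable sphere_measure"
  by (rule measurable_on_sphere) measurable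

text \<open>On the cap of radius \<open>2^-j\<close> the p-th power of the function is at least of
  order \<open>2^(jn) / (j + 1)\<close>, and the cap has measure at least of order
  \<open>2^(-jn)\<close>. Bounded means would therefore bound the harmonic series.\<close>

lemma log_singular_not_hardy:
  fixes k :: "'n::finite"
  assumes p: "0 < p" and L: "1 \<le> L"
  shows "log_singular (real CARD('n) / p) (1 / p) L k \<notin> hardy p"
proof
  let ?n = "CARD('n)" and ?\<sigma> = "sphere_measure :: (complex^'n) measure"
  let ?f = "log_singular (real ?n / p) (1 / p) L k"
  have n: "1 \<le> ?n" by (simp add: Suc_leI)
  assume "?f \<in> hardy p"
  then obtain K where K: "K \<ge> 0" "\<And>s. s \<in> {0..<1} \<Longrightarrow> (\<integral>\<^sup>+\<zeta>. ennreal (norm (?f (s *\<^sub>R \<zeta>)) powr p) \<partial>?\<sigma>) \<le> ennreal K"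
    using hardy_iff[OF p, of ?f] by blast
  obtain c where c: "0 < c" "\<And>d. 0 < d \<Longrightarrow> d \<le> 1 \<Longrightarrow> ennreal (c * d ^ ?n) \<le> emeasure ?\<sigma> (cap k d)"
    using emeasure_cap_ge[of k] by blast
  \<comment> \<open>The factor 4 comes from the dyadic sum, \<open>2^n\<close> from
    \<open>u \<le> 2 * 2^-i\<close>, and \<open>L + 2\<close> from estimating the logarithmic term
    by \<open>(L + 2) * (i + 1)\<close>.\<close>
  define M where "M = 4 * 2 ^ ?n * (L + 2)"
  have hp: "0 < (1/2::real) ^ Suc J \<and> (1/2::real) ^ Suc J \<le> 1" for J
    by (simp add: power_le_one del: power_Suc)
  have M: "0 < M" using L by (simp add: M_def)
  \<comment> \<open>The minorant is a sum over nested caps instead of disjoint annuli, so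
    integrating it calls only for lower bounds on cap measures. The radius
    \<open>1 - 2^-(J+1)\<close> resolves the singularity down to level \<open>J\<close>.\<close>
  have low: "1 / M * (\<Sum>j\<le>J. 2 ^ (j * ?n) / (real j + 1) * indicator (cap k ((1 / 2) ^ j)) \<zeta>) \<le> norm (?f ((1 - (1/2) ^ (Suc J)) *\<^sub>R \<zeta>)) powr p"
    if \<zeta>: "norm \<zeta> = 1" for J \<zeta>
  proof (cases "\<exists>j\<le>J. \<zeta> \<in> cap k ((1 / 2) ^ j)")
    case False
    then have "(\<Sum>j\<le>J. 2 ^ (j * ?n) / (real j + 1) * indicator (cap k ((1 / 2) ^ j)) \<zeta> :: real) = 0"
      by (intro sum.neutral) auto
    then show ?thesis by simp
  next
    case True
    \<comment> \<open>The smallest of the caps that contains \<open>\<zeta>\<close>: exactly the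
      levels up to \<open>i\<close> can contribute to the sum at this point.\<close>
    define i where "i = Max {j. j \<le> J \<and> \<zeta> \<in> cap k ((1 / 2) ^ j)}"
    have fin: "finite {j. j \<le> J \<and> \<zeta> \<in> cap k ((1 / 2) ^ j)}" by simp
    have "i \<in> {j. j \<le> J \<and> \<zeta> \<in> cap k ((1 / 2) ^ j)}" unfolding i_def by (rule Max_in[OF fin]) (use True in auto)
    then have i: "i \<le> J" "norm (1 - \<zeta> $ k) \<le> (1/2) ^ i" by (auto simp: cap_def)
    have imax: "j \<le> i" if "j \<le> J" "\<zeta> \<in> cap k ((1 / 2) ^ j)" for j
      unfolding i_def by (rule Max_ge[OF fin]) (use that in auto)
    define s where "s = 1 - (1/2 :: real) ^ (Suc J)"
    have s: "0 \<le> s" "s < 1" using hp[of J] by (auto simp: s_def simp del: power_Suc)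
    have \<zeta>k: "norm (\<zeta> $ k) \<le> 1" using Finite_Cartesian_Product.norm_nth_le[of \<zeta> k] \<zeta> by simp
    define u where "u = norm (1 - of_real s * \<zeta> $ k)"
    have "1 - s \<le> (1/2) ^ i"
      unfolding s_def using power_decreasing[of i "Suc J" "1/2::real"] i by simp
    then have u: "u \<le> 2 * (1/2) ^ i" "0 < u"
      using norm_1_minus_dilate(1,2)[OF \<zeta>k, of s] s i by (auto simp: u_def)
    have "(\<Sum>j\<le>J. 2 ^ (j * ?n) / (real j + 1) * indicator (cap k ((1 / 2) ^ j)) \<zeta>) \<le> (\<Sum>j\<le>i. (2::real) ^ (j * ?n) / (real j + 1))"
    proof -
      have "(\<Sum>j\<le>J. (2::real) ^ (j * ?n) / (real j + 1) * indicator (cap k ((1 / 2) ^ j)) \<zeta>)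
        = (\<Sum>j\<le>i. 2 ^ (j * ?n) / (real j + 1) * indicator (cap k ((1 / 2) ^ j)) \<zeta>)"
        by (rule sum.mono_neutral_right) (use i imax in \<open>auto simp: indicator_def\<close>)
      also have "\<dots> \<le> (\<Sum>j\<le>i. (2::real) ^ (j * ?n) / (real j + 1))"
        by (intro sum_mono mult_left_le) (auto simp: indicator_def)
      finally show ?thesis .
    qed
    also have "\<dots> \<le> 4 * 2 ^ (i * ?n) / (real i + 1)" by (rule sum_dyadic_harmonic_le[OF n])
    also have "\<dots> \<le> M * power_log (L + 2) (real ?n) 1 (2 * (1/2) ^ i)"
    proof -
      have l: "L + 2 - ln (2 * (1/2) ^ i) = L + 2 - ln 2 + real i * ln 2" by (simp add: ln_mult ln_realpow ln_div)
      have ln2: "0 < ln (2::real)" "ln (2::real) < 1" using ln_2_less_1 by auto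
      have "L + 2 - ln (2 * (1/2) ^ i) \<le> (L + 2) + real i * 1"
        unfolding l using ln2 by (intro add_mono mult_left_mono) auto
      also have "\<dots> \<le> (L + 2) * (real i + 1)" using L by (simp add: algebra_simps mult_left_le_one_le)
      finally have l2: "L + 2 - ln (2 * (1/2) ^ i) \<le> (L + 2) * (real i + 1)" .
      have l0: "0 < L + 2 - ln (2 * (1/2) ^ i)" unfolding l using L ln2 by (simp add: add_pos_nonneg)
      have pw: "(2 * (1/2::real) ^ i) powr (- real ?n) = 2 ^ (i * ?n) / 2 ^ ?n"
        by (simp add: powr_minus powr_realpow power_mult_distrib power_mult[symmetric] power_divide field_simps)
      define l where "l = L + 2 - ln (2 * (1/2) ^ i)"
      have L0: "L + 2 \<noteq> 0" using L by simp
      have lp: "l powr (- 1) = 1 / l" using l0 by (simp add: l_def[symmetric] powr_minus_divide)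
      have "M * power_log (L + 2) (real ?n) 1 (2 * (1/2) ^ i) = 4 * (L + 2) * 2 ^ (i * ?n) / l"
        unfolding power_log_def pw l_def[symmetric] lp by (simp add: M_def)
      also have "\<dots> = 4 * (L + 2) * 2 ^ (i * ?n) / (L + 2 - ln (2 * (1/2) ^ i))"
        unfolding l_def ..
      also have "\<dots> \<ge> 4 * (L + 2) * 2 ^ (i * ?n) / ((L + 2) * (real i + 1))"
        using l0 l2 L by (intro divide_left_mono mult_pos_pos) auto
      finally have "4 * (L + 2) * 2 ^ (i * ?n) / ((L + 2) * (real i + 1)) \<le> M * power_log (L + 2) (real ?n) 1 (2 * (1/2) ^ i)" .
      moreover have "4 * y * X / (y * r) = 4 * X / r" if "y \<noteq> 0" for y X r :: real using that by simp
      ultimately show ?thesis using L0 by metis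
    qed
    also have "\<dots> \<le> M * power_log (L + 2) (real ?n) 1 u"
    proof (intro mult_left_mono power_log_antimono u)
      have "ln (2 * (1/2::real) ^ i) \<le> ln 2" by (simp add: power_le_one)
      then have l1: "1 \<le> L + 2 - ln (2 * (1/2) ^ i)" using L ln_2_less_1 by linarith
      then show "0 < L + 2 - ln (2 * (1/2) ^ i)" by simp
      have "1 * 1 \<le> real ?n * (L + 2 - ln (2 * (1/2) ^ i))" using l1 n by (intro mult_mono) auto
      then show "1 \<le> real ?n * (L + 2 - ln (2 * (1/2) ^ i))" by simp
    qed (use M in auto)
    finally have S: "(\<Sum>j\<le>J. 2 ^ (j * ?n) / (real j + 1) * indicator (cap k ((1 / 2) ^ j)) \<zeta>) \<le> M * power_log (L + 2) (real ?n) 1 u" .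
    have "power_log (L + 2) (real ?n) 1 u = (power_log (L + 2) (real ?n / p) (1 / p) u) powr p"
      using p by (simp add: power_log_def powr_mult powr_powr)
    also have "\<dots> \<le> norm (?f (s *\<^sub>R \<zeta>)) powr p"
      using norm_log_singular(2)[of "s *\<^sub>R \<zeta>" L "1 / p" "real ?n / p" k] s \<zeta> L p
      by (intro powr_mono2) (auto simp: power_log_nonneg u_def scaleR_conv_of_real[where 'a=complex])
    finally have "M * power_log (L + 2) (real ?n) 1 u \<le> M * norm (?f (s *\<^sub>R \<zeta>)) powr p" using M by (intro mult_left_mono) auto
    with S have "(\<Sum>j\<le>J. 2 ^ (j * ?n) / (real j + 1) * indicator (cap k ((1 / 2) ^ j)) \<zeta>) \<le> M * norm (?f (s *\<^sub>R \<zeta>)) powr p" by linarith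
    then show ?thesis using M by (simp add: s_def field_simps)
  qed
  have "(\<Sum>j\<le>J. c / M * (1 / (real j + 1))) \<le> K" for J
  proof -
    have "ennreal (\<Sum>j\<le>J. c / M * (1 / (real j + 1))) = (\<Sum>j\<le>J. ennreal (c / M * (1 / (real j + 1))))"
      using c M by (intro sum_ennreal[symmetric]) auto
    also have "\<dots> \<le> (\<Sum>j\<le>J. ennreal (1 / M * (2 ^ (j * ?n) / (real j + 1))) * emeasure ?\<sigma> (cap k ((1/2) ^ j)))"
    proof (rule sum_mono)
      fix j
      have "ennreal (c / M * (1 / (real j + 1))) = ennreal (1 / M * (2 ^ (j * ?n) / (real j + 1))) * ennreal (c * ((1/2) ^ j) ^ ?n)"
        using M c by (subst ennreal_mult[symmetric]) (auto simp: power_mult[symmetric] power_divide)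
      also have "\<dots> \<le> ennreal (1 / M * (2 ^ (j * ?n) / (real j + 1))) * emeasure ?\<sigma> (cap k ((1/2) ^ j))"
        by (intro mult_left_mono c(2)) (auto simp: power_le_one)
      finally show "ennreal (c / M * (1 / (real j + 1))) \<le> \<dots>" .
    qed
    also have "\<dots> = (\<integral>\<^sup>+\<zeta>. (\<Sum>j\<le>J. ennreal (1 / M * (2 ^ (j * ?n) / (real j + 1))) * indicator (cap k ((1/2) ^ j)) \<zeta>) \<partial>?\<sigma>)"
    proof -
      have "(\<integral>\<^sup>+\<zeta>. (\<Sum>j\<le>J. ennreal (1 / M * (2 ^ (j * ?n) / (real j + 1))) * indicator (cap k ((1/2) ^ j)) \<zeta>) \<partial>?\<sigma>)
        = (\<Sum>j\<le>J. \<integral>\<^sup>+\<zeta>. ennreal (1 / M * (2 ^ (j * ?n) / (real j + 1))) * indicator (cap k ((1/2) ^ j)) \<zeta> \<partial>?\<sigma>)"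
        by (rule nn_integral_sum) (rule borel_measurable_cap_indicator)
      also have "\<dots> = (\<Sum>j\<le>J. ennreal (1 / M * (2 ^ (j * ?n) / (real j + 1))) * emeasure ?\<sigma> (cap k ((1/2) ^ j)))"
        by (intro sum.cong refl nn_integral_cmult_indicator cap_sets)
      finally show ?thesis ..
    qed
    also have "\<dots> = (\<integral>\<^sup>+\<zeta>. ennreal (1 / M * (\<Sum>j\<le>J. 2 ^ (j * ?n) / (real j + 1) * indicator (cap k ((1/2) ^ j)) \<zeta>)) \<partial>?\<sigma>)"
    proof (rule nn_integral_cong)
      fix \<zeta> :: "complex^'n"
      have "ennreal (1 / M * (\<Sum>j\<le>J. 2 ^ (j * ?n) / (real j + 1) * indicator (cap k ((1/2) ^ j)) \<zeta>))
        = ennreal (\<Sum>j\<le>J. 1 / M * (2 ^ (j * ?n) / (real j + 1)) * indicator (cap k ((1/2) ^ j)) \<zeta>)"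
        by (simp add: sum_distrib_left mult.assoc)
      also have "\<dots> = (\<Sum>j\<le>J. ennreal (1 / M * (2 ^ (j * ?n) / (real j + 1)) * indicator (cap k ((1/2) ^ j)) \<zeta>))"
        using M by (intro sum_ennreal[symmetric]) auto
      also have "\<dots> = (\<Sum>j\<le>J. ennreal (1 / M * (2 ^ (j * ?n) / (real j + 1))) * indicator (cap k ((1/2) ^ j)) \<zeta>)"
        by (intro sum.cong refl) (auto simp: indicator_def)
      finally show "(\<Sum>j\<le>J. ennreal (1 / M * (2 ^ (j * ?n) / (real j + 1))) * indicator (cap k ((1/2) ^ j)) \<zeta>)
         = ennreal (1 / M * (\<Sum>j\<le>J. 2 ^ (j * ?n) / (real j + 1) * indicator (cap k ((1/2) ^ j)) \<zeta>))" ..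
    qed
    also have "\<dots> \<le> (\<integral>\<^sup>+\<zeta>. ennreal (norm (?f ((1 - (1/2) ^ (Suc J)) *\<^sub>R \<zeta>)) powr p) \<partial>?\<sigma>)"
      by (intro nn_integral_mono ennreal_leI low) simp
    also have "\<dots> \<le> ennreal K" by (rule K(2)) (use hp[of J] in \<open>auto simp del: power_Suc\<close>)
    finally show ?thesis using K(1) by (simp add: ennreal_le_iff)
  qed
  then have "summable (\<lambda>j. c / M * (1 / (real j + 1)))"
    using c M by (intro bounded_imp_summable[where B = K]) auto
  then have "summable (\<lambda>j. M / c * (c / M * (1 / (real j + 1))))" by (rule summable_mult)
  then have "summable (\<lambda>j. 1 / (real j + 1))" using c M by simp
  then have "summable (\<lambda>j. inverse (real (Suc j)))" by (simp add: inverse_eq_divide add.commute)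
  then show False using not_summable_harmonic[where 'a=real] summable_Suc_iff[of "\<lambda>j. inverse (real j)"] by blast
qed

section \<open>Boundedness of the q-th means after integration\<close>

text \<open>At distance \<open>v\<close> from the singularity the Volterra integral is of size
  \<open>v^-b\<close> with the logarithmic factor unchanged, because the function at parameter
  \<open>t\<close> is dominated by its model at \<open>max (1 - t) v\<close>. As
  \<open>b q = n\<close>, summing q-th powers over dyadic caps leaves a series with exponent
  \<open>q / p > 1\<close>.\<close>

lemma log_singular_volterra:
  fixes k :: "'n::finite" and g :: "complex^'n \<Rightarrow> complex"
  assumes p: "0 < p" and pq: "p < q" and \<alpha>: "\<alpha> = 1 + real CARD('n) / q - real CARD('n) / p" "0 \<le> \<alpha>"
    and L: "L = 2 * q / (p * real CARD('n)) + 2" and g: "g \<in> bloch \<alpha>"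
  shows "volterra g (log_singular (real CARD('n) / p) (1 / p) L k) \<in> hardy q"
proof -
  let ?n = "CARD('n)" and ?\<sigma> = "sphere_measure :: (complex^'n) measure"
  define a where "a = real ?n / p"
  define b where "b = real ?n / q"
  define \<beta> where "\<beta> = 1 - \<alpha>"
  define \<kappa> where "\<kappa> = 1 / p"
  let ?f = "log_singular a \<kappa> L k"
  have n: "0 < real ?n" by simp
  have q: "0 < q" using p pq by simp
  have b: "0 < b" and a: "0 < a" and ab: "a = b + \<beta>" using p q n \<alpha> by (auto simp: a_def b_def \<beta>_def)
  have \<beta>: "0 < \<beta>" using p pq n by (simp add: \<beta>_def \<alpha> divide_strict_left_mono)
  have L1: "1 \<le> L" using p q n unfolding L by (simp add: add_nonneg_nonneg)
  have \<kappa>: "0 \<le> \<kappa>" using p by (simp add: \<kappa>_def)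
  \<comment> \<open>The value of \<open>L\<close> is made for this inequality: it is the
    monotonicity condition for exponent \<open>b / 2\<close> on the interval \<open>(0, 2]\<close>,
    where \<open>ln u < 1\<close>.\<close>
  have Lb: "2 * \<kappa> \<le> b * (L - 1)"
  proof -
    have "b * (L - 1) = 2 * \<kappa> + b" using p q n by (simp add: L b_def \<kappa>_def field_simps)
    then show ?thesis using b by simp
  qed
  have lnu: "L - 1 \<le> L - ln u" "0 < L - ln u" if "0 < u" "u \<le> 2" for u
  proof -
    have "ln u \<le> ln 2" using that by simp
    then show "L - 1 \<le> L - ln u" "0 < L - ln u" using ln_2_less_1 L1 by linarith+
  qed
  have anti_b: "power_log L (b / 2) \<kappa> v \<le> power_log L (b / 2) \<kappa> u" if "0 < u" "u \<le> v" "v \<le> 2" for u v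
  proof (rule power_log_antimono[OF that(1,2) _ \<kappa>])
    have "\<kappa> \<le> b / 2 * (L - 1)" using Lb by simp
    also have "\<dots> \<le> b / 2 * (L - ln v)" using b lnu(1)[of v] that by (intro mult_left_mono) auto
    finally show "\<kappa> \<le> b / 2 * (L - ln v)" .
  qed (use lnu that in auto)
  have anti_a: "power_log L a \<kappa> v \<le> power_log L a \<kappa> u" if "0 < u" "u \<le> v" "v \<le> 2" for u v
  proof (rule power_log_antimono[OF that(1,2) _ \<kappa>])
    have "\<kappa> \<le> b * (L - 1)" using Lb \<kappa> by simp
    also have "\<dots> \<le> a * (L - ln v)" using b ab \<beta> L1 lnu(1)[of v] that by (intro mult_mono) auto
    finally show "\<kappa> \<le> a * (L - ln v)" .
  qed (use lnu that in auto)
  have anti_n: "power_log L (real ?n) (\<kappa> * q) v \<le> power_log L (real ?n) (\<kappa> * q) u" if "0 < u" "u \<le> v" "v \<le> 2" for u v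
  proof (rule power_log_antimono[OF that(1,2)])
    have "\<kappa> * q \<le> b * (L - 1) * q" using Lb \<kappa> q by (intro mult_right_mono) auto
    also have "\<dots> = real ?n * (L - 1)" using q by (simp add: b_def)
    also have "\<dots> \<le> real ?n * (L - ln v)" using lnu(1)[of v] that by (intro mult_left_mono) auto
    finally show "\<kappa> * q \<le> real ?n * (L - ln v)" .
  qed (use lnu that \<kappa> q in auto)
  have fh: "?f \<in> holo_ball" by (rule log_singular_holo_ball[OF L1])
  have gh: "g \<in> holo_ball" using g \<alpha>(2) by (simp add: bloch_def)
  have Th: "volterra g ?f \<in> holo_ball" by (rule volterra_holo_ball[OF fh gh])
  obtain C where C: "C \<ge> 0" "\<And>s \<zeta>. 0 < s \<Longrightarrow> s < 1 \<Longrightarrow> norm \<zeta> = 1 \<Longrightarrow>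
    (\<exists>F. continuous_on {0..1} F \<and> volterra g ?f (s *\<^sub>R \<zeta>) = integral {0..1} F \<and>
      (\<forall>t\<in>{0..<1}. norm (F t) \<le> C * norm (?f ((s * t) *\<^sub>R \<zeta>)) * (1 - t) powr (- \<alpha>)))"
    using volterra_integrand_bound[OF g \<alpha>(2)] fh by blast
  define D where "D = (C * (2 / b + 1 / \<beta>)) powr q"
  \<comment> \<open>Half the distance of \<open>s * \<zeta>_k\<close> from 1 is taken, since
    \<open>v \<le> 1\<close> is needed for a splitting point and
    \<open>v \<le> |1 - t s \<zeta>_k|\<close> for every \<open>t\<close> in between.\<close>
  have pointwise: "norm (volterra g ?f (s *\<^sub>R \<zeta>)) powr q \<le> D * power_log L (real ?n) (\<kappa> * q) v"
    if s: "0 < s" "s < 1" and \<zeta>: "norm \<zeta> = 1" and v: "v = norm (1 - of_real s * \<zeta> $ k) / 2" for s \<zeta> v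
  proof -
    obtain F where F: "continuous_on {0..1} F" "volterra g ?f (s *\<^sub>R \<zeta>) = integral {0..1} F"
      "\<And>t. t \<in> {0..<1} \<Longrightarrow> norm (F t) \<le> C * norm (?f ((s * t) *\<^sub>R \<zeta>)) * (1 - t) powr (- \<alpha>)"
      using C(2)[OF s \<zeta>] by blast
    have \<zeta>k: "norm (\<zeta> $ k) \<le> 1" using Finite_Cartesian_Product.norm_nth_le[of \<zeta> k] \<zeta> by simp
    have sk: "norm (of_real s * \<zeta> $ k) \<le> s" using mult_left_mono[OF \<zeta>k, of s] s by (simp add: norm_mult)
    have v0: "0 < v" unfolding v using norm_1_minus_dilate(2)[OF \<zeta>k, of s] s by linarith
    have v1: "v \<le> 1" using norm_triangle_ineq4[of 1 "of_real s * \<zeta> $ k"] sk s by (simp add: v)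
    have ft: "norm (?f ((s * t) *\<^sub>R \<zeta>)) \<le> power_log L a \<kappa> (max (1 - t) v)" if t: "0 \<le> t" "t < 1" for t
    proof -
      define u where "u = norm (1 - of_real t * (of_real s * \<zeta> $ k))"
      have sk1: "norm (of_real s * \<zeta> $ k) \<le> 1" using sk s by simp
      have u1: "1 - t \<le> u" "2 * v \<le> 2 * u" using norm_1_minus_dilate(2,3)[OF sk1, of t] t by (auto simp: u_def v)
      have "norm (of_real t * (of_real s * \<zeta> $ k)) \<le> 1" using mult_mono[of t 1 "norm (of_real s * \<zeta> $ k)" 1] sk1 t by (simp add: norm_mult)
      then have u2: "u \<le> 2" unfolding u_def using norm_triangle_ineq4[of 1 "of_real t * (of_real s * \<zeta> $ k)"] by simp
      have st: "0 \<le> s * t" "s * t < 1" using s t mult_strict_mono'[of s 1 t 1] by auto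
      have "norm (1 - ((s * t) *\<^sub>R \<zeta>) $ k) = u"
        by (simp add: u_def scaleR_conv_of_real[where 'a=complex] mult_ac)
      then have "norm (?f ((s * t) *\<^sub>R \<zeta>)) \<le> power_log L a \<kappa> u"
        using norm_log_singular(1)[of "(s * t) *\<^sub>R \<zeta>" L \<kappa> a k] st \<zeta> L1 \<kappa> by (simp add: abs_mult)
      also have "\<dots> \<le> power_log L a \<kappa> (max (1 - t) v)" using u1 u2 t v0 by (intro anti_a) auto
      finally show ?thesis .
    qed
    have "norm (integral {0..1} F) \<le> C * power_log L (b / 2) \<kappa> v * v powr (- (b / 2)) / (b / 2) + C * power_log L a \<kappa> v * v powr \<beta> / \<beta>"
    proof (rule integral_split_power_bound[OF F(1) v0 v1 _ \<beta>])
      fix t :: real assume t: "0 \<le> t" "t \<le> 1 - v"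
      then have t1: "t < 1" "v \<le> 1 - t" using v0 by auto
      have "norm (?f ((s * t) *\<^sub>R \<zeta>)) \<le> power_log L a \<kappa> (1 - t)" using ft[OF t(1) t1(1)] t1 by (simp add: max_def split: if_splits)
      \<comment> \<open>Half of the exponent \<open>b\<close> stays with the logarithm, so that
        monotonicity allows that factor to be frozen at \<open>v\<close>; the other half remains as
        the power integrated over \<open>{0..1 - v}\<close>.\<close>
      also have "\<dots> = (1 - t) powr (- a + b / 2) * power_log L (b / 2) \<kappa> (1 - t)"
        unfolding power_log_def mult.assoc[symmetric] powr_add[symmetric] by simp
      also have "\<dots> \<le> (1 - t) powr (- a + b / 2) * power_log L (b / 2) \<kappa> v"
        using anti_b[of v "1 - t"] v0 t1 t by (intro mult_left_mono) auto
      finally have "C * norm (?f ((s * t) *\<^sub>R \<zeta>)) * (1 - t) powr (- \<alpha>) \<le> C * ((1 - t) powr (- a + b / 2) * power_log L (b / 2) \<kappa> v) * (1 - t) powr (- \<alpha>)"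
        using C(1) by (intro mult_right_mono mult_left_mono) auto
      also have "\<dots> = C * power_log L (b / 2) \<kappa> v * ((1 - t) powr (- a + b / 2) * (1 - t) powr (- \<alpha>))" by simp
      also have "(1 - t) powr (- a + b / 2) * (1 - t) powr (- \<alpha>) = (1 - t) powr (- (b / 2) - 1)"
        unfolding powr_add[symmetric] by (rule arg_cong[where f="\<lambda>x. _ powr x"]) (simp add: ab \<beta>_def field_simps)
      finally show "norm (F t) \<le> C * power_log L (b / 2) \<kappa> v * (1 - t) powr (- (b / 2) - 1)"
        using F(3)[of t] t t1 by simp
    next
      fix t :: real assume t: "1 - v \<le> t" "t < 1"
      then have t0: "0 \<le> t" using v1 by simp
      have "norm (?f ((s * t) *\<^sub>R \<zeta>)) \<le> power_log L a \<kappa> v" using ft[OF t0 t(2)] t by (simp add: max_def split: if_splits)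
      then have "C * norm (?f ((s * t) *\<^sub>R \<zeta>)) * (1 - t) powr (- \<alpha>) \<le> C * power_log L a \<kappa> v * (1 - t) powr (- \<alpha>)"
        using C(1) by (intro mult_right_mono mult_left_mono) auto
      then show "norm (F t) \<le> C * power_log L a \<kappa> v * (1 - t) powr (\<beta> - 1)"
        using F(3)[of t] t t0 by (simp add: \<beta>_def)
    qed (use b C(1) power_log_nonneg in auto)
    also have "C * power_log L (b / 2) \<kappa> v * v powr (- (b / 2)) / (b / 2) = C * (2 / b) * power_log L b \<kappa> v"
    proof -
      have "power_log L (b / 2) \<kappa> v * v powr (- (b / 2)) = power_log L b \<kappa> v"
        unfolding power_log_def by (simp add: mult.commute mult.left_commute powr_add[symmetric])
      then show ?thesis by (simp add: mult.assoc)
    qed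
    also have "C * power_log L a \<kappa> v * v powr \<beta> / \<beta> = C * (1 / \<beta>) * power_log L b \<kappa> v"
    proof -
      have "power_log L a \<kappa> v * v powr \<beta> = (v powr (- a) * v powr \<beta>) * (L - ln v) powr (- \<kappa>)"
        unfolding power_log_def by simp
      also have "v powr (- a) * v powr \<beta> = v powr (- b)" unfolding powr_add[symmetric] by (simp add: ab)
      finally have "power_log L a \<kappa> v * v powr \<beta> = power_log L b \<kappa> v" by (simp add: power_log_def)
      then show ?thesis by (simp add: mult.assoc)
    qed
    also have "C * (2 / b) * power_log L b \<kappa> v + C * (1 / \<beta>) * power_log L b \<kappa> v = C * (2 / b + 1 / \<beta>) * power_log L b \<kappa> v"
      by (simp add: algebra_simps)
    finally have "norm (volterra g ?f (s *\<^sub>R \<zeta>)) powr q \<le> (C * (2 / b + 1 / \<beta>) * power_log L b \<kappa> v) powr q"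
      unfolding F(2) using q by (intro powr_mono2) auto
    also have "\<dots> = D * (power_log L b \<kappa> v) powr q" by (simp add: D_def powr_mult)
    also have "(power_log L b \<kappa> v) powr q = power_log L (real ?n) (\<kappa> * q) v"
      using q by (simp add: power_log_def powr_mult powr_powr b_def)
    finally show ?thesis .
  qed
  obtain Cc where Cc: "1 \<le> Cc" "\<And>d. 0 < d \<Longrightarrow> emeasure ?\<sigma> (cap k d) \<le> ennreal (Cc * d ^ ?n)"
    using emeasure_cap_le[of k] by blast
  \<comment> \<open>Level \<open>j\<close> means \<open>2^-(j+1) < v \<le> 2^-j\<close>. The model
    is largest at the lower end, and \<open>|1 - \<zeta>_k| \<le> 4 v\<close> puts
    \<open>\<zeta>\<close> into the cap of radius \<open>4 * 2^-j\<close>.\<close>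
  define W where "W = (\<lambda>j. D * power_log L (real ?n) (\<kappa> * q) ((1/2) ^ Suc j))"
  have D0: "0 \<le> D" by (simp add: D_def)
  have W0: "0 \<le> W j" for j unfolding W_def by (intro mult_nonneg_nonneg D0 power_log_nonneg)
  have Wle: "W j * (Cc * (4 * (1/2) ^ j) ^ ?n) \<le> (D * Cc * 8 ^ ?n * ln 2 powr (- (\<kappa> * q))) * real (Suc j) powr (- (\<kappa> * q))" for j
  proof -
    have "L - ln ((1/2) ^ Suc j) = L + real (Suc j) * ln 2" by (simp add: ln_realpow ln_div del: power_Suc of_nat_Suc)
    then have "(L - ln ((1/2) ^ Suc j)) powr (- (\<kappa> * q)) \<le> (real (Suc j) * ln 2) powr (- (\<kappa> * q))"
      using L1 \<kappa> q by (intro powr_mono2') (auto simp del: of_nat_Suc power_Suc)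
    also have "\<dots> = ln 2 powr (- (\<kappa> * q)) * real (Suc j) powr (- (\<kappa> * q))" by (simp add: powr_mult mult.commute del: of_nat_Suc)
    finally have 1: "(L - ln ((1/2) ^ Suc j)) powr (- (\<kappa> * q)) \<le> ln 2 powr (- (\<kappa> * q)) * real (Suc j) powr (- (\<kappa> * q))" .
    have 2: "((1/2::real) ^ Suc j) powr (- real ?n) * (4 * (1/2) ^ j) ^ ?n = 8 ^ ?n"
    proof -
      have "((1/2::real) ^ Suc j) powr (- real ?n) = inverse (((1/2) ^ Suc j) ^ ?n)"
        by (simp add: powr_minus powr_realpow del: power_Suc)
      then have "((1/2::real) ^ Suc j) powr (- real ?n) * (4 * (1/2) ^ j) ^ ?n = (inverse ((1/2) ^ Suc j) * (4 * (1/2) ^ j)) ^ ?n"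
        by (simp only: power_inverse power_mult_distrib)
      also have "inverse ((1/2) ^ Suc j) * (4 * (1/2::real) ^ j) = 8" by (simp add: power_divide)
      finally show ?thesis .
    qed
    have "W j * (Cc * (4 * (1/2) ^ j) ^ ?n) = D * Cc * (((1/2::real) ^ Suc j) powr (- real ?n) * (4 * (1/2) ^ j) ^ ?n) * (L - ln ((1/2) ^ Suc j)) powr (- (\<kappa> * q))"
      unfolding W_def power_log_def by (simp only: mult_ac)
    also have "\<dots> \<le> D * Cc * 8 ^ ?n * (ln 2 powr (- (\<kappa> * q)) * real (Suc j) powr (- (\<kappa> * q)))"
      unfolding 2 using 1 D0 Cc by (intro mult_left_mono) auto
    finally show ?thesis by (simp only: mult.assoc)
  qed
  have sum: "summable (\<lambda>j. W j * (Cc * (4 * (1/2) ^ j) ^ ?n))"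
  proof (rule summable_comparison_test')
    \<comment> \<open>Here \<open>\<kappa> * q = q / p\<close>; strictness of \<open>p < q\<close>
      makes the series converge.\<close>
    have "- (\<kappa> * q) < -1" using p pq by (simp add: \<kappa>_def)
    then have "summable (\<lambda>j. real j powr (- (\<kappa> * q)))" by (simp only: summable_real_powr_iff)
    then have "summable (\<lambda>j. real (Suc j) powr (- (\<kappa> * q)))" by (subst summable_Suc_iff)
    then show "summable (\<lambda>j. (D * Cc * 8 ^ ?n * ln 2 powr (- (\<kappa> * q))) * real (Suc j) powr (- (\<kappa> * q)))"
      by (rule summable_mult)
    show "norm (W j * (Cc * (4 * (1/2) ^ j) ^ ?n)) \<le> (D * Cc * 8 ^ ?n * ln 2 powr (- (\<kappa> * q))) * real (Suc j) powr (- (\<kappa> * q))" for j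
      using Wle[of j] W0[of j] Cc by simp
  qed
  define K where "K = (\<Sum>j. W j * (Cc * (4 * (1/2) ^ j) ^ ?n))"
  have K0: "0 \<le> K" unfolding K_def using W0 Cc by (intro suminf_nonneg[OF sum]) auto
  have bound: "(\<integral>\<^sup>+\<zeta>. ennreal (norm (volterra g ?f (s *\<^sub>R \<zeta>)) powr q) \<partial>?\<sigma>) \<le> ennreal K" if s: "s \<in> {0..<1}" for s
  proof (cases "s = 0")
    case True
    then show ?thesis by (simp add: volterra_0[OF gh])
  next
    case False
    then have s: "0 < s" "s < 1" using s by auto
    have "ennreal (norm (volterra g ?f (s *\<^sub>R \<zeta>)) powr q) \<le> (\<Sum>j. ennreal (W j) * indicator (cap k (4 * (1/2) ^ j)) \<zeta>)"
      if \<zeta>: "norm \<zeta> = 1" for \<zeta>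
    proof -
      define v where "v = norm (1 - of_real s * \<zeta> $ k) / 2"
      have \<zeta>k: "norm (\<zeta> $ k) \<le> 1" using Finite_Cartesian_Product.norm_nth_le[of \<zeta> k] \<zeta> by simp
      have sk: "norm (of_real s * \<zeta> $ k) \<le> s" using mult_left_mono[OF \<zeta>k, of s] s by (simp add: norm_mult)
      have v0: "0 < v" unfolding v_def using norm_1_minus_dilate(2)[OF \<zeta>k, of s] s by linarith
      have v1: "v \<le> 1" using norm_triangle_ineq4[of 1 "of_real s * \<zeta> $ k"] sk s by (simp add: v_def)
      obtain m where m: "(1/2::real) ^ m < v" using real_arch_pow_inv[OF v0, of "1/2"] by auto
      \<comment> \<open>The first dyadic power below \<open>v\<close>; it is not the zeroth one
        because \<open>v \<le> 1\<close>, so its predecessor locates \<open>v\<close> in a dyadic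
        interval.\<close>
      define i where "i = (LEAST m. (1/2::real) ^ m < v)"
      have i: "(1/2::real) ^ i < v" unfolding i_def using m by (rule LeastI)
      have "i \<noteq> 0" using i v1 by (cases i) auto
      then obtain j where j: "i = Suc j" by (cases i) auto
      have "\<not> (1/2::real) ^ j < v" using not_less_Least[of j "\<lambda>m. (1/2::real) ^ m < v"] j by (simp add: i_def)
      then have vj: "v \<le> (1/2) ^ j" by simp
      have "norm (1 - \<zeta> $ k) \<le> 4 * v" using norm_1_minus_dilate(3)[OF \<zeta>k, of s] s by (simp add: v_def)
      then have inc: "\<zeta> \<in> cap k (4 * (1/2) ^ j)" using vj \<zeta> by (simp add: cap_def)
      have "norm (volterra g ?f (s *\<^sub>R \<zeta>)) powr q \<le> D * power_log L (real ?n) (\<kappa> * q) v"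
        by (rule pointwise[OF s \<zeta> v_def])
      also have "\<dots> \<le> W j" unfolding W_def
        using i v1 j D0 by (intro mult_left_mono anti_n) auto
      finally have le: "norm (volterra g ?f (s *\<^sub>R \<zeta>)) powr q \<le> W j" .
      define h where "h = (\<lambda>j. ennreal (W j) * indicator (cap k (4 * (1/2) ^ j)) \<zeta>)"
      have "ennreal (norm (volterra g ?f (s *\<^sub>R \<zeta>)) powr q) \<le> h j"
        using inc le by (simp add: ennreal_leI h_def)
      also have "\<dots> = sum h {j}" by simp
      also have "\<dots> \<le> suminf h" by (rule sum_le_suminf) auto
      finally show ?thesis unfolding h_def .
    qed
    then have "(\<integral>\<^sup>+\<zeta>. ennreal (norm (volterra g ?f (s *\<^sub>R \<zeta>)) powr q) \<partial>?\<sigma>)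
      \<le> (\<integral>\<^sup>+\<zeta>. (\<Sum>j. ennreal (W j) * indicator (cap k (4 * (1/2) ^ j)) \<zeta>) \<partial>?\<sigma>)"
      by (intro nn_integral_mono) simp
    also have "\<dots> = (\<Sum>j. \<integral>\<^sup>+\<zeta>. ennreal (W j) * indicator (cap k (4 * (1/2) ^ j)) \<zeta> \<partial>?\<sigma>)"
      by (rule nn_integral_suminf) (rule borel_measurable_cap_indicator)
    also have "\<dots> = (\<Sum>j. ennreal (W j) * emeasure ?\<sigma> (cap k (4 * (1/2) ^ j)))"
      by (intro suminf_cong nn_integral_cmult_indicator cap_sets)
    also have "\<dots> \<le> (\<Sum>j. ennreal (W j * (Cc * (4 * (1/2) ^ j) ^ ?n)))"
    proof (intro suminf_le)
      fix j
      have "ennreal (W j) * emeasure ?\<sigma> (cap k (4 * (1/2) ^ j)) \<le> ennreal (W j) * ennreal (Cc * (4 * (1/2) ^ j) ^ ?n)"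
        by (intro mult_left_mono Cc(2)) auto
      also have "\<dots> = ennreal (W j * (Cc * (4 * (1/2) ^ j) ^ ?n))"
        using W0[of j] Cc by (intro ennreal_mult[symmetric]) auto
      finally show "ennreal (W j) * emeasure ?\<sigma> (cap k (4 * (1/2) ^ j)) \<le> \<dots>" .
    qed auto
    also have "\<dots> = ennreal K"
      unfolding K_def using W0 Cc by (intro suminf_ennreal2 sum) auto
    finally show ?thesis .
  qed
  have "volterra g ?f \<in> hardy q" unfolding hardy_iff[OF q]
    using Th K0 bound by blast
  then show ?thesis by (simp add: a_def \<kappa>_def)
qed

theorem proposition5:
  fixes p q \<alpha> :: real
  assumes "0 < p" and "p < q"
    and "\<alpha> = 1 + real CARD('n::finite) / q - real CARD('n) / p"
  shows "(hardy p :: (complex ^ 'n \<Rightarrow> complex) set) \<subset> optimal_domain_set (bloch \<alpha>) (hardy q)"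
proof -
  note p = assms(1) and pq = assms(2) and \<alpha> = assms(3)
  have q: "0 < q" using p pq by simp
  \<comment> \<open>Any coordinate serves. The witness depends on this coordinate alone and is the
    same for all \<open>g\<close>.\<close>
  obtain k :: 'n where True by simp
  define L where "L = 2 * q / (p * real CARD('n)) + 2"
  have L1: "1 \<le> L" using p q unfolding L_def by (simp add: add_nonneg_nonneg)
  define f :: "complex^'n \<Rightarrow> complex" where "f = log_singular (real CARD('n) / p) (1 / p) L k"
  have fh: "f \<in> holo_ball" unfolding f_def by (rule log_singular_holo_ball[OF L1])
  have fn: "f \<notin> hardy p" unfolding f_def by (rule log_singular_not_hardy[OF p L1])
  \<comment> \<open>Stated for arbitrary holomorphic \<open>h\<close>, so that it covers both the
    inclusion and the witness. \<open>g\<close> is constant only inside the ball, which is open, so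
    its derivatives still vanish there.\<close>
  have const: "volterra g h \<in> hardy q" if \<alpha>0: "\<alpha> < 0" and g: "g \<in> bloch \<alpha>" and h: "h \<in> holo_ball" for g h :: "complex^'n \<Rightarrow> complex"
  proof -
    have gh: "g \<in> holo_ball" and "\<exists>c. \<forall>z\<in>ball 0 1. g z = c" using g \<alpha>0 by (auto simp: bloch_def)
    then obtain c where c: "\<And>z. z \<in> ball 0 1 \<Longrightarrow> g z = c" by blast
    have R: "radial_deriv g z = 0" if z: "z \<in> ball 0 1" for z
    proof -
      have "((\<lambda>_. c) has_derivative (\<lambda>_. 0)) (at z)" by simp
      then have "(g has_derivative (\<lambda>_. 0)) (at z)"
        by (rule has_derivative_transform_within_open[of _ _ _ _ "ball 0 1"]) (use z c in auto)
      then show ?thesis using radial_deriv_eq[of g "\<lambda>_. 0" z] by simp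
    qed
    have V: "volterra g h z = 0" if z: "z \<in> ball 0 1" for z
    proof -
      have "volterra g h z = integral {0..1} (\<lambda>t::real. 0 :: complex)"
        unfolding volterra_def
      proof (rule integral_cong)
        fix t :: real assume "t \<in> {0..1}"
        then have "t *\<^sub>R z \<in> ball 0 1" using z mult_mono[of t 1 "norm z" "norm z"] by auto
        then show "h (t *\<^sub>R z) * radial_deriv g (t *\<^sub>R z) / of_real t = 0" using R by simp
      qed
      then show ?thesis by simp
    qed
    have "(\<integral>\<^sup>+\<zeta>. ennreal (norm (volterra g h (s *\<^sub>R \<zeta>)) powr q) \<partial>sphere_measure) \<le> ennreal 0" if "s \<in> {0..<1}" for s
    proof -
      have "(\<integral>\<^sup>+\<zeta>. ennreal (norm (volterra g h (s *\<^sub>R \<zeta>)) powr q) \<partial>sphere_measure) = (\<integral>\<^sup>+(\<zeta>::complex^'n). 0 \<partial>sphere_measure)"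
        by (intro nn_integral_cong) (use that V in auto)
      then show ?thesis by simp
    qed
    then show ?thesis unfolding hardy_iff[OF q] using volterra_holo_ball[OF h gh] by blast
  qed
  have sub: "h \<in> optimal_domain_set (bloch \<alpha>) (hardy q)" if h: "h \<in> hardy p" for h :: "complex^'n \<Rightarrow> complex"
  proof -
    have hh: "h \<in> holo_ball" using h by (simp add: hardy_def)
    have "volterra g h \<in> hardy q" if g: "g \<in> bloch \<alpha>" for g
      using const[OF _ g hh] volterra_mem_hardy[OF p pq \<alpha> _ h g] by (cases "\<alpha> < 0") auto
    then show ?thesis using hh by (auto simp: optimal_domain_set_def optimal_domain_def)
  qed
  have "f \<in> optimal_domain_set (bloch \<alpha>) (hardy q)"
  proof -
    have "volterra g f \<in> hardy q" if g: "g \<in> bloch \<alpha>" for g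
      using const[OF _ g fh] log_singular_volterra[OF p pq \<alpha> _ L_def g, of k] unfolding f_def by (cases "\<alpha> < 0") auto
    then show ?thesis using fh by (auto simp: optimal_domain_set_def optimal_domain_def)
  qed
  then show ?thesis using sub fn by blast
qed

end
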